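(* Let $n\ge 2$, and let $D$ be the sum of $c$ general hyperplanes in the complex projective space $\mathbb{P}^n$. Then the logarithmic cotangent bundle $\Omega_{\mathbb{P}^n}(\log D)$ is big if and only if $c\ge 2n+1$.
   Context: "$c$ general hyperplanes" means: for all $c$-tuples of hyperplanes in a nonempty Zariski-open subset of $((\mathbb{P}^n)^\ast)^c$; in particular such hyperplanes are in general position (the linear forms defining any $\min(c,n+1)$ of them are linearly independent). $\Omega_{\mathbb{P}^n}(\log D)$ is the vector bundle of logarithmic $1$-forms: in local coordinates with $D=(z_1\cdots z_r=0)$ it is generated by $\frac{dz_1}{z_1},\dots,\frac{dz_r}{z_r},dz_{r+1},\dots,dz_n$. A vector bundle $E$ is big if the tautological line bundle $\mathcal{O}_{\mathbb{P}(E)}(1)$ on the bundle $\mathbb{P}(E)$ of rank one quotients of $E$ is big. *)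

theory Defs
  imports
    "HOL-Analysis.Analysis"
    "HOL-Library.Function_Algebras"
    "HOL-Library.Extended_Real"
    "HOL-Library.Liminf_Limsup"
begin

text \<open>
  Conventions.  With \<open>CARD('n) = n + 1\<close>, points of complex projective \<open>n\<close>-space are given by
  homogeneous coordinate vectors, i.e. nonzero elements of \<^typ>\<open>complex ^ 'n\<close>, so that a set of
  points is a set of nonzero vectors stable under nonzero scaling.  Everything is algebraic:
  open means Zariski-open and functions are regular functions.
\<close>

section \<open>Polynomial functions, Zariski-open sets, regular functions\<close>

inductive_set polynomials :: "('a \<Rightarrow> complex) set \<Rightarrow> ('a \<Rightarrow> complex) set"
  for X :: "('a \<Rightarrow> complex) set" where
  coord: "x \<in> X \<Longrightarrow> x \<in> polynomials X"
| const: "(\<lambda>_. c) \<in> polynomials X"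
| add: "P \<in> polynomials X \<Longrightarrow> Q \<in> polynomials X \<Longrightarrow> (\<lambda>y. P y + Q y) \<in> polynomials X"
| mult: "P \<in> polynomials X \<Longrightarrow> Q \<in> polynomials X \<Longrightarrow> (\<lambda>y. P y * Q y) \<in> polynomials X"

definition forms :: "nat \<Rightarrow> (complex ^ 'n \<Rightarrow> complex) set" where
  "forms d = {P \<in> polynomials (range (\<lambda>k x. x $ k)). \<forall>t x. P (t *s x) = t ^ d * P x}"

definition proj_open :: "(complex ^ 'n) set \<Rightarrow> bool" where
  "proj_open U \<longleftrightarrow> (\<exists>\<P> \<subseteq> (\<Union>d. forms d). U = {x. x \<noteq> 0 \<and> (\<exists>P\<in>\<P>. P x \<noteq> 0)})"

definition regular_fun :: "(complex ^ 'n) set \<Rightarrow> (complex ^ 'n \<Rightarrow> complex) \<Rightarrow> bool" where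
  "regular_fun U f \<longleftrightarrow>
    (\<forall>p\<in>U. \<exists>W d. \<exists>P\<in>forms d. \<exists>Q\<in>forms d.
       proj_open W \<and> p \<in> W \<and> W \<subseteq> U \<and> (\<forall>x\<in>W. Q x \<noteq> 0 \<and> f x = P x / Q x))"


section \<open>Tuples of hyperplanes\<close>

text \<open>
  A hyperplane is given by the coefficient vector of a linear form, which is a homogeneous
  coordinate vector of a point of the dual projective space.
\<close>

definition linear_form :: "complex ^ 'n \<Rightarrow> complex ^ 'n \<Rightarrow> complex" where
  "linear_form a x = (\<Sum>k\<in>UNIV. a $ k * x $ k)"

text \<open>
  A tuple of \<open>c\<close> points is a function on \<open>{..<c}\<close>; closed sets of a product of \<open>c\<close> projective
  spaces are the zero loci of multihomogeneous polynomials.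
\<close>

definition multiforms :: "nat \<Rightarrow> (nat \<Rightarrow> nat) \<Rightarrow> ((nat \<Rightarrow> complex ^ 'n) \<Rightarrow> complex) set" where
  "multiforms c d =
    {P \<in> polynomials {\<lambda>a. a i $ k | i k. i < c}.
      \<forall>t a. P (\<lambda>i. t i *s a i) = (\<Prod>i<c. t i ^ d i) * P a}"

definition multiproj_open :: "nat \<Rightarrow> (nat \<Rightarrow> complex ^ 'n) set \<Rightarrow> bool" where
  "multiproj_open c G \<longleftrightarrow>
    (\<exists>\<P> \<subseteq> (\<Union>d. multiforms c d).
       G = {a \<in> {..<c} \<rightarrow>\<^sub>E - {0}. \<exists>P\<in>\<P>. P a \<noteq> 0})"

definition general_position :: "nat \<Rightarrow> (nat \<Rightarrow> complex ^ 'n) \<Rightarrow> bool" where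
  "general_position c a \<longleftrightarrow>
    (\<forall>J \<subseteq> {..<c}. card J = min c CARD('n) \<longrightarrow> inj_on a J \<and> vec.independent (a ` J))"

definition hyperplane_sum :: "nat \<Rightarrow> (nat \<Rightarrow> complex ^ 'n) \<Rightarrow> (complex ^ 'n) set" where
  "hyperplane_sum c a = {x. \<exists>i<c. linear_form (a i) x = 0}"


section \<open>Logarithmic 1-forms\<close>

text \<open>
  A 1-form on projective space is represented by its pullback to the cone, the covector
  \<open>\<omega> x\<close> being given by its coefficients with respect to the differentials of the homogeneous
  coordinates.
\<close>

definition differential :: "(complex ^ 'n \<Rightarrow> complex) \<Rightarrow> complex ^ 'n \<Rightarrow> complex ^ 'n" where
  "differential z x = (\<chi> i. deriv (\<lambda>t. z (x + axis i t)) 0)"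

definition coord :: "complex ^ 'n ^ 'n \<Rightarrow> 'n \<Rightarrow> 'n \<Rightarrow> complex ^ 'n \<Rightarrow> complex" where
  "coord b h k x = linear_form (b $ k) x / linear_form (b $ h) x"

text \<open>
  Local coordinates adapted to \<open>D\<close>: the rows of \<open>b\<close> are a basis of the space of linear forms, the
  row with index \<open>h\<close> is a denominator not vanishing on \<open>W\<close>, and the \<open>n\<close> coordinates are the
  quotients \<^term>\<open>coord b h k\<close> for \<open>k \<noteq> h\<close>.  The logarithmic indices are those for which row \<open>k\<close>
  is the equation of a component of \<open>D\<close>, and on \<open>W\<close> the divisor is the vanishing locus of the
  product of the corresponding coordinates.  As the sheaf of logarithmic forms does not depend on
  the choice of adapted coordinates and its sections are defined locally, coordinates of this kind
  suffice for hyperplanes in general position.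
\<close>

definition log_indices :: "nat \<Rightarrow> (nat \<Rightarrow> complex ^ 'n) \<Rightarrow> complex ^ 'n ^ 'n \<Rightarrow> 'n \<Rightarrow> 'n set" where
  "log_indices c a b h = {k. k \<noteq> h \<and> b $ k \<in> a ` {..<c}}"

definition adapted_coords ::
    "nat \<Rightarrow> (nat \<Rightarrow> complex ^ 'n) \<Rightarrow> (complex ^ 'n) set \<Rightarrow> complex ^ 'n ^ 'n \<Rightarrow> 'n \<Rightarrow> bool" where
  "adapted_coords c a W b h \<longleftrightarrow>
    invertible b \<and> (\<forall>x\<in>W. linear_form (b $ h) x \<noteq> 0) \<and>
    hyperplane_sum c a \<inter> W = {x \<in> W. (\<Prod>k\<in>log_indices c a b h. coord b h k x) = 0}"

definition log_frame ::
    "nat \<Rightarrow> (nat \<Rightarrow> complex ^ 'n) \<Rightarrow> complex ^ 'n ^ 'n \<Rightarrow> 'n \<Rightarrow> 'n \<Rightarrow> complex ^ 'n \<Rightarrow> complex ^ 'n" where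
  "log_frame c a b h k x =
    (if k \<in> log_indices c a b h
     then inverse (coord b h k x) *s differential (coord b h k) x
     else differential (coord b h k) x)"

text \<open>
  The sheaf \<open>\<Omega>(log D)\<close>.  A section over \<open>U\<close> is a form on the complement of \<open>D\<close> in \<open>U\<close>, normalised
  to be zero elsewhere (on \<open>D\<close>, where it may have a pole, and outside \<open>U\<close>).
\<close>

definition log_cotangent ::
    "nat \<Rightarrow> (nat \<Rightarrow> complex ^ 'n) \<Rightarrow> (complex ^ 'n) set \<Rightarrow> (complex ^ 'n \<Rightarrow> complex ^ 'n) set" where
  "log_cotangent c a U =
    {\<omega>. (\<forall>x. x \<notin> U - hyperplane_sum c a \<longrightarrow> \<omega> x = 0) \<and>
        (\<forall>p\<in>U. \<exists>W b h f.
           proj_open W \<and> p \<in> W \<and> W \<subseteq> U \<and> adapted_coords c a W b h \<and>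
           (\<forall>k. regular_fun W (f k)) \<and>
           (\<forall>x \<in> W - hyperplane_sum c a. \<omega> x = (\<Sum>k\<in>-{h}. f k x *s log_frame c a b h k x)))}"


section \<open>The bundle of rank one quotients and bigness\<close>

text \<open>
  A vector bundle \<open>E\<close> on projective space is represented by its sheaf of sections, realised by
  vector-valued functions on the cone that are zero outside their domain.  A point of \<open>\<P>(E)\<close> over
  \<open>p\<close> is a rank one quotient of the fibre of \<open>E\<close> at \<open>p\<close>.  Choosing a basis of the quotient, this
  is a nonzero linear functional on the fibre, determined up to scaling; equivalently, a functional
  \<open>\<xi>\<close> on germs of sections at \<open>p\<close> which is linear over the local ring, the latter acting on the
  target by evaluation at \<open>p\<close>.  Germs are given by sections over neighbourhoods of \<open>p\<close>, and \<open>\<xi>\<close>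
  is set to zero on functions that are not such sections.
\<close>

definition rank_one_quotients ::
    "((complex ^ 'n) set \<Rightarrow> (complex ^ 'n \<Rightarrow> complex ^ 'm) set) \<Rightarrow>
     ((complex ^ 'n) \<times> ((complex ^ 'n \<Rightarrow> complex ^ 'm) \<Rightarrow> complex)) set" where
  "rank_one_quotients E =
    {(p, \<xi>). p \<noteq> 0 \<and>
      (\<forall>U. proj_open U \<and> p \<in> U \<longrightarrow>
         (\<forall>\<omega>\<in>E U. \<forall>\<eta>\<in>E U. \<xi> (\<lambda>x. \<omega> x + \<eta> x) = \<xi> \<omega> + \<xi> \<eta>) \<and>
         (\<forall>\<omega>\<in>E U. \<forall>f. regular_fun U f \<longrightarrow> \<xi> (\<lambda>x. f x *s \<omega> x) = f p * \<xi> \<omega>) \<and>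
         (\<forall>\<omega>\<in>E U. \<forall>W. proj_open W \<and> p \<in> W \<and> W \<subseteq> U \<longrightarrow>
            \<xi> (\<lambda>x. if x \<in> W then \<omega> x else 0) = \<xi> \<omega>)) \<and>
      (\<forall>\<omega>. (\<nexists>U. proj_open U \<and> p \<in> U \<and> \<omega> \<in> E U) \<longrightarrow> \<xi> \<omega> = 0) \<and>
      (\<exists>\<omega>. \<xi> \<omega> \<noteq> 0)}"

text \<open>
  The elements of degree \<open>k\<close> of the symmetric algebra of \<open>E\<close> over \<open>U\<close>, as functions on the pairs
  \<open>(x, \<xi>)\<close> with \<open>x \<in> U\<close>.
\<close>

inductive sym_section ::
    "((complex ^ 'n) set \<Rightarrow> (complex ^ 'n \<Rightarrow> complex ^ 'm) set) \<Rightarrow> (complex ^ 'n) set \<Rightarrow> nat \<Rightarrow>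
     ((complex ^ 'n) \<times> ((complex ^ 'n \<Rightarrow> complex ^ 'm) \<Rightarrow> complex) \<Rightarrow> complex) \<Rightarrow> bool"
  for E :: "(complex ^ 'n) set \<Rightarrow> (complex ^ 'n \<Rightarrow> complex ^ 'm) set" and U :: "(complex ^ 'n) set"
where
  scalar: "regular_fun U f \<Longrightarrow> sym_section E U 0 (\<lambda>(x, \<xi>). f x)"
| mult: "\<omega> \<in> E U \<Longrightarrow> sym_section E U k A \<Longrightarrow> sym_section E U (Suc k) (\<lambda>(x, \<xi>). \<xi> \<omega> * A (x, \<xi>))"
| add: "sym_section E U k A \<Longrightarrow> sym_section E U k B \<Longrightarrow> sym_section E U k (\<lambda>y. A y + B y)"

text \<open>
  Global sections of the \<open>m\<close>-th power of the tautological line bundle.  The fibre of \<open>\<O>(1)\<close> at a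
  point of \<open>\<P>(E)\<close> is the corresponding quotient line, which \<open>\<xi>\<close> identifies with the complex
  numbers, so a section of \<open>\<O>(m)\<close> is a function of \<open>(x, \<xi>)\<close>.  As on any relative Proj of a
  symmetric algebra, it is regular if it is locally a fraction of elements of the symmetric algebra
  whose degrees differ by \<open>m\<close>.  In particular it is invariant under scaling \<open>x\<close> and homogeneous of
  degree \<open>m\<close> in \<open>\<xi>\<close>.
\<close>

definition taut_sections ::
    "((complex ^ 'n) set \<Rightarrow> (complex ^ 'n \<Rightarrow> complex ^ 'm) set) \<Rightarrow> nat \<Rightarrow>
     ((complex ^ 'n) \<times> ((complex ^ 'n \<Rightarrow> complex ^ 'm) \<Rightarrow> complex) \<Rightarrow> complex) set" where
  "taut_sections E m =
    {s. (\<forall>y. y \<notin> rank_one_quotients E \<longrightarrow> s y = 0) \<and>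
        (\<forall>(p, \<xi>) \<in> rank_one_quotients E. \<exists>U k A B.
           proj_open U \<and> p \<in> U \<and> sym_section E U (k + m) A \<and> sym_section E U k B \<and>
           B (p, \<xi>) \<noteq> 0 \<and>
           (\<forall>(x, \<eta>) \<in> rank_one_quotients E.
              x \<in> U \<and> B (x, \<eta>) \<noteq> 0 \<longrightarrow> s (x, \<eta>) = A (x, \<eta>) / B (x, \<eta>)))}"

text \<open>
  The dimension of a complex vector space of functions, infinite if it is not finite-dimensional
  (in contrast to the library's \<open>dim\<close>, which is then zero).
\<close>

definition fun_dim :: "('a \<Rightarrow> complex) set \<Rightarrow> enat" where
  "fun_dim V =
    (SUP B \<in> {B. B \<subseteq> V \<and> finite B \<and> \<not> module.dependent (\<lambda>t s y. t * s y) B}. enat (card B))"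

text \<open>
  A line bundle \<open>L\<close> on a projective variety of dimension \<open>d\<close> is big if the dimension of the space
  of sections of its \<open>m\<close>-th power grows like the \<open>d\<close>-th power of \<open>m\<close>, i.e. if its volume is
  positive; \<open>\<Gamma> m\<close> is the space of sections of the \<open>m\<close>-th power.
\<close>

definition big_line_bundle :: "nat \<Rightarrow> (nat \<Rightarrow> ('a \<Rightarrow> complex) set) \<Rightarrow> bool" where
  "big_line_bundle d \<Gamma> \<longleftrightarrow>
    limsup (\<lambda>m. ereal_of_enat (fun_dim (\<Gamma> m)) / ereal (real m ^ d)) > 0"

text \<open>
  For a bundle of rank \<open>r\<close> on projective \<open>n\<close>-space the dimension of \<open>\<P>(E)\<close> is \<open>n + (r - 1)\<close>.
\<close>

definition big_vector_bundle ::
    "nat \<Rightarrow> ((complex ^ 'n) set \<Rightarrow> (complex ^ 'n \<Rightarrow> complex ^ 'm) set) \<Rightarrow> bool" where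
  "big_vector_bundle r E \<longleftrightarrow> big_line_bundle ((CARD('n) - 1) + (r - 1)) (taut_sections E)"

end

theory Submission
  imports Defs "HOL-Complex_Analysis.Cauchy_Integral_Formula"
begin

text \<open>
  Let \<open>l_i\<close> be the linear forms defining the \<open>c\<close> hyperplanes.  Off the divisor a point of the
  projectivised bundle is a point \<open>x\<close> of projective space with a tangent vector \<open>v\<close>, taken modulo the
  radial vector \<open>x\<close>.  The global logarithmic forms \<open>dl_i/l_i - dl_j/l_j\<close> are the differences of the
  logarithmic derivatives \<open>\<mu> i = l_i(v) / l_i(x)\<close>.  Sections of the powers of the tautological bundle are
  thus compared with functions of \<open>\<mu> 0, ..., \<mu> (c - 1)\<close> modulo simultaneous translation.
  Prescribing these derivatives gives \<open>c\<close> linear equations \<open>l_i(v) = \<mu> i * l_i(x)\<close> for the \<open>2n + 2\<close> coordinates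
  of \<open>(x, v)\<close>.

  If \<open>c \<ge> 2n + 1\<close>, the equations for \<open>2n + 1\<close> of the forms have a nonzero solution for each \<open>\<mu>\<close>, and for
  an open set of \<open>\<mu>\<close> the point \<open>x\<close> avoids the divisor (\<open>open_set_of_log_derivatives\<close>).  Hence \<open>2n\<close> of the
  differences are algebraically independent, and their monomials of degree \<open>m\<close> are sections whose
  number grows like \<open>m ^ (2n - 1)\<close> (\<open>many_sections\<close>), while \<open>2n - 1\<close> is the dimension of the
  projectivised bundle.

  If \<open>c \<le> 2n\<close>, auxiliary hyperplanes are added to obtain \<open>2n\<close> forms.  Now the solutions for given
  derivatives contain a line through each general point, along which all logarithmic forms have no
  poles, so a section is a bounded function on the line and is constant
  (\<open>log_symmetric_line_constant\<close>).  Each line meets one more hyperplane.  So a section is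
  determined by its restriction to this hyperplane (\<open>zero_if_zero_on_hyperplane\<close>), which lowers the
  number of parameters from \<open>2n - 1\<close> to \<open>2n - 2\<close>.  After the poles are cleared the restriction is a polynomial
  of degree linear in \<open>m\<close>, and the dimension of the space of sections is at most of order
  \<open>m ^ (2n - 2)\<close> (\<open>few_sections\<close>).

  The sections of the second part are handled analytically.  In a logarithmic frame they are
  continuous homogeneous functions of the coordinates of the tangent vector, also at points of the
  divisor, which bounds them in terms of the logarithmic derivatives (\<open>pullback_bound\<close>); Liouville's
  theorem along lines then gives polynomials and constants.

  The same open set of tuples serves all cases: padded by fixed hyperplanes to at least
  \<open>2n + 1\<close> members, the tuple has to be in general position.
\<close>

section \<open>Linear forms and linear systems\<close>

lemma linear_form_add_right [simp]: "linear_form a (x + y) = linear_form a x + linear_form a y"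
  by (simp add: linear_form_def algebra_simps sum.distrib)

lemma linear_form_add_left [simp]: "linear_form (a + b) x = linear_form a x + linear_form b x"
  by (simp add: linear_form_def algebra_simps sum.distrib)

lemma linear_form_scale_right [simp]: "linear_form a (t *s x) = t * linear_form a x"
  by (simp add: linear_form_def sum_distrib_left mult_ac)

lemma linear_form_scale_left [simp]: "linear_form (t *s a) x = t * linear_form a x"
  by (simp add: linear_form_def sum_distrib_left mult_ac)

lemma linear_form_diff_right [simp]: "linear_form a (x - y) = linear_form a x - linear_form a y"
  by (simp add: linear_form_def algebra_simps sum_subtractf)

lemma linear_form_diff_left [simp]: "linear_form (a - b) x = linear_form a x - linear_form b x"
  by (simp add: linear_form_def algebra_simps sum_subtractf)

lemma linear_form_zero_right [simp]: "linear_form a 0 = 0"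
  by (simp add: linear_form_def)

lemma linear_form_zero_left [simp]: "linear_form 0 x = 0"
  by (simp add: linear_form_def)

lemma linear_form_sum_right: "linear_form a (sum f A) = (\<Sum>i\<in>A. linear_form a (f i))"
  by (induction A rule: infinite_finite_induct) auto

lemma linear_form_sum_left: "linear_form (sum f A) x = (\<Sum>i\<in>A. linear_form (f i) x)"
  by (induction A rule: infinite_finite_induct) auto

lemma linear_form_axis_right [simp]: "linear_form a (axis k t) = a $ k * t"
  by (simp add: linear_form_def axis_def if_distrib cong: if_cong)

lemma linear_form_axis_left [simp]: "linear_form (axis k t) x = t * x $ k"
  by (simp add: linear_form_def axis_def if_distrib if_distribR cong: if_cong)

lemma linear_form_eqI:
  fixes \<eta> :: "complex ^ 'n"
  assumes "\<And>v. linear_form \<eta> v = linear_form \<zeta> v"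
  shows "\<eta> = \<zeta>"
proof -
  have "\<eta> $ k = \<zeta> $ k" for k
    using assms[of "axis k 1"] by simp
  then show ?thesis by (simp add: vec_eq_iff)
qed

lemma matrix_vector_nth: "(b *v x) $ k = linear_form (b $ k) x"
  by (simp add: matrix_vector_mult_def linear_form_def)

lemma continuous_linear_form [continuous_intros]:
  "continuous F f \<Longrightarrow> continuous F g \<Longrightarrow> continuous F (\<lambda>x. linear_form (f x) (g x))"
  unfolding linear_form_def continuous_def
  by (intro tendsto_sum tendsto_mult tendsto_vec_nth)

lemma tendsto_linear_form [tendsto_intros]:
  "(f \<longlongrightarrow> a) F \<Longrightarrow> (g \<longlongrightarrow> x) F \<Longrightarrow> ((\<lambda>i. linear_form (f i) (g i)) \<longlongrightarrow> linear_form a x) F"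
  unfolding linear_form_def by (intro tendsto_sum tendsto_mult tendsto_vec_nth)

lemma tendsto_vector_scale [tendsto_intros]:
  fixes g :: "'i \<Rightarrow> complex ^ 'n"
  assumes "(f \<longlongrightarrow> t) F" "(g \<longlongrightarrow> x) F"
  shows "((\<lambda>i. f i *s g i) \<longlongrightarrow> t *s x) F"
proof (rule vec_tendstoI)
  show "((\<lambda>i. (f i *s g i) $ k) \<longlongrightarrow> (t *s x) $ k) F" for k
    using tendsto_mult[OF assms(1) tendsto_vec_nth[OF assms(2), of k]] by simp
qed

lemma norm_vector_scale [simp]: "norm (t *s (x :: complex ^ 'n)) = norm t * norm x"
  by (simp add: norm_vec_def L2_set_def norm_mult power_mult_distrib
        flip: sum_distrib_left) (simp add: real_sqrt_mult)

lemma norm_linear_form_le: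
  fixes x :: "complex ^ 'n"
  shows "norm (linear_form a x) \<le> real CARD('n) * norm a * norm x"
proof -
  have "norm (linear_form a x) \<le> (\<Sum>k\<in>UNIV. norm (a $ k * x $ k))"
    unfolding linear_form_def by (rule norm_sum)
  also have "\<dots> \<le> (\<Sum>k\<in>(UNIV::'n set). norm a * norm x)"
    by (intro sum_mono) (simp add: norm_mult mult_mono Finite_Cartesian_Product.norm_nth_le)
  finally show ?thesis by simp
qed

text \<open>
  Used both for finding points, where the unknowns \<open>B\<close> are coordinates, and for finding relations
  between sections, where \<open>B\<close> is a set of sections and \<open>T\<close> a set of points.
\<close>

lemma homogeneous_system:
  fixes f :: "'b \<Rightarrow> 't \<Rightarrow> 'k::field"
  assumes "finite T" "finite B" "card T < card B"
  shows "\<exists>u. (\<exists>b\<in>B. u b \<noteq> 0) \<and> (\<forall>\<tau>\<in>T. (\<Sum>b\<in>B. u b * f b \<tau>) = 0)"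
  using assms
proof (induction T arbitrary: B f rule: finite_induct)
  case empty
  then obtain b where "b \<in> B" by fastforce
  then show ?case by (intro exI[of _ "\<lambda>_. 1"]) auto
next
  case (insert \<tau> T)
  show ?case
  proof (cases "\<forall>b\<in>B. f b \<tau> = 0")
    case True
    have "card T < card B" using insert by simp
    then obtain u where "\<exists>b\<in>B. u b \<noteq> 0" "\<forall>\<tau>\<in>T. (\<Sum>b\<in>B. u b * f b \<tau>) = 0"
      using insert.IH[of B f] insert.prems by blast
    then show ?thesis using True by (intro exI[of _ u]) auto
  next
    case False
    then obtain p where p: "p \<in> B" "f p \<tau> \<noteq> 0" by blast
    \<comment> \<open>eliminate the unknown \<open>p\<close> with the help of the equation \<open>\<tau>\<close>\<close>
    define g where "g b \<sigma> = f b \<sigma> - f b \<tau> / f p \<tau> * f p \<sigma>" for b \<sigma>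
    have "card T < card (B - {p})" using insert p by (simp add: card_Diff_singleton)
    then obtain u where u: "\<exists>b\<in>B - {p}. u b \<noteq> 0" "\<forall>\<sigma>\<in>T. (\<Sum>b\<in>B - {p}. u b * g b \<sigma>) = 0"
      using insert.IH[of "B - {p}" g] insert.prems by blast
    define w where "w b = (if b = p then - (\<Sum>b\<in>B - {p}. u b * f b \<tau>) / f p \<tau> else u b)" for b
    have split: "(\<Sum>b\<in>B. w b * f b \<sigma>) = (\<Sum>b\<in>B - {p}. u b * g b \<sigma>)" for \<sigma>
    proof -
      have "(\<Sum>b\<in>B. w b * f b \<sigma>) = w p * f p \<sigma> + (\<Sum>b\<in>B - {p}. w b * f b \<sigma>)"
        using p insert.prems by (simp add: sum.remove)
      also have "(\<Sum>b\<in>B - {p}. w b * f b \<sigma>) = (\<Sum>b\<in>B - {p}. u b * f b \<sigma>)"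
        by (intro sum.cong) (auto simp: w_def)
      also have "w p * f p \<sigma> = - (\<Sum>b\<in>B - {p}. u b * (f b \<tau> / f p \<tau> * f p \<sigma>))"
        by (simp add: w_def sum_distrib_left sum_distrib_right sum_divide_distrib sum_negf mult_ac)
      finally show ?thesis
        by (simp add: g_def algebra_simps sum_subtractf)
    qed
    have "g b \<tau> = 0" for b using p by (simp add: g_def)
    then have "\<forall>\<sigma>\<in>insert \<tau> T. (\<Sum>b\<in>B. w b * f b \<sigma>) = 0"
      using u(2) by (simp add: split)
    moreover have "\<exists>b\<in>B. w b \<noteq> 0" using u(1) by (auto simp: w_def)
    ultimately show ?thesis by blast
  qed
qed


section \<open>Regular functions\<close>

lemma linear_form_forms: "linear_form a \<in> forms 1"
proof -
  have sum: "(\<lambda>x. \<Sum>k\<in>K. a $ k * x $ k) \<in> polynomials (range (\<lambda>k x. x $ k))"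
    if "finite K" for K :: "'a set"
    using that
  proof induction
    case (insert k K)
    have "(\<lambda>x. a $ k * x $ k) \<in> polynomials (range (\<lambda>k x. x $ k))"
      by (intro polynomials.mult polynomials.const polynomials.coord) auto
    from polynomials.add[OF this insert.IH] show ?case
      unfolding sum.insert[OF insert.hyps] .
  next
    case empty
    show ?case unfolding sum.empty by (rule polynomials.const)
  qed
  have "linear_form a \<in> polynomials (range (\<lambda>k x. x $ k))"
    unfolding linear_form_def[abs_def] using sum[OF finite] .
  then show ?thesis by (simp add: forms_def)
qed

lemma const_forms: "(\<lambda>_. t) \<in> forms 0"
  unfolding forms_def by (simp add: polynomials.const)

lemma add_forms: "P \<in> forms d \<Longrightarrow> Q \<in> forms d \<Longrightarrow> (\<lambda>x. P x + Q x) \<in> forms d"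
  unfolding forms_def by (simp add: polynomials.add distrib_left)

lemma mult_forms: "P \<in> forms d \<Longrightarrow> Q \<in> forms e \<Longrightarrow> (\<lambda>x. P x * Q x) \<in> forms (d + e)"
  unfolding forms_def by (simp add: polynomials.mult power_add mult_ac)

lemma prod_forms:
  "finite I \<Longrightarrow> (\<And>i. i \<in> I \<Longrightarrow> P i \<in> forms (d i)) \<Longrightarrow> (\<lambda>x. \<Prod>i\<in>I. P i x) \<in> forms (\<Sum>i\<in>I. d i)"
proof (induction I rule: finite_induct)
  case empty
  then show ?case by (simp add: const_forms)
next
  case (insert i I)
  then show ?case
    using mult_forms[of "P i" "d i" "\<lambda>x. \<Prod>i\<in>I. P i x" "\<Sum>i\<in>I. d i"] by simp
qed

lemma polynomials_continuous:
  "P \<in> polynomials (range (\<lambda>k (x :: complex ^ 'n). x $ k)) \<Longrightarrow> continuous_on UNIV P"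
proof (induction rule: polynomials.induct)
  case (coord x)
  then show ?case by (auto intro!: continuous_on_component continuous_on_id)
qed (simp_all add: continuous_on_add continuous_on_mult)

lemma forms_isCont:
  fixes P :: "complex ^ 'n \<Rightarrow> complex"
  shows "P \<in> forms d \<Longrightarrow> isCont P x"
  using polynomials_continuous[of P] unfolding forms_def
  by (simp add: continuous_on_eq_continuous_at)

lemma forms_scale: "P \<in> forms d \<Longrightarrow> P (t *s x) = t ^ d * P x"
  unfolding forms_def by blast

lemma polynomials_analytic_on_line:
  fixes x y :: "complex ^ 'n"
  shows "P \<in> polynomials (range (\<lambda>k (x :: complex ^ 'n). x $ k)) \<Longrightarrow> (\<lambda>t. P (x + t *s y)) analytic_on A"
proof (induction rule: polynomials.induct)
  case (coord f)
  then obtain k where "f = (\<lambda>x. x $ k)" by blast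
  moreover have "(\<lambda>t. x $ k + t * y $ k) analytic_on A"
    by (intro analytic_on_add analytic_on_mult analytic_on_const analytic_on_ident)
  ultimately show ?case by simp
qed (simp_all add: analytic_on_add analytic_on_mult)

lemma forms_analytic_on_line:
  "P \<in> forms d \<Longrightarrow> (\<lambda>t. P (x + t *s y)) analytic_on A"
  using polynomials_analytic_on_line unfolding forms_def by blast

lemma proj_openE:
  assumes "proj_open U"
  obtains \<P> where "\<P> \<subseteq> (\<Union>d. forms d)" "U = {x. x \<noteq> 0 \<and> (\<exists>P\<in>\<P>. P x \<noteq> 0)}"
  using assms unfolding proj_open_def by (elim exE conjE)

lemma regular_funE:
  assumes "regular_fun U f" "p \<in> U"
  obtains W d P Q where "proj_open W" "p \<in> W" "W \<subseteq> U" "P \<in> forms d" "Q \<in> forms d"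
    "\<forall>x\<in>W. Q x \<noteq> 0 \<and> f x = P x / Q x"
  using assms unfolding regular_fun_def by blast

lemma regular_funI:
  assumes "\<And>p. p \<in> U \<Longrightarrow> \<exists>W. proj_open W \<and> p \<in> W \<and> W \<subseteq> U \<and> regular_fun W f"
  shows "regular_fun U f"
  unfolding regular_fun_def
proof
  fix p assume "p \<in> U"
  then obtain V where V: "p \<in> V" "V \<subseteq> U" "regular_fun V f" using assms by blast
  obtain W d P Q where "proj_open W" "p \<in> W" "W \<subseteq> V" "P \<in> forms d" "Q \<in> forms d"
    "\<forall>x\<in>W. Q x \<noteq> 0 \<and> f x = P x / Q x"
    using V by (elim regular_funE) blast
  then show "\<exists>W d. \<exists>P\<in>forms d. \<exists>Q\<in>forms d.
       proj_open W \<and> p \<in> W \<and> W \<subseteq> U \<and> (\<forall>x\<in>W. Q x \<noteq> 0 \<and> f x = P x / Q x)"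
    using V(2) by blast
qed

lemma proj_open_nonvanishing: "P \<in> forms d \<Longrightarrow> proj_open {x. x \<noteq> 0 \<and> P x \<noteq> 0}"
  unfolding proj_open_def by (rule exI[of _ "{P}"]) fast

lemma proj_open_nonzero: "proj_open (- {0})"
  using proj_open_nonvanishing[OF const_forms[of 1]] by (simp add: Compl_eq)

lemma proj_open_Int:
  assumes "proj_open U" "proj_open W"
  shows "proj_open (U \<inter> W)"
proof -
  obtain \<P> \<Q> where PQ: "\<P> \<subseteq> (\<Union>d. forms d)" "U = {x. x \<noteq> 0 \<and> (\<exists>P\<in>\<P>. P x \<noteq> 0)}"
    "\<Q> \<subseteq> (\<Union>d. forms d)" "W = {x. x \<noteq> 0 \<and> (\<exists>P\<in>\<Q>. P x \<noteq> 0)}"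
    using assms by (elim proj_openE)
  define \<R> where "\<R> = {(\<lambda>x. P x * Q x) | P Q. P \<in> \<P> \<and> Q \<in> \<Q>}"
  have "\<R> \<subseteq> (\<Union>d. forms d)"
  proof
    fix R assume "R \<in> \<R>"
    then obtain P Q where "R = (\<lambda>x. P x * Q x)" "P \<in> \<P>" "Q \<in> \<Q>" unfolding \<R>_def by blast
    moreover obtain d e where "P \<in> forms d" "Q \<in> forms e" using PQ(1,3) calculation(2,3) by blast
    ultimately show "R \<in> (\<Union>d. forms d)" using mult_forms[of P d Q e] by auto
  qed
  moreover have "U \<inter> W = {x. x \<noteq> 0 \<and> (\<exists>P\<in>\<R>. P x \<noteq> 0)}"
    unfolding PQ \<R>_def by force
  ultimately show ?thesis unfolding proj_open_def by blast
qed

lemma proj_open_imp_open: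
  fixes U :: "(complex ^ 'n) set"
  assumes "proj_open U"
  shows "open U"
proof -
  obtain \<P> where P: "\<P> \<subseteq> (\<Union>d. forms d)" "U = {x. x \<noteq> 0 \<and> (\<exists>P\<in>\<P>. P x \<noteq> 0)}"
    using assms by (elim proj_openE)
  have "open {x. P x \<noteq> 0}" if "P \<in> \<P>" for P
  proof -
    have "continuous_on UNIV P" using that P(1) forms_isCont continuous_on_eq_continuous_at open_UNIV
      by blast
    then show ?thesis by (intro open_Collect_neq) auto
  qed
  moreover have "U = - {0} \<inter> (\<Union>P\<in>\<P>. {x. P x \<noteq> 0})"
    unfolding P by blast
  ultimately show ?thesis by (metis (no_types, lifting) open_Compl closed_singleton open_Int open_UN)
qed

lemma proj_open_nonzeroD: "proj_open U \<Longrightarrow> x \<in> U \<Longrightarrow> x \<noteq> 0"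
  unfolding proj_open_def by auto

lemma proj_open_scale:
  assumes "proj_open U" "t \<noteq> 0"
  shows "t *s x \<in> U \<longleftrightarrow> x \<in> U"
proof -
  obtain \<P> where P: "\<P> \<subseteq> (\<Union>d. forms d)" "U = {x. x \<noteq> 0 \<and> (\<exists>P\<in>\<P>. P x \<noteq> 0)}"
    using assms by (elim proj_openE)
  have "P (t *s x) \<noteq> 0 \<longleftrightarrow> P x \<noteq> 0" if "P \<in> \<P>" for P
    using that P(1) forms_scale assms(2) by fastforce
  then show ?thesis using assms(2) unfolding P(2) by (auto simp: vec.scale_eq_0_iff)
qed

lemma regular_fun_quotient:
  assumes "proj_open W" "P \<in> forms d" "Q \<in> forms d" "\<forall>x\<in>W. Q x \<noteq> 0 \<and> f x = P x / Q x"
  shows "regular_fun W f"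
  unfolding regular_fun_def using assms by blast

lemma regular_fun_subset:
  assumes "regular_fun U f" "proj_open W" "W \<subseteq> U"
  shows "regular_fun W f"
proof (rule regular_funI)
  fix p assume p: "p \<in> W"
  obtain V d P Q where V: "proj_open V" "p \<in> V" "V \<subseteq> U" "P \<in> forms d" "Q \<in> forms d"
    "\<forall>x\<in>V. Q x \<noteq> 0 \<and> f x = P x / Q x"
    using assms p by (elim regular_funE) auto
  have "regular_fun (V \<inter> W) f"
    using V assms proj_open_Int by (intro regular_fun_quotient[OF _ V(4,5)]) auto
  then show "\<exists>V. proj_open V \<and> p \<in> V \<and> V \<subseteq> W \<and> regular_fun V f"
    using V p assms proj_open_Int by (intro exI[of _ "V \<inter> W"]) auto
qed

lemma regular_fun_const: "proj_open U \<Longrightarrow> regular_fun U (\<lambda>_. t)"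
  by (rule regular_fun_quotient[OF _ const_forms[of t] const_forms[of 1]]) auto

lemma regular_fun_mult:
  assumes "regular_fun U f" "regular_fun U g"
  shows "regular_fun U (\<lambda>x. f x * g x)"
  unfolding regular_fun_def
proof
  fix p assume p: "p \<in> U"
  obtain V d P Q where 1: "proj_open V" "p \<in> V" "V \<subseteq> U" "P \<in> forms d" "Q \<in> forms d"
    "\<forall>x\<in>V. Q x \<noteq> 0 \<and> f x = P x / Q x"
    using assms(1) p by (elim regular_funE) blast
  obtain V' d' P' Q' where 2: "proj_open V'" "p \<in> V'" "V' \<subseteq> U" "P' \<in> forms d'" "Q' \<in> forms d'"
    "\<forall>x\<in>V'. Q' x \<noteq> 0 \<and> g x = P' x / Q' x"
    using assms(2) p by (elim regular_funE) blast
  show "\<exists>W d. \<exists>P\<in>forms d. \<exists>Q\<in>forms d.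
       proj_open W \<and> p \<in> W \<and> W \<subseteq> U \<and> (\<forall>x\<in>W. Q x \<noteq> 0 \<and> f x * g x = P x / Q x)"
    by (rule exI[of _ "V \<inter> V'"], rule exI[of _ "d + d'"],
        rule bexI[OF _ mult_forms[OF 1(4) 2(4)]], rule bexI[OF _ mult_forms[OF 1(5) 2(5)]])
      (use 1 2 proj_open_Int in auto)
qed

lemma regular_fun_add:
  assumes "regular_fun U f" "regular_fun U g"
  shows "regular_fun U (\<lambda>x. f x + g x)"
  unfolding regular_fun_def
proof
  fix p assume p: "p \<in> U"
  obtain V d P Q where 1: "proj_open V" "p \<in> V" "V \<subseteq> U" "P \<in> forms d" "Q \<in> forms d"
    "\<forall>x\<in>V. Q x \<noteq> 0 \<and> f x = P x / Q x"
    using assms(1) p by (elim regular_funE) blast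
  obtain V' d' P' Q' where 2: "proj_open V'" "p \<in> V'" "V' \<subseteq> U" "P' \<in> forms d'" "Q' \<in> forms d'"
    "\<forall>x\<in>V'. Q' x \<noteq> 0 \<and> g x = P' x / Q' x"
    using assms(2) p by (elim regular_funE) blast
  have num: "(\<lambda>x. P x * Q' x + Q x * P' x) \<in> forms (d + d')"
    by (intro add_forms mult_forms 1 2)
  show "\<exists>W d. \<exists>P\<in>forms d. \<exists>Q\<in>forms d.
       proj_open W \<and> p \<in> W \<and> W \<subseteq> U \<and> (\<forall>x\<in>W. Q x \<noteq> 0 \<and> f x + g x = P x / Q x)"
    by (rule exI[of _ "V \<inter> V'"], rule exI[of _ "d + d'"],
        rule bexI[OF _ num], rule bexI[OF _ mult_forms[OF 1(5) 2(5)]])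
      (use 1 2 proj_open_Int in \<open>auto simp: field_simps\<close>)
qed

lemma regular_fun_diff:
  assumes "regular_fun U f" "regular_fun U g" "proj_open U"
  shows "regular_fun U (\<lambda>x. f x - g x)"
  using regular_fun_add[OF assms(1) regular_fun_mult[OF regular_fun_const[of _ "-1"] assms(2)]] assms
  by simp

lemma regular_fun_isCont:
  assumes "regular_fun U f" "p \<in> U"
  shows "isCont f p"
proof -
  obtain V d P Q where V: "proj_open V" "p \<in> V" "V \<subseteq> U" "P \<in> forms d" "Q \<in> forms d"
    "\<forall>x\<in>V. Q x \<noteq> 0 \<and> f x = P x / Q x"
    using assms(1,2) by (elim regular_funE) blast
  have "isCont (\<lambda>x. P x / Q x) p"
    using V by (intro continuous_intros forms_isCont[of _ d]) auto
  moreover have "eventually (\<lambda>x. f x = P x / Q x) (nhds p)"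
    using V eventually_nhds_in_open[OF proj_open_imp_open[OF V(1)], of p]
    by (auto elim!: eventually_mono)
  ultimately show ?thesis by (simp add: isCont_cong)
qed

lemma eventually_line_in_open:
  fixes x y :: "complex ^ 'n"
  assumes "open W" "x + t *s y \<in> W"
  shows "eventually (\<lambda>s. x + s *s y \<in> W) (nhds t)"
proof -
  have "((\<lambda>s. x + s *s y) \<longlongrightarrow> x + t *s y) (nhds t)"
    by (intro tendsto_intros filterlim_ident)
  then show ?thesis using assms by (simp add: topological_tendstoD)
qed

lemma analytic_on_eventually:
  assumes "f analytic_on {t}" "eventually (\<lambda>s. f s = g s) (nhds t)"
  shows "g analytic_on {t}"
proof -
  obtain e where e: "e > 0" "f holomorphic_on ball t e"
    using assms(1) by (auto simp: analytic_on_def)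
  obtain T where T: "open T" "t \<in> T" "\<And>s. s \<in> T \<Longrightarrow> f s = g s"
    using assms(2) by (auto simp: eventually_nhds)
  have "f holomorphic_on (ball t e \<inter> T)" using e by (auto intro: holomorphic_on_subset)
  then have "g holomorphic_on (ball t e \<inter> T)"
    by (rule holomorphic_transform) (use T in auto)
  then show ?thesis using e T by (simp add: analytic_at) (metis IntI centre_in_ball open_Int open_ball)
qed

lemma regular_fun_analytic_on_line:
  assumes "regular_fun U f" "x + t *s y \<in> U"
  shows "(\<lambda>s. f (x + s *s y)) analytic_on {t}"
proof -
  obtain V d P Q where V: "proj_open V" "x + t *s y \<in> V" "V \<subseteq> U" "P \<in> forms d" "Q \<in> forms d"
    "\<forall>x\<in>V. Q x \<noteq> 0 \<and> f x = P x / Q x"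
    using assms(1,2) by (elim regular_funE) blast
  have "(\<lambda>s. P (x + s *s y) / Q (x + s *s y)) analytic_on {t}"
    using V by (intro analytic_intros forms_analytic_on_line) auto
  moreover have "eventually (\<lambda>s. P (x + s *s y) / Q (x + s *s y) = f (x + s *s y)) (nhds t)"
    using V eventually_line_in_open[OF proj_open_imp_open[OF V(1)] V(2)]
    by (auto elim!: eventually_mono)
  ultimately show ?thesis by (rule analytic_on_eventually)
qed

lemma regular_fun_scale:
  assumes "regular_fun U f" "x \<in> U" "t \<noteq> 0"
  shows "f (t *s x) = f x"
proof -
  obtain V d P Q where V: "proj_open V" "x \<in> V" "V \<subseteq> U" "P \<in> forms d" "Q \<in> forms d"
    "\<forall>x\<in>V. Q x \<noteq> 0 \<and> f x = P x / Q x"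
    using assms(1,2) by (elim regular_funE) blast
  then show ?thesis using proj_open_scale[OF V(1) assms(3)] forms_scale[OF V(4)] forms_scale[OF V(5)] assms(3)
    by auto
qed

section \<open>Hyperplanes in general position\<close>

lemma avoid_hyperplanes:
  fixes A :: "(complex ^ 'n) set"
  assumes "finite A" "0 \<notin> A"
  shows "\<exists>q. \<forall>v\<in>A. linear_form v q \<noteq> 0"
  using assms
proof (induction A rule: finite_induct)
  case (insert v A)
  then obtain q where q: "\<forall>v\<in>A. linear_form v q \<noteq> 0" by auto
  obtain k where k: "v $ k \<noteq> 0" using insert.prems by (auto simp: vec_eq_iff)
  define bad where "bad u = {t. linear_form u q + t * u $ k = 0}" for u
  have "finite (bad u)" if "linear_form u q \<noteq> 0 \<or> u $ k \<noteq> 0" for u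
  proof (cases "u $ k = 0")
    case False
    have "bad u \<subseteq> {- linear_form u q / u $ k}"
      using False by (auto simp: bad_def field_simps add_eq_0_iff)
    then show ?thesis by (rule finite_subset) simp
  qed (use that in \<open>auto simp: bad_def\<close>)
  then have "finite (\<Union>u\<in>insert v A. bad u)" using q k insert.hyps by auto
  then obtain t where "t \<notin> (\<Union>u\<in>insert v A. bad u)"
    using ex_new_if_finite infinite_UNIV_char_0 by blast
  then have "\<forall>u\<in>insert v A. linear_form u (q + axis k t) \<noteq> 0"
    by (auto simp: bad_def mult.commute)
  then show ?case by blast
qed simp

lemma invertible_matrix_inv:
  fixes b :: "complex ^ 'n ^ 'n"
  assumes "invertible b"
  shows matrix_inv_left: "matrix_inv b ** b = mat 1" and matrix_inv_right: "b ** matrix_inv b = mat 1"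
proof -
  have "b ** matrix_inv b = mat 1 \<and> matrix_inv b ** b = mat 1"
    unfolding matrix_inv_def using assms unfolding invertible_def by (rule someI_ex)
  then show "matrix_inv b ** b = mat 1" "b ** matrix_inv b = mat 1" by auto
qed

lemma matrix_vector_zero_iff:
  fixes b :: "complex ^ 'n ^ 'n"
  assumes "invertible b"
  shows "(\<forall>k. linear_form (b $ k) x = 0) \<longleftrightarrow> x = 0"
proof
  assume "\<forall>k. linear_form (b $ k) x = 0"
  then have "b *v x = 0" by (simp add: vec_eq_iff matrix_vector_nth)
  then have "matrix_inv b *v (b *v x) = 0" by simp
  then show "x = 0" by (simp add: matrix_vector_mul_assoc matrix_inv_left[OF assms])
qed simp

text \<open>
  The divisor consists of the first \<open>c\<close> of \<open>C\<close> hyperplanes in general position.  The further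
  hyperplanes are auxiliary: they supply coordinates and, when \<open>c\<close> is small, additional equations.
\<close>

locale arrangement =
  fixes c C :: nat and a :: "nat \<Rightarrow> complex ^ 'n"
  assumes position: "general_position C a"
    and dim_le: "CARD('n) \<le> C"
    and c_le: "c \<le> C"
begin

abbreviation \<H> :: "(complex ^ 'n) set" where "\<H> \<equiv> hyperplane_sum c a"

lemma not_in_\<H>: "x \<notin> \<H> \<longleftrightarrow> (\<forall>i<c. linear_form (a i) x \<noteq> 0)"
  by (auto simp: hyperplane_sum_def)

lemma invertible_rows:
  assumes "K \<subseteq> {..<C}" "card K = CARD('n)"
  obtains \<sigma> :: "'n \<Rightarrow> nat" and b where "bij_betw \<sigma> UNIV K" "b = (\<chi> k. a (\<sigma> k))" "invertible b"
proof -
  have "finite K" using assms(1) finite_subset by blast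
  then obtain \<sigma> :: "'n \<Rightarrow> nat" where \<sigma>: "bij_betw \<sigma> UNIV K"
    using assms(2) finite_same_card_bij[of "UNIV :: 'n set" K] by auto
  have ind: "inj_on a K" "vec.independent (a ` K)"
    using position assms dim_le unfolding general_position_def by (auto simp: min_def)
  define b where "b = (\<chi> k. a (\<sigma> k))"
  have inj: "inj (\<lambda>k. a (\<sigma> k))"
    using comp_inj_on[of \<sigma> UNIV a] \<sigma> ind(1) by (auto simp: bij_betw_def comp_def)
  have "\<exists>B. b ** B = mat 1"
    unfolding matrix_right_invertible_independent_rows
  proof (intro allI impI)
    fix u k assume u: "(\<Sum>i\<in>UNIV. u i *s row i b) = 0"
    let ?g = "inv (\<lambda>k. a (\<sigma> k))"
    have "(\<Sum>v\<in>range (\<lambda>k. a (\<sigma> k)). u (?g v) *s v) = (\<Sum>i\<in>UNIV. u i *s row i b)"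
      by (subst sum.reindex[OF inj]) (simp add: inv_f_f[OF inj] b_def row_def)
    moreover have "range (\<lambda>k. a (\<sigma> k)) = a ` K"
      using \<sigma> by (auto simp: bij_betw_def)
    ultimately have "u (?g (a (\<sigma> k))) = 0"
      using vec.independentD[OF ind(2), of "a ` K" "\<lambda>v. u (?g v)" "a (\<sigma> k)"] u \<open>finite K\<close> \<sigma>
      by (auto simp: bij_betw_def)
    then show "u k = 0" by (simp add: inv_f_f[OF inj])
  qed
  then have "invertible b" by (simp add: invertible_right_inverse)
  with that \<sigma> b_def show ?thesis by blast
qed

lemma common_zero_eq_0:
  assumes "K \<subseteq> {..<C}" "card K = CARD('n)" "\<And>i. i \<in> K \<Longrightarrow> linear_form (a i) x = 0"
  shows "x = 0"
proof -
  obtain \<sigma> :: "'n \<Rightarrow> nat" and b where \<sigma>: "bij_betw \<sigma> UNIV K" "b = (\<chi> k. a (\<sigma> k))" "invertible b"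
    by (rule invertible_rows[OF assms(1,2)])
  have "\<sigma> k \<in> K" for k using \<sigma>(1) by (auto simp: bij_betw_def)
  then have "\<forall>k. linear_form (b $ k) x = 0" using assms(3) \<sigma>(2) by simp
  then show ?thesis using matrix_vector_zero_iff[OF \<sigma>(3)] by blast
qed

lemma dual_vectors:
  assumes "K \<subseteq> {..<C}" "card K = CARD('n)"
  shows "\<exists>e. (\<forall>i\<in>K. \<forall>j\<in>K. linear_form (a i) (e j) = (if i = j then 1 else 0)) \<and>
    (\<forall>x. x = (\<Sum>i\<in>K. linear_form (a i) x *s e i))"
proof -
  obtain \<sigma> :: "'n \<Rightarrow> nat" and b where \<sigma>: "bij_betw \<sigma> UNIV K" "b = (\<chi> k. a (\<sigma> k))" "invertible b"
    by (rule invertible_rows[OF assms(1,2)])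
  define e where "e j = matrix_inv b *v axis (inv \<sigma> j) 1" for j
  have inj: "inj \<sigma>" using \<sigma> by (auto simp: bij_betw_def)
  have e: "linear_form (a i) (e j) = (if i = j then 1 else 0)" if ij: "i \<in> K" "j \<in> K" for i j
  proof -
    obtain k l where kl: "i = \<sigma> k" "j = \<sigma> l"
      using ij \<sigma>(1) unfolding bij_betw_def by blast
    have "linear_form (a i) (e j) = (b *v e j) $ k" by (simp add: matrix_vector_nth \<sigma>(2) kl)
    also have "b *v e j = axis l 1"
      by (simp add: e_def matrix_vector_mul_assoc matrix_inv_right[OF \<sigma>(3)] kl inv_f_f[OF inj])
    finally show ?thesis using kl inj by (simp add: axis_def inj_eq)
  qed
  have "x - (\<Sum>i\<in>K. linear_form (a i) x *s e i) = 0" for x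
  proof (rule common_zero_eq_0[OF assms])
    fix j assume "j \<in> K"
    then show "linear_form (a j) (x - (\<Sum>i\<in>K. linear_form (a i) x *s e i)) = 0"
      using finite_subset[OF assms(1)] e
      by (simp add: linear_form_sum_right if_distrib[of "(*) _"] cong: if_cong)
  qed
  then show ?thesis using e by (intro exI[of _ e]) simp
qed

lemma card_zeros_less:
  assumes "p \<noteq> 0" "J \<subseteq> {..<C}" "\<And>i. i \<in> J \<Longrightarrow> linear_form (a i) p = 0"
  shows "card J < CARD('n)"
proof (rule ccontr)
  assume "\<not> ?thesis"
  then obtain K where "K \<subseteq> J" "card K = CARD('n)" by (meson not_less obtain_subset_with_card_n)
  then show False using common_zero_eq_0[of K p] assms by blast
qed

lemma extend_to_card:
  assumes "J \<subseteq> {..<C}" "card J \<le> CARD('n)"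
  obtains K where "J \<subseteq> K" "K \<subseteq> {..<C}" "card K = CARD('n)"
  using exists_subset_between[of J "CARD('n)" "{..<C}"] assms dim_le by auto

lemma form_nonzero:
  assumes "i < C"
  shows "a i \<noteq> 0"
proof
  assume "a i = 0"
  obtain K where K: "{i} \<subseteq> K" "K \<subseteq> {..<C}" "card K = CARD('n)"
    by (rule extend_to_card[of "{i}"]) (use assms zero_less_card_finite[where 'a='n] in auto)
  obtain e where "\<forall>i\<in>K. \<forall>j\<in>K. linear_form (a i) (e j) = (if i = j then 1 else 0)"
    using dual_vectors[OF K(2,3)] by blast
  then show False using K(1) \<open>a i = 0\<close> by (metis insert_subset linear_form_zero_left zero_neq_one)
qed

lemma generic_point: "\<exists>q. \<forall>i<C. linear_form (a i) q \<noteq> 0"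
  using avoid_hyperplanes[of "a ` {..<C}"] form_nonzero by fastforce

end


section \<open>Logarithmic frames\<close>

lemma differential_coord:
  assumes "linear_form (b $ h) x \<noteq> 0"
  shows "linear_form (differential (coord b h k) x) v =
    (linear_form (b $ k) v * linear_form (b $ h) x - linear_form (b $ k) x * linear_form (b $ h) v) /
    (linear_form (b $ h) x)\<^sup>2"
proof -
  have "deriv (\<lambda>t. coord b h k (x + axis i t)) 0 =
     (b $ k $ i * linear_form (b $ h) x - linear_form (b $ k) x * b $ h $ i) / (linear_form (b $ h) x)\<^sup>2" for i
  proof (rule DERIV_imp_deriv)
    have "((\<lambda>t. (linear_form (b $ k) x + b $ k $ i * t) / (linear_form (b $ h) x + b $ h $ i * t))
      has_field_derivative ((b $ k $ i * linear_form (b $ h) x - linear_form (b $ k) x * b $ h $ i)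
        / (linear_form (b $ h) x)\<^sup>2)) (at 0)"
      by (rule derivative_eq_intros refl | use assms in \<open>simp add: power2_eq_square\<close>)+
    then show "((\<lambda>t. coord b h k (x + axis i t))
      has_field_derivative ((b $ k $ i * linear_form (b $ h) x - linear_form (b $ k) x * b $ h $ i)
        / (linear_form (b $ h) x)\<^sup>2)) (at 0)"
      by (simp add: coord_def[abs_def])
  qed
  then have "differential (coord b h k) x =
    (1 / (linear_form (b $ h) x)\<^sup>2) *s (linear_form (b $ h) x *s b $ k - linear_form (b $ k) x *s b $ h)"
    by (simp add: differential_def vec_eq_iff mult_ac diff_divide_distrib)
  then show ?thesis by (simp add: mult_ac diff_divide_distrib)
qed

lemma log_frame_pairing:
  assumes "linear_form (b $ h) x \<noteq> 0"
  shows "linear_form (log_frame c a b h k x) v =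
    (if k \<in> log_indices c a b h then
       if linear_form (b $ k) x = 0 then 0
       else linear_form (b $ k) v / linear_form (b $ k) x - linear_form (b $ h) v / linear_form (b $ h) x
     else (linear_form (b $ k) v * linear_form (b $ h) x - linear_form (b $ k) x * linear_form (b $ h) v) /
       (linear_form (b $ h) x)\<^sup>2)"
  using assms
  by (auto simp: log_frame_def differential_coord coord_def power2_eq_square divide_simps)

text \<open>
  The vector fields along which one coordinate of the frame has constant logarithmic (or, for an
  index that is not logarithmic, ordinary) derivative and the other coordinates are constant.  They
  are linear in \<open>x\<close> and tangent to the hyperplanes given by logarithmic rows.
\<close>

definition dual_field ::
    "nat \<Rightarrow> (nat \<Rightarrow> complex ^ 'n) \<Rightarrow> complex ^ 'n ^ 'n \<Rightarrow> 'n \<Rightarrow> 'n \<Rightarrow> complex ^ 'n \<Rightarrow> complex ^ 'n" where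
  "dual_field c a b h k x =
    matrix_inv b *v axis k (linear_form (b $ (if k \<in> log_indices c a b h then k else h)) x)"

lemma dual_field_pairing:
  assumes "invertible b"
  shows "linear_form (b $ j) (dual_field c a b h k x) =
    (if j = k then linear_form (b $ (if k \<in> log_indices c a b h then k else h)) x else 0)"
proof -
  have "b *v dual_field c a b h k x = axis k (linear_form (b $ (if k \<in> log_indices c a b h then k else h)) x)"
    by (simp add: dual_field_def matrix_vector_mul_assoc matrix_inv_right[OF assms])
  then have "linear_form (b $ j) (dual_field c a b h k x) =
      axis k (linear_form (b $ (if k \<in> log_indices c a b h then k else h)) x) $ j"
    by (metis matrix_vector_nth)
  then show ?thesis by (simp add: axis_def)
qed

lemma linear_form_dual_field:
  "linear_form e (dual_field c a b h k x) =
    linear_form ((\<Sum>i\<in>UNIV. (e $ i * matrix_inv b $ i $ k)) *s b $ (if k \<in> log_indices c a b h then k else h)) x"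
  unfolding dual_field_def linear_form_scale_left
  by (simp add: linear_form_def matrix_vector_mult_def axis_def if_distrib sum_distrib_right mult_ac cong: if_cong)

context arrangement
begin

lemma log_form_nonzero:
  assumes "x \<notin> \<H>" "k \<in> log_indices c a b h"
  shows "linear_form (b $ k) x \<noteq> 0"
  using assms by (auto simp: log_indices_def hyperplane_sum_def)

lemma log_frame_pairing':
  assumes "x \<notin> \<H>" "linear_form (b $ h) x \<noteq> 0"
  shows "linear_form (log_frame c a b h k x) v =
    (if k \<in> log_indices c a b h then
       linear_form (b $ k) v / linear_form (b $ k) x - linear_form (b $ h) v / linear_form (b $ h) x
     else (linear_form (b $ k) v * linear_form (b $ h) x - linear_form (b $ k) x * linear_form (b $ h) v) /
       (linear_form (b $ h) x)\<^sup>2)"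
  using log_form_nonzero[OF assms(1)] by (auto simp: log_frame_pairing[OF assms(2)])

lemma log_frame_dual_field:
  assumes "invertible b" "x \<notin> \<H>" "linear_form (b $ h) x \<noteq> 0" "j \<noteq> h" "k \<noteq> h"
  shows "linear_form (log_frame c a b h j x) (dual_field c a b h k x) = (if j = k then 1 else 0)"
  using assms log_form_nonzero[OF assms(2), of k b h]
  by (auto simp: log_frame_pairing' dual_field_pairing power2_eq_square)

text \<open>
  The pullback of a form to the cone ignores the radial direction \<open>x\<close>, and nothing else is
  invisible to a frame.
\<close>

lemma log_frame_kernel:
  assumes b: "invertible b" and x: "x \<notin> \<H>" "linear_form (b $ h) x \<noteq> 0"
    and zero: "\<And>k. k \<noteq> h \<Longrightarrow> linear_form (log_frame c a b h k x) v = 0"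
  shows "v = (linear_form (b $ h) v / linear_form (b $ h) x) *s x"
proof -
  let ?t = "linear_form (b $ h) v / linear_form (b $ h) x"
  have "linear_form (b $ k) (v - ?t *s x) = 0" for k
    using zero[of k] x log_form_nonzero[OF x(1), of k b h]
    by (cases "k = h") (auto simp: log_frame_pairing' field_simps power2_eq_square split: if_splits)
  then have "v - ?t *s x = 0" using matrix_vector_zero_iff[OF b] by blast
  then show ?thesis by simp
qed

lemma log_frame_expansion:
  assumes b: "invertible b" and x: "x \<notin> \<H>" "linear_form (b $ h) x \<noteq> 0"
    and \<eta>: "linear_form \<eta> x = 0"
  shows "\<eta> = (\<Sum>k\<in>-{h}. linear_form \<eta> (dual_field c a b h k x) *s log_frame c a b h k x)"
proof (rule linear_form_eqI)
  fix v
  let ?y = "\<lambda>k. linear_form (log_frame c a b h k x) v"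
  define u where "u = v - (\<Sum>k\<in>-{h}. ?y k *s dual_field c a b h k x)"
  have "linear_form (log_frame c a b h j x) u = 0" if "j \<noteq> h" for j
  proof -
    have "(\<Sum>k\<in>-{h}. ?y k * linear_form (log_frame c a b h j x) (dual_field c a b h k x)) =
       (\<Sum>k\<in>-{h}. if j = k then ?y k else 0)"
      by (intro sum.cong) (use log_frame_dual_field[OF b x that] in auto)
    then show ?thesis using that by (simp add: u_def linear_form_sum_right)
  qed
  then have "u = (linear_form (b $ h) u / linear_form (b $ h) x) *s x"
    by (rule log_frame_kernel[OF b x])
  then have "linear_form \<eta> u = 0" using \<eta> by (metis linear_form_scale_right mult_zero_right)
  then show "linear_form \<eta> v = linear_form (\<Sum>k\<in>-{h}. linear_form \<eta> (dual_field c a b h k x) *s log_frame c a b h k x) v"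
    by (simp add: u_def linear_form_sum_right linear_form_sum_left mult.commute)
qed

lemma log_frame_radial:
  assumes "linear_form (b $ h) x \<noteq> 0"
  shows "linear_form (log_frame c a b h k x) x = 0"
  using assms by (simp add: log_frame_pairing)

text \<open>
  Adapted coordinates on \<open>W\<close> only say that the hyperplanes meeting \<open>W\<close> are covered by logarithmic
  rows.  For a frame at \<open>p\<close> each hyperplane through \<open>p\<close> is required to be such a row itself, so that
  the dual fields are visibly tangent to it.
\<close>

definition frame_at :: "complex ^ 'n \<Rightarrow> (complex ^ 'n) set \<Rightarrow> complex ^ 'n ^ 'n \<Rightarrow> 'n \<Rightarrow> bool" where
  "frame_at p W b h \<longleftrightarrow> proj_open W \<and> p \<in> W \<and> adapted_coords c a W b h \<and>
    (\<forall>i<c. linear_form (a i) p = 0 \<longrightarrow> (\<exists>k. k \<noteq> h \<and> b $ k = a i))"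

lemma frame_atD:
  assumes "frame_at p W b h"
  shows "proj_open W" "p \<in> W" "adapted_coords c a W b h" "invertible b"
    "\<And>x. x \<in> W \<Longrightarrow> linear_form (b $ h) x \<noteq> 0"
    "\<And>i. i < c \<Longrightarrow> linear_form (a i) p = 0 \<Longrightarrow> \<exists>k. k \<in> log_indices c a b h \<and> b $ k = a i"
proof -
  show "\<exists>k. k \<in> log_indices c a b h \<and> b $ k = a i" if i: "i < c" "linear_form (a i) p = 0" for i
  proof -
    obtain k where "k \<noteq> h" "b $ k = a i" using assms i unfolding frame_at_def by blast
    then show ?thesis using i(1) unfolding log_indices_def by (intro exI[of _ k]) auto
  qed
qed (use assms in \<open>auto simp: frame_at_def adapted_coords_def\<close>)

lemma adapted_coords_subset:
  assumes "adapted_coords c a W b h" "W' \<subseteq> W"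
  shows "adapted_coords c a W' b h"
proof -
  have "\<H> \<inter> W' = (\<H> \<inter> W) \<inter> W'" using assms(2) by blast
  also have "\<dots> = {x \<in> W'. (\<Prod>k\<in>log_indices c a b h. coord b h k x) = 0}"
    using assms by (auto simp: adapted_coords_def)
  finally show ?thesis using assms by (auto simp: adapted_coords_def)
qed

text \<open>
  By general position fewer than \<open>CARD('n)\<close> hyperplanes pass through \<open>p\<close>; their forms are completed by others
  of the \<open>C\<close> forms to a basis, some member of which does not vanish at \<open>p\<close>.
\<close>

lemma frame_exists:
  assumes "p \<noteq> 0"
  obtains W b h where "frame_at p W b h"
proof -
  define J where "J = {i. i < c \<and> linear_form (a i) p = 0}"
  have J: "J \<subseteq> {..<C}" using c_le by (auto simp: J_def)
  have "card J \<le> CARD('n)"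
    using card_zeros_less[OF assms J] by (auto simp: J_def)
  then obtain K where K: "J \<subseteq> K" "K \<subseteq> {..<C}" "card K = CARD('n)"
    by (rule extend_to_card[OF J])
  obtain \<sigma> :: "'n \<Rightarrow> nat" and b where \<sigma>: "bij_betw \<sigma> UNIV K" "b = (\<chi> k. a (\<sigma> k))" "invertible b"
    by (rule invertible_rows[OF K(2,3)])
  obtain h where h: "linear_form (b $ h) p \<noteq> 0"
  proof (rule ccontr)
    assume "\<not> thesis"
    then have "linear_form (a i) p = 0" if "i \<in> K" for i
      using that \<sigma> \<open>\<And>h. linear_form (b $ h) p \<noteq> 0 \<Longrightarrow> thesis\<close> by (auto simp: bij_betw_def)
    then show False using common_zero_eq_0[OF K(2,3)] assms by blast
  qed
  define I where "I = {i. i < c \<and> linear_form (a i) p \<noteq> 0}"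
  define P where "P x = linear_form (b $ h) x * (\<Prod>i\<in>I. linear_form (a i) x)" for x
  have fin: "finite I" by (simp add: I_def)
  have "P \<in> forms (1 + (\<Sum>i\<in>I. 1))"
    unfolding P_def by (intro mult_forms prod_forms linear_form_forms fin)
  define W where "W = {x. x \<noteq> 0 \<and> P x \<noteq> 0}"
  have W: "x \<in> W \<longleftrightarrow> x \<noteq> 0 \<and> linear_form (b $ h) x \<noteq> 0 \<and> (\<forall>i\<in>I. linear_form (a i) x \<noteq> 0)" for x
    using fin by (simp add: W_def P_def)
  have log: "\<exists>k. k \<noteq> h \<and> b $ k = a i" if i: "i < c" "linear_form (a i) p = 0" for i
  proof -
    have "i \<in> K" using i K by (auto simp: J_def)
    then obtain k where "i = \<sigma> k" using \<sigma> by (auto simp: bij_betw_def)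
    then show ?thesis using h i \<sigma>(2) by (intro exI[of _ k]) auto
  qed
  have "x \<in> \<H> \<longleftrightarrow> (\<Prod>k\<in>log_indices c a b h. coord b h k x) = 0" if x: "x \<in> W" for x
  proof
    assume "x \<in> \<H>"
    then obtain i where i: "i < c" "linear_form (a i) x = 0" by (auto simp: hyperplane_sum_def)
    then have "linear_form (a i) p = 0" using x W by (auto simp: I_def)
    then obtain k where "k \<noteq> h" "b $ k = a i" using log i by blast
    then have "k \<in> log_indices c a b h" "coord b h k x = 0"
      using i by (auto simp: log_indices_def coord_def)
    then show "(\<Prod>k\<in>log_indices c a b h. coord b h k x) = 0" by auto
  next
    assume "(\<Prod>k\<in>log_indices c a b h. coord b h k x) = 0"
    then obtain k where "k \<in> log_indices c a b h" "coord b h k x = 0" by auto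
    then show "x \<in> \<H>"
      using x W by (auto simp: log_indices_def coord_def hyperplane_sum_def)
  qed
  then have "adapted_coords c a W b h"
    using \<sigma>(3) W by (auto simp: adapted_coords_def)
  moreover have "proj_open W"
    unfolding W_def by (rule proj_open_nonvanishing) fact
  moreover have "p \<in> W" using h assms by (auto simp: W I_def)
  ultimately show ?thesis using that log unfolding frame_at_def by blast
qed

section \<open>Logarithmic forms near a point\<close>

text \<open>
  Sections are normalised to zero on the hyperplanes, so their coefficients are regular
  functions only after redefinition there: agreement is demanded only off the hyperplanes.
\<close>

definition regular_near :: "complex ^ 'n \<Rightarrow> (complex ^ 'n \<Rightarrow> complex) \<Rightarrow> bool" where
  "regular_near p f \<longleftrightarrow>
    (\<exists>W F. proj_open W \<and> p \<in> W \<and> regular_fun W F \<and> (\<forall>x\<in>W - \<H>. f x = F x))"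

lemma regular_nearI:
  "proj_open W \<Longrightarrow> p \<in> W \<Longrightarrow> regular_fun W F \<Longrightarrow> (\<And>x. x \<in> W \<Longrightarrow> x \<notin> \<H> \<Longrightarrow> f x = F x) \<Longrightarrow>
    regular_near p f"
  unfolding regular_near_def by blast

lemma regular_near_cong:
  assumes "regular_near p f" "proj_open V" "p \<in> V" "\<And>x. x \<in> V \<Longrightarrow> x \<notin> \<H> \<Longrightarrow> f x = g x"
  shows "regular_near p g"
proof -
  obtain W F where W: "proj_open W" "p \<in> W" "regular_fun W F" "\<forall>x\<in>W - \<H>. f x = F x"
    using assms(1) unfolding regular_near_def by blast
  then show ?thesis
    using assms proj_open_Int regular_fun_subset[of W F "W \<inter> V"]
    by (intro regular_nearI[of "W \<inter> V" _ F]) (auto simp flip: assms(4))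
qed

lemma regular_near_binary:
  assumes "regular_near p f" "regular_near p g"
    and op: "\<And>(W :: (complex ^ 'n) set) F G. proj_open W \<Longrightarrow> regular_fun W F \<Longrightarrow> regular_fun W G \<Longrightarrow> regular_fun W (\<lambda>x. op (F x) (G x))"
  shows "regular_near p (\<lambda>x. op (f x) (g x))"
proof -
  obtain W F where W: "proj_open W" "p \<in> W" "regular_fun W F" "\<forall>x\<in>W - \<H>. f x = F x"
    using assms(1) unfolding regular_near_def by blast
  obtain V G where V: "proj_open V" "p \<in> V" "regular_fun V G" "\<forall>x\<in>V - \<H>. g x = G x"
    using assms(2) unfolding regular_near_def by blast
  show ?thesis
  proof (rule regular_nearI[of "W \<inter> V" _ "\<lambda>x. op (F x) (G x)"])
    show "regular_fun (W \<inter> V) (\<lambda>x. op (F x) (G x))"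
      by (rule op proj_open_Int regular_fun_subset[OF W(3)] regular_fun_subset[OF V(3)] W(1) V(1) Int_lower1 Int_lower2)+
  qed (use W V in \<open>auto intro: proj_open_Int\<close>)
qed

lemma regular_near_add:
  "regular_near p f \<Longrightarrow> regular_near p g \<Longrightarrow> regular_near p (\<lambda>x. f x + g x)"
  by (erule (1) regular_near_binary) (rule regular_fun_add; assumption)

lemma regular_near_diff:
  "regular_near p f \<Longrightarrow> regular_near p g \<Longrightarrow> regular_near p (\<lambda>x. f x - g x)"
  by (erule (1) regular_near_binary) (rule regular_fun_diff; assumption)

lemma regular_near_mult:
  "regular_near p f \<Longrightarrow> regular_near p g \<Longrightarrow> regular_near p (\<lambda>x. f x * g x)"
  by (erule (1) regular_near_binary) (rule regular_fun_mult; assumption)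

lemma regular_near_const: "p \<noteq> 0 \<Longrightarrow> regular_near p (\<lambda>_. t)"
  by (rule regular_nearI[of "-{0}" _ "\<lambda>_. t"])
    (auto intro: regular_fun_const proj_open_nonzero)

lemma regular_near_sum:
  assumes "p \<noteq> 0" "finite K" "\<And>k. k \<in> K \<Longrightarrow> regular_near p (f k)"
  shows "regular_near p (\<lambda>x. \<Sum>k\<in>K. f k x)"
  using assms(2,3)
  by (induction K rule: finite_induct) (auto intro: regular_near_const[OF assms(1)] regular_near_add)

lemma regular_near_quotient:
  assumes "P \<in> forms d" "Q \<in> forms d" "Q p \<noteq> 0" "p \<noteq> 0"
  shows "regular_near p (\<lambda>x. P x / Q x)"
proof (rule regular_nearI)
  show "proj_open {x. x \<noteq> 0 \<and> Q x \<noteq> 0}" by (rule proj_open_nonvanishing) fact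
  then show "regular_fun {x. x \<noteq> 0 \<and> Q x \<noteq> 0} (\<lambda>x. P x / Q x)"
    by (rule regular_fun_quotient[OF _ assms(1,2)]) auto
qed (use assms in auto)

lemma regular_fun_regular_near:
  "regular_fun U f \<Longrightarrow> proj_open U \<Longrightarrow> p \<in> U \<Longrightarrow> regular_near p f"
  by (rule regular_nearI) auto

lemma dual_field_forms: "(\<lambda>x. linear_form e (dual_field c a b h k x)) \<in> forms 1"
  unfolding linear_form_dual_field by (rule linear_form_forms)

text \<open>
  The logarithmic derivative of a linear form \<open>e\<close> along a dual vector field has no pole at \<open>p\<close>: where
  \<open>e\<close> is one of the hyperplanes through \<open>p\<close> the field is tangent to it.
\<close>

lemma log_derivative_regular:
  assumes fr: "frame_at p W b h" and k: "k \<noteq> h"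
    and e: "linear_form e p \<noteq> 0 \<or> e \<in> a ` {..<c}"
  shows "regular_near p (\<lambda>x. linear_form e (dual_field c a b h k x) / linear_form e x)"
proof (cases "linear_form e p = 0")
  case False
  then show ?thesis
    using frame_atD(1,2)[OF fr] proj_open_nonzeroD
    by (intro regular_near_quotient[OF dual_field_forms linear_form_forms]) auto
next
  case True
  then obtain i where i: "i < c" "e = a i" using e by auto
  obtain j where j: "j \<in> log_indices c a b h" "b $ j = a i"
    using frame_atD(6)[OF fr] i True by blast
  show ?thesis
  proof (rule regular_near_cong[OF regular_near_const[of p "if j = k then 1 else 0"] frame_atD(1,2)[OF fr]])
    show "p \<noteq> 0" using frame_atD(1,2)[OF fr] proj_open_nonzeroD by blast
    fix x assume "x \<in> W" "x \<notin> \<H>"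
    then show "(if j = k then 1 else 0) = linear_form e (dual_field c a b h k x) / linear_form e x"
      using log_form_nonzero[of x j b h] j dual_field_pairing[OF frame_atD(4)[OF fr], of j c a h k x]
      by (auto simp: i)
  qed
qed

text \<open>
  The transition functions between two logarithmic frames are regular, which is the independence of
  the sheaf of the choice of adapted coordinates.
\<close>

lemma log_frame_change_regular:
  assumes fr: "frame_at p W b h" and k: "k \<noteq> h"
    and V: "proj_open V" "p \<in> V" "adapted_coords c a V b' h'"
  shows "regular_near p (\<lambda>x. linear_form (log_frame c a b' h' j x) (dual_field c a b h k x))"
proof -
  have h': "linear_form (b' $ h') x \<noteq> 0" if "x \<in> V" for x
    using V(3) that by (auto simp: adapted_coords_def)
  show ?thesis
  proof (cases "j \<in> log_indices c a b' h'")
    case True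
    have "regular_near p (\<lambda>x. linear_form (b' $ j) (dual_field c a b h k x) / linear_form (b' $ j) x -
        linear_form (b' $ h') (dual_field c a b h k x) / linear_form (b' $ h') x)"
      by (intro regular_near_diff log_derivative_regular[OF fr k])
        (use True h' V in \<open>auto simp: log_indices_def\<close>)
    then show ?thesis
      by (rule regular_near_cong[OF _ V(1,2)]) (use True h' in \<open>simp add: log_frame_pairing'\<close>)
  next
    case False
    define P where "P x = linear_form (b' $ j) (dual_field c a b h k x) * linear_form (b' $ h') x
      + linear_form (- (b' $ j)) x * linear_form (b' $ h') (dual_field c a b h k x)" for x
    have "P \<in> forms (1 + 1)"
      unfolding P_def by (intro add_forms mult_forms dual_field_forms linear_form_forms)
    moreover have "(\<lambda>x. linear_form (b' $ h') x * linear_form (b' $ h') x) \<in> forms (1 + 1)"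
      by (intro mult_forms linear_form_forms)
    ultimately have "regular_near p (\<lambda>x. P x / (linear_form (b' $ h') x * linear_form (b' $ h') x))"
      using h' V proj_open_nonzeroD by (intro regular_near_quotient) auto
    moreover have "linear_form (- (b' $ j)) x = - linear_form (b' $ j) x" for x
      by (metis linear_form_scale_left mult_minus1 vec.scale_minus_left vec.scale_one)
    ultimately show ?thesis
      by (elim regular_near_cong[OF _ V(1,2)])
        (use False h' in \<open>simp add: log_frame_pairing' P_def power2_eq_square\<close>)
  qed
qed

text \<open>
  The coefficients with respect to a frame are the pairings with the dual fields, so a form is
  logarithmic near \<open>p\<close> as soon as these finitely many pairings are regular near \<open>p\<close>.
\<close>

lemma local_expansion:
  assumes fr: "frame_at p W b h" and U: "proj_open U" "p \<in> U"
    and radial: "\<And>x. x \<in> U \<Longrightarrow> x \<notin> \<H> \<Longrightarrow> linear_form (\<omega> x) x = 0"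
    and reg: "\<And>k. k \<noteq> h \<Longrightarrow> regular_near p (\<lambda>x. linear_form (\<omega> x) (dual_field c a b h k x))"
  shows "\<exists>V F. proj_open V \<and> p \<in> V \<and> V \<subseteq> U \<and> V \<subseteq> W \<and> (\<forall>k. regular_fun V (F k)) \<and>
    (\<forall>x\<in>V - \<H>. \<omega> x = (\<Sum>k\<in>-{h}. F k x *s log_frame c a b h k x)) \<and>
    (\<forall>x\<in>V - \<H>. \<forall>k\<in>-{h}. F k x = linear_form (\<omega> x) (dual_field c a b h k x))"
proof -
  have "\<forall>k\<in>-{h}. \<exists>V F. proj_open V \<and> p \<in> V \<and> regular_fun V F \<and>
      (\<forall>x\<in>V - \<H>. linear_form (\<omega> x) (dual_field c a b h k x) = F x)"
    using reg unfolding regular_near_def by blast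
  from bchoice[OF this] obtain V where "\<forall>k\<in>-{h}. \<exists>F. proj_open (V k) \<and> p \<in> V k \<and> regular_fun (V k) F \<and>
      (\<forall>x\<in>V k - \<H>. linear_form (\<omega> x) (dual_field c a b h k x) = F x)" ..
  from bchoice[OF this] obtain F where "\<forall>k\<in>-{h}. proj_open (V k) \<and> p \<in> V k \<and> regular_fun (V k) (F k) \<and>
      (\<forall>x\<in>V k - \<H>. linear_form (\<omega> x) (dual_field c a b h k x) = F k x)" ..
  then have VF: "\<And>k. k \<noteq> h \<Longrightarrow> proj_open (V k)" "\<And>k. k \<noteq> h \<Longrightarrow> p \<in> V k"
    "\<And>k. k \<noteq> h \<Longrightarrow> regular_fun (V k) (F k)"
    "\<And>k x. k \<noteq> h \<Longrightarrow> x \<in> V k \<Longrightarrow> x \<notin> \<H> \<Longrightarrow> linear_form (\<omega> x) (dual_field c a b h k x) = F k x"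
    by auto
  define G where "G k = (if k = h then (\<lambda>_. 0) else F k)" for k
  define Z where "Z = U \<inter> W \<inter> (\<Inter>k\<in>-{h}. V k)"
  have inter: "proj_open (A \<inter> (\<Inter>k\<in>K. V k))" if "finite K" "K \<subseteq> -{h}" "proj_open A" for K A
    using that
  proof (induction K rule: finite_induct)
    case (insert k K)
    have "A \<inter> (\<Inter>k\<in>insert k K. V k) = (A \<inter> (\<Inter>k\<in>K. V k)) \<inter> V k" by auto
    then show ?case using insert VF(1)[of k] proj_open_Int by auto
  qed simp
  have Z: "proj_open Z" "p \<in> Z" "Z \<subseteq> U" "Z \<subseteq> W" "\<And>k. k \<noteq> h \<Longrightarrow> Z \<subseteq> V k"
    using inter[of "-{h}" "U \<inter> W"] U frame_atD(1,2)[OF fr] VF(2) proj_open_Int[of U W]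
    unfolding Z_def by auto
  have "regular_fun Z (G k)" for k
  proof (cases "k = h")
    case True
    then show ?thesis by (simp add: G_def regular_fun_const[OF Z(1)])
  next
    case False
    then show ?thesis
      using regular_fun_subset[OF VF(3)[OF False] Z(1) Z(5)[OF False]] by (simp add: G_def)
  qed
  moreover have G: "G k x = linear_form (\<omega> x) (dual_field c a b h k x)"
    if "x \<in> Z - \<H>" "k \<in> -{h}" for k x
    using that subsetD[OF Z(5)[of k], of x] VF(4)[of k x] by (auto simp: G_def)
  moreover have "\<omega> x = (\<Sum>k\<in>-{h}. G k x *s log_frame c a b h k x)" if "x \<in> Z - \<H>" for x
  proof -
    have "\<omega> x = (\<Sum>k\<in>-{h}. linear_form (\<omega> x) (dual_field c a b h k x) *s log_frame c a b h k x)"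
      by (rule log_frame_expansion) (use that Z radial frame_atD[OF fr] in auto)
    then show ?thesis using G[OF that] by simp
  qed
  ultimately show ?thesis using Z by blast
qed

abbreviation \<Omega> :: "(complex ^ 'n) set \<Rightarrow> (complex ^ 'n \<Rightarrow> complex ^ 'n) set" where
  "\<Omega> \<equiv> log_cotangent c a"

lemma log_cotangentI:
  assumes U: "proj_open U" and zero: "\<And>x. x \<notin> U \<or> x \<in> \<H> \<Longrightarrow> \<omega> x = 0"
    and radial: "\<And>x. x \<in> U \<Longrightarrow> x \<notin> \<H> \<Longrightarrow> linear_form (\<omega> x) x = 0"
    and reg: "\<And>p W b h k. p \<in> U \<Longrightarrow> frame_at p W b h \<Longrightarrow> k \<noteq> h \<Longrightarrow>
      regular_near p (\<lambda>x. linear_form (\<omega> x) (dual_field c a b h k x))"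
  shows "\<omega> \<in> \<Omega> U"
  unfolding log_cotangent_def
proof (intro CollectI conjI ballI)
  show "\<forall>x. x \<notin> U - \<H> \<longrightarrow> \<omega> x = 0" using zero by auto
  fix p assume p: "p \<in> U"
  obtain W b h where fr: "frame_at p W b h"
    by (rule frame_exists[OF proj_open_nonzeroD[OF U p]])
  obtain V F where V: "proj_open V" "p \<in> V" "V \<subseteq> U" "V \<subseteq> W" "\<forall>k. regular_fun V (F k)"
    "\<forall>x\<in>V - \<H>. \<omega> x = (\<Sum>k\<in>-{h}. F k x *s log_frame c a b h k x)"
    using local_expansion[OF fr U p radial reg[OF p fr]] by blast
  moreover have "adapted_coords c a V b h"
    using V(4) frame_atD(3)[OF fr] adapted_coords_subset by blast
  ultimately show "\<exists>W b h f. proj_open W \<and> p \<in> W \<and> W \<subseteq> U \<and> adapted_coords c a W b h \<and>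
      (\<forall>k. regular_fun W (f k)) \<and>
      (\<forall>x\<in>W - \<H>. \<omega> x = (\<Sum>k\<in>-{h}. f k x *s log_frame c a b h k x))"
    by blast
qed

lemma log_cotangentE:
  assumes "\<omega> \<in> \<Omega> U" "p \<in> U"
  obtains W b h f where "proj_open W" "p \<in> W" "W \<subseteq> U" "adapted_coords c a W b h"
    "\<forall>k. regular_fun W (f k)"
    "\<forall>x \<in> W - \<H>. \<omega> x = (\<Sum>k\<in>-{h}. f k x *s log_frame c a b h k x)"
  using assms unfolding log_cotangent_def by blast

lemma log_cotangent_zero: "\<omega> \<in> \<Omega> U \<Longrightarrow> x \<notin> U \<or> x \<in> \<H> \<Longrightarrow> \<omega> x = 0"
  unfolding log_cotangent_def by blast

lemma log_cotangent_radial: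
  assumes "\<omega> \<in> \<Omega> U"
  shows "linear_form (\<omega> x) x = 0"
proof (cases "x \<in> U - \<H>")
  case True
  then obtain W b h f where W: "proj_open W" "x \<in> W" "W \<subseteq> U" "adapted_coords c a W b h"
    "\<forall>k. regular_fun W (f k)"
    "\<forall>x \<in> W - \<H>. \<omega> x = (\<Sum>k\<in>-{h}. f k x *s log_frame c a b h k x)"
    using log_cotangentE[OF assms, of x] by blast
  have "\<omega> x = (\<Sum>k\<in>-{h}. f k x *s log_frame c a b h k x)" using W True by blast
  moreover have "linear_form (b $ h) x \<noteq> 0" using W(2,4) by (auto simp: adapted_coords_def)
  ultimately show ?thesis by (simp add: linear_form_sum_left log_frame_radial)
next
  case False
  then show ?thesis using log_cotangent_zero[OF assms] by auto
qed

lemma \<H>_scale: "t \<noteq> 0 \<Longrightarrow> t *s x \<in> \<H> \<longleftrightarrow> x \<in> \<H>"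
  by (auto simp: hyperplane_sum_def)

lemma log_frame_scale:
  assumes "t \<noteq> 0" "linear_form (b $ h) x \<noteq> 0"
  shows "log_frame c a b h k (t *s x) = inverse t *s log_frame c a b h k x"
  by (rule linear_form_eqI) (use assms in \<open>simp add: log_frame_pairing field_simps power2_eq_square\<close>)

lemma log_cotangent_scale:
  assumes "\<omega> \<in> \<Omega> U" "proj_open U" "t \<noteq> 0"
  shows "\<omega> (t *s x) = inverse t *s \<omega> x"
proof (cases "x \<in> U - \<H>")
  case True
  then obtain W b h f where W: "proj_open W" "x \<in> W" "W \<subseteq> U" "adapted_coords c a W b h"
    "\<forall>k. regular_fun W (f k)"
    "\<forall>x \<in> W - \<H>. \<omega> x = (\<Sum>k\<in>-{h}. f k x *s log_frame c a b h k x)"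
    using log_cotangentE[OF assms(1), of x] by blast
  have x: "\<omega> x = (\<Sum>k\<in>-{h}. f k x *s log_frame c a b h k x)" using W True by blast
  have "t *s x \<in> W - \<H>" using W(1,2) assms(3) True by (simp add: proj_open_scale \<H>_scale)
  then have tx: "\<omega> (t *s x) = (\<Sum>k\<in>-{h}. f k (t *s x) *s log_frame c a b h k (t *s x))"
    using W by blast
  have h: "linear_form (b $ h) x \<noteq> 0" using W(2,4) by (auto simp: adapted_coords_def)
  have "f k (t *s x) = f k x" for k using regular_fun_scale W(2,5) assms(3) by blast
  then show ?thesis
    unfolding x tx by (simp add: log_frame_scale[OF assms(3) h] vec.scale_sum_right mult.commute)
next
  case False
  then show ?thesis
    using log_cotangent_zero[OF assms(1)] assms(2,3) proj_open_scale \<H>_scale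
    by (metis DiffI vector_smult_rzero)
qed

lemma log_cotangent_regular_near:
  assumes \<omega>: "\<omega> \<in> \<Omega> U" and p: "p \<in> U" and fr: "frame_at p W b h" and k: "k \<noteq> h"
  shows "regular_near p (\<lambda>x. linear_form (\<omega> x) (dual_field c a b h k x))"
proof -
  obtain V b' h' f where V: "proj_open V" "p \<in> V" "V \<subseteq> U" "adapted_coords c a V b' h'"
    "\<forall>k. regular_fun V (f k)"
    "\<forall>x \<in> V - \<H>. \<omega> x = (\<Sum>k\<in>-{h'}. f k x *s log_frame c a b' h' k x)"
    using log_cotangentE[OF \<omega> p] by blast
  have "regular_near p (\<lambda>x. \<Sum>j\<in>-{h'}. f j x * linear_form (log_frame c a b' h' j x) (dual_field c a b h k x))"
    using V proj_open_nonzeroD[OF V(1,2)]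
    by (intro regular_near_sum regular_near_mult log_frame_change_regular[OF fr k V(1,2,4)]
        regular_fun_regular_near[of V]) auto
  then show ?thesis
    by (rule regular_near_cong[OF _ V(1,2)]) (use V(6) in \<open>simp add: linear_form_sum_left\<close>)
qed

text \<open>
  Each section can be expanded near \<open>p\<close> in any given frame at \<open>p\<close>, which allows to add sections
  and to evaluate them at a point of the projectivised bundle.
\<close>

lemma log_cotangent_expansion:
  assumes \<omega>: "\<omega> \<in> \<Omega> U" and p: "proj_open U" "p \<in> U" and fr: "frame_at p W b h"
  shows "\<exists>V F. proj_open V \<and> p \<in> V \<and> V \<subseteq> U \<and> V \<subseteq> W \<and> (\<forall>k. regular_fun V (F k)) \<and>
    (\<forall>x\<in>V - \<H>. \<omega> x = (\<Sum>k\<in>-{h}. F k x *s log_frame c a b h k x)) \<and>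
    (\<forall>x\<in>V - \<H>. \<forall>k\<in>-{h}. F k x = linear_form (\<omega> x) (dual_field c a b h k x))"
  using local_expansion[OF fr p log_cotangent_radial[OF \<omega>] log_cotangent_regular_near[OF \<omega> p(2) fr]] .

lemma log_cotangent_add:
  assumes "\<omega> \<in> \<Omega> U" "\<eta> \<in> \<Omega> U" "proj_open U"
  shows "(\<lambda>x. \<omega> x + \<eta> x) \<in> \<Omega> U"
  using log_cotangent_zero[OF assms(1)] log_cotangent_zero[OF assms(2)]
    log_cotangent_regular_near[OF assms(1)] log_cotangent_regular_near[OF assms(2)]
  by (intro log_cotangentI[OF assms(3)])
    (auto simp: log_cotangent_radial[OF assms(1)] log_cotangent_radial[OF assms(2)] intro!: regular_near_add)

lemma log_cotangent_mult:
  assumes "\<omega> \<in> \<Omega> U" "regular_fun U f" "proj_open U"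
  shows "(\<lambda>x. f x *s \<omega> x) \<in> \<Omega> U"
  using log_cotangent_zero[OF assms(1)] log_cotangent_regular_near[OF assms(1)]
    regular_fun_regular_near[OF assms(2,3)]
  by (intro log_cotangentI[OF assms(3)])
    (auto simp: log_cotangent_radial[OF assms(1)] intro!: regular_near_mult)

lemma log_cotangent_restrict:
  assumes "\<omega> \<in> \<Omega> U" "proj_open W" "W \<subseteq> U"
  shows "(\<lambda>x. if x \<in> W then \<omega> x else 0) \<in> \<Omega> W"
proof (rule log_cotangentI[OF assms(2)])
  fix p V b h k assume p: "p \<in> W" and fr: "frame_at p V b h" and k: "k \<noteq> h"
  show "regular_near p (\<lambda>x. linear_form (if x \<in> W then \<omega> x else 0) (dual_field c a b h k x))"
    by (rule regular_near_cong[OF log_cotangent_regular_near[OF assms(1) _ fr k] assms(2) p])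
      (use p assms in auto)
qed (use log_cotangent_zero[OF assms(1)] assms in \<open>auto simp: log_cotangent_radial[OF assms(1)]\<close>)

definition frame_section :: "(complex ^ 'n) set \<Rightarrow> complex ^ 'n ^ 'n \<Rightarrow> 'n \<Rightarrow> 'n \<Rightarrow> complex ^ 'n \<Rightarrow> complex ^ 'n" where
  "frame_section W b h k x = (if x \<in> W - \<H> then log_frame c a b h k x else 0)"

lemma frame_section_log_cotangent:
  assumes "proj_open W" "adapted_coords c a W b h"
  shows "frame_section W b h k \<in> \<Omega> W"
proof (rule log_cotangentI[OF assms(1)])
  fix p V b' h' j assume p: "p \<in> W" and fr: "frame_at p V b' h'" and j: "j \<noteq> h'"
  show "regular_near p (\<lambda>x. linear_form (frame_section W b h k x) (dual_field c a b' h' j x))"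
    by (rule regular_near_cong[OF log_frame_change_regular[OF fr j assms(1) p assms(2)] assms(1) p])
      (auto simp: frame_section_def)
qed (use assms in \<open>auto simp: frame_section_def adapted_coords_def log_frame_radial\<close>)

text \<open>The global forms \<open>dl/l - dl'/l'\<close>, where \<open>l\<close> and \<open>l'\<close> are equations of hyperplanes.\<close>

definition dlog_ratio :: "nat \<Rightarrow> nat \<Rightarrow> complex ^ 'n \<Rightarrow> complex ^ 'n" where
  "dlog_ratio i j x = (if x = 0 \<or> x \<in> \<H> then 0
     else inverse (linear_form (a i) x) *s a i - inverse (linear_form (a j) x) *s a j)"

lemma dlog_ratio_log_cotangent:
  assumes "i < c" "j < c"
  shows "dlog_ratio i j \<in> \<Omega> (- {0})"
proof (rule log_cotangentI[OF proj_open_nonzero])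
  fix p W b h k assume "p \<in> - {0 :: complex ^ 'n}" and fr: "frame_at p W b h" and k: "k \<noteq> h"
  show "regular_near p (\<lambda>x. linear_form (dlog_ratio i j x) (dual_field c a b h k x))"
    by (rule regular_near_cong[OF regular_near_diff[OF
            log_derivative_regular[OF fr k, of "a i"] log_derivative_regular[OF fr k, of "a j"]] frame_atD(1,2)[OF fr]])
      (use assms proj_open_nonzeroD[OF frame_atD(1)[OF fr]] in \<open>auto simp: dlog_ratio_def divide_inverse mult.commute\<close>)
qed (use assms in \<open>auto simp: dlog_ratio_def not_in_\<H>\<close>)

section \<open>Points of the projectivised bundle\<close>

lemma closed_\<H>: "closed \<H>"
proof -
  have "\<H> = (\<Union>i\<in>{..<c}. {x. linear_form (a i) x = 0})"
    by (auto simp: hyperplane_sum_def)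
  moreover have "closed {x. linear_form (a i) x = 0}" for i
    by (intro closed_Collect_eq) (auto simp: linear_form_def intro!: continuous_intros)
  ultimately show ?thesis by auto
qed

lemma generic_curve:
  assumes "\<forall>i<C. linear_form (a i) q \<noteq> 0"
  shows "eventually (\<lambda>t. \<forall>i<C. linear_form (a i) (p + t *s q) \<noteq> 0) (at 0)"
proof -
  have "eventually (\<lambda>t. linear_form (a i) (p + t *s q) \<noteq> 0) (at 0)" if i: "i < C" for i
  proof (cases "linear_form (a i) p = 0")
    case True
    then show ?thesis using assms i by (auto simp: eventually_at_filter)
  next
    case False
    have "((\<lambda>t. linear_form (a i) (p + t *s q)) \<longlongrightarrow> linear_form (a i) (p + 0 *s q)) (at 0)"
      by (intro tendsto_intros)
    then show ?thesis using False tendsto_imp_eventually_ne by fastforce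
  qed
  then have "eventually (\<lambda>t. \<forall>i\<in>{..<C}. linear_form (a i) (p + t *s q) \<noteq> 0) (at 0)"
    by (intro eventually_ball_finite) auto
  then show ?thesis by (rule eventually_mono) auto
qed

text \<open>
  Limits of functions defined off the hyperplanes are meaningful at each point, since a line in a
  general direction \<open>q\<close> leaves the hyperplanes immediately.
\<close>

lemma nontrivial_limit: "at p within - \<H> \<noteq> bot"
proof -
  obtain q where q: "\<forall>i<C. linear_form (a i) q \<noteq> 0" using generic_point by blast
  have "0 < C" using dim_le zero_less_card_finite[where 'a='n] by linarith
  then have "q \<noteq> 0" using q by auto
  have "((\<lambda>t. p + t *s q) \<longlongrightarrow> p + 0 *s q) (at 0)" by (intro tendsto_intros)
  moreover have "eventually (\<lambda>t. p + t *s q \<in> - \<H> \<and> p + t *s q \<noteq> p) (at 0)"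
    using generic_curve[OF q, of p] eventually_neq_at_within[of 0]
    by eventually_elim (use \<open>q \<noteq> 0\<close> c_le in \<open>auto simp: not_in_\<H>\<close>)
  ultimately have "filterlim (\<lambda>t. p + t *s q) (at p within - \<H>) (at (0::complex))"
    by (simp add: filterlim_at)
  then show ?thesis by (metis at_neq_bot filterlim_def filtermap_bot_iff bot.extremum_uniqueI)
qed

definition germ :: "complex ^ 'n \<Rightarrow> (complex ^ 'n \<Rightarrow> complex ^ 'n) \<Rightarrow> bool" where
  "germ p \<omega> \<longleftrightarrow> (\<exists>U. proj_open U \<and> p \<in> U \<and> \<omega> \<in> \<Omega> U)"

text \<open>
  Outside the hyperplanes a rank one quotient is given by a tangent vector.  At a point \<open>p\<close> of the
  hyperplanes, the pairing with a tangent vector has to be replaced by the limit of the pairing with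
  the vector field whose components in the dual frame are constant.
\<close>

definition tangent_point :: "complex ^ 'n \<Rightarrow> complex ^ 'n \<Rightarrow> (complex ^ 'n \<Rightarrow> complex ^ 'n) \<Rightarrow> complex" where
  "tangent_point x v \<omega> = (if germ x \<omega> then linear_form (\<omega> x) v else 0)"

definition limit_point ::
    "complex ^ 'n \<Rightarrow> complex ^ 'n ^ 'n \<Rightarrow> 'n \<Rightarrow> complex ^ 'n \<Rightarrow> (complex ^ 'n \<Rightarrow> complex ^ 'n) \<Rightarrow> complex" where
  "limit_point p b h y \<omega> =
    (if germ p \<omega> then Lim (at p within - \<H>)
       (\<lambda>x. \<Sum>k\<in>-{h}. y $ k * linear_form (\<omega> x) (dual_field c a b h k x)) else 0)"

lemma eventually_within_open:
  assumes "proj_open V" "p \<in> V"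
  shows "eventually (\<lambda>x. x \<in> V - \<H>) (at p within - \<H>)"
proof -
  have "eventually (\<lambda>x. x \<in> V) (nhds p)"
    using eventually_nhds_in_open[OF proj_open_imp_open[OF assms(1)] assms(2)] .
  then show ?thesis by (auto simp: eventually_at_filter elim: eventually_mono)
qed

lemma section_data:
  assumes \<omega>: "\<omega> \<in> \<Omega> U" and p: "proj_open U" "p \<in> U" and fr: "frame_at p W b h"
  shows "\<exists>V F. proj_open V \<and> p \<in> V \<and> V \<subseteq> U \<and> V \<subseteq> W \<and> (\<forall>k. regular_fun V (F k)) \<and>
    (\<forall>x\<in>V - \<H>. \<omega> x = (\<Sum>k\<in>-{h}. F k x *s log_frame c a b h k x)) \<and>
    (\<forall>y. ((\<lambda>x. \<Sum>k\<in>-{h}. y $ k * linear_form (\<omega> x) (dual_field c a b h k x)) \<longlongrightarrow>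
       (\<Sum>k\<in>-{h}. F k p * y $ k)) (at p within - \<H>)) \<and>
    (\<forall>y. limit_point p b h y \<omega> = (\<Sum>k\<in>-{h}. F k p * y $ k))"
proof -
  obtain V F where V: "proj_open V" "p \<in> V" "V \<subseteq> U" "V \<subseteq> W" "\<forall>k. regular_fun V (F k)"
    "\<forall>x\<in>V - \<H>. \<omega> x = (\<Sum>k\<in>-{h}. F k x *s log_frame c a b h k x)"
    "\<forall>x\<in>V - \<H>. \<forall>k\<in>-{h}. F k x = linear_form (\<omega> x) (dual_field c a b h k x)"
    using log_cotangent_expansion[OF \<omega> p fr] by blast
  have lim: "((\<lambda>x. \<Sum>k\<in>-{h}. y $ k * linear_form (\<omega> x) (dual_field c a b h k x)) \<longlongrightarrow>
       (\<Sum>k\<in>-{h}. F k p * y $ k)) (at p within - \<H>)" for y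
  proof (rule Lim_transform_eventually)
    have "isCont (F k) p" for k using V regular_fun_isCont by blast
    then have "(F k \<longlongrightarrow> F k p) (at p within - \<H>)" for k
      using continuous_at_imp_continuous_at_within continuous_within by blast
    then show "((\<lambda>x. \<Sum>k\<in>-{h}. F k x * y $ k) \<longlongrightarrow> (\<Sum>k\<in>-{h}. F k p * y $ k)) (at p within - \<H>)"
      by (intro tendsto_intros)
    show "eventually (\<lambda>x. (\<Sum>k\<in>-{h}. F k x * y $ k) =
        (\<Sum>k\<in>-{h}. y $ k * linear_form (\<omega> x) (dual_field c a b h k x))) (at p within - \<H>)"
      using eventually_within_open[OF V(1,2)] by eventually_elim (use V(7) in \<open>simp add: mult.commute\<close>)
  qed
  have "germ p \<omega>" using \<omega> p unfolding germ_def by blast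
  then have "limit_point p b h y \<omega> = (\<Sum>k\<in>-{h}. F k p * y $ k)" for y
    using tendsto_Lim[OF nontrivial_limit lim[of y]] by (simp add: limit_point_def)
  then show ?thesis using V lim by blast
qed

lemma limit_point_tendsto:
  assumes "\<omega> \<in> \<Omega> U" "proj_open U" "p \<in> U" "frame_at p W b h"
  shows "((\<lambda>x. \<Sum>k\<in>-{h}. y $ k * linear_form (\<omega> x) (dual_field c a b h k x)) \<longlongrightarrow>
     limit_point p b h y \<omega>) (at p within - \<H>)"
  using section_data[OF assms] by force

lemma limit_point_unique:
  assumes "\<omega> \<in> \<Omega> U" "proj_open U" "p \<in> U" "frame_at p W b h"
    and "((\<lambda>x. \<Sum>k\<in>-{h}. y $ k * linear_form (\<omega> x) (dual_field c a b h k x)) \<longlongrightarrow> l) (at p within - \<H>)"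
  shows "limit_point p b h y \<omega> = l"
  using tendsto_unique[OF nontrivial_limit limit_point_tendsto[OF assms(1-4)] assms(5)] .

lemma limit_point_frame_section:
  assumes fr: "frame_at p W b h" and k: "k \<noteq> h"
  shows "limit_point p b h y (frame_section W b h k) = y $ k"
proof (rule limit_point_unique[OF frame_section_log_cotangent[OF frame_atD(1,3)[OF fr]] frame_atD(1,2)[OF fr] fr])
  have "eventually (\<lambda>x. y $ k = (\<Sum>j\<in>-{h}. y $ j * linear_form (frame_section W b h k x) (dual_field c a b h j x)))
      (at p within - \<H>)"
    using eventually_within_open[OF frame_atD(1,2)[OF fr]]
  proof eventually_elim
    case (elim x)
    have "(\<Sum>j\<in>-{h}. y $ j * linear_form (frame_section W b h k x) (dual_field c a b h j x)) =
       (\<Sum>j\<in>-{h}. if k = j then y $ j else 0)"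
      by (intro sum.cong) (use elim k log_frame_dual_field[OF frame_atD(4)[OF fr], of x h k] frame_atD(5)[OF fr]
          in \<open>auto simp: frame_section_def\<close>)
    then show ?case using k by simp
  qed
  then show "((\<lambda>x. \<Sum>j\<in>-{h}. y $ j * linear_form (frame_section W b h k x) (dual_field c a b h j x)) \<longlongrightarrow> y $ k)
      (at p within - \<H>)"
    by (rule Lim_transform_eventually[OF tendsto_const])
qed

lemma limit_point_rank_one:
  assumes fr: "frame_at p W b h" and y: "k \<noteq> h" "y $ k \<noteq> 0"
  shows "(p, limit_point p b h y) \<in> rank_one_quotients \<Omega>"
  unfolding rank_one_quotients_def
proof (intro CollectI case_prodI conjI allI impI ballI)
  show "p \<noteq> 0" using frame_atD(1,2)[OF fr] proj_open_nonzeroD by blast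
  fix U assume "proj_open U \<and> p \<in> U"
  then have U: "proj_open U" "p \<in> U" by auto
  let ?S = "\<lambda>\<omega> x. \<Sum>k\<in>-{h}. y $ k * linear_form (\<omega> x) (dual_field c a b h k x)"
  {
    fix \<omega> \<eta> assume \<omega>: "\<omega> \<in> \<Omega> U" and \<eta>: "\<eta> \<in> \<Omega> U"
    show "limit_point p b h y (\<lambda>x. \<omega> x + \<eta> x) = limit_point p b h y \<omega> + limit_point p b h y \<eta>"
    proof (rule limit_point_unique[OF log_cotangent_add[OF \<omega> \<eta> U(1)] U fr])
      show "(?S (\<lambda>x. \<omega> x + \<eta> x) \<longlongrightarrow> limit_point p b h y \<omega> + limit_point p b h y \<eta>) (at p within - \<H>)"
        using tendsto_add[OF limit_point_tendsto[OF \<omega> U fr, of y] limit_point_tendsto[OF \<eta> U fr, of y]]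
        by (simp add: algebra_simps sum.distrib)
    qed
  next
    fix \<omega> f assume \<omega>: "\<omega> \<in> \<Omega> U" and f: "regular_fun U f"
    show "limit_point p b h y (\<lambda>x. f x *s \<omega> x) = f p * limit_point p b h y \<omega>"
    proof (rule limit_point_unique[OF log_cotangent_mult[OF \<omega> f U(1)] U fr])
      have "isCont f p" using regular_fun_isCont[OF f U(2)] .
      then have "(f \<longlongrightarrow> f p) (at p within - \<H>)"
        using continuous_at_imp_continuous_at_within continuous_within by blast
      from tendsto_mult[OF this limit_point_tendsto[OF \<omega> U fr, of y]]
      show "(?S (\<lambda>x. f x *s \<omega> x) \<longlongrightarrow> f p * limit_point p b h y \<omega>) (at p within - \<H>)"
        by (simp add: sum_distrib_left mult_ac)
    qed
  next
    fix \<omega> V assume \<omega>: "\<omega> \<in> \<Omega> U" and "proj_open V \<and> p \<in> V \<and> V \<subseteq> U"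
    then have V: "proj_open V" "p \<in> V" "V \<subseteq> U" by auto
    show "limit_point p b h y (\<lambda>x. if x \<in> V then \<omega> x else 0) = limit_point p b h y \<omega>"
    proof (rule limit_point_unique[OF log_cotangent_restrict[OF \<omega> V(1,3)] V(1,2) fr])
      have "eventually (\<lambda>x. ?S \<omega> x = ?S (\<lambda>x. if x \<in> V then \<omega> x else 0) x) (at p within - \<H>)"
        using eventually_within_open[OF V(1,2)] by eventually_elim auto
      then show "(?S (\<lambda>x. if x \<in> V then \<omega> x else 0) \<longlongrightarrow> limit_point p b h y \<omega>) (at p within - \<H>)"
        by (rule Lim_transform_eventually[OF limit_point_tendsto[OF \<omega> U fr]])
    qed
  }
next
  fix \<omega> assume "\<nexists>U. proj_open U \<and> p \<in> U \<and> \<omega> \<in> \<Omega> U"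
  then show "limit_point p b h y \<omega> = 0" by (auto simp: limit_point_def germ_def)
next
  show "\<exists>\<omega>. limit_point p b h y \<omega> \<noteq> 0"
    using limit_point_frame_section[OF fr y(1), of y] y(2) by metis
qed

lemma rank_one_quotientsD:
  assumes "(p, \<xi>) \<in> rank_one_quotients \<Omega>"
  shows "p \<noteq> 0"
    "\<And>U \<omega> \<eta>. proj_open U \<Longrightarrow> p \<in> U \<Longrightarrow> \<omega> \<in> \<Omega> U \<Longrightarrow> \<eta> \<in> \<Omega> U \<Longrightarrow> \<xi> (\<lambda>x. \<omega> x + \<eta> x) = \<xi> \<omega> + \<xi> \<eta>"
    "\<And>U \<omega> f. proj_open U \<Longrightarrow> p \<in> U \<Longrightarrow> \<omega> \<in> \<Omega> U \<Longrightarrow> regular_fun U f \<Longrightarrow> \<xi> (\<lambda>x. f x *s \<omega> x) = f p * \<xi> \<omega>"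
    "\<And>U \<omega> V. proj_open U \<Longrightarrow> p \<in> U \<Longrightarrow> \<omega> \<in> \<Omega> U \<Longrightarrow> proj_open V \<Longrightarrow> p \<in> V \<Longrightarrow> V \<subseteq> U \<Longrightarrow>
      \<xi> (\<lambda>x. if x \<in> V then \<omega> x else 0) = \<xi> \<omega>"
    "\<And>\<omega>. \<not> germ p \<omega> \<Longrightarrow> \<xi> \<omega> = 0"
    "\<exists>\<omega>. \<xi> \<omega> \<noteq> 0"
  using assms unfolding rank_one_quotients_def germ_def mem_Collect_eq case_prod_conv by blast+

text \<open>
  Every rank one quotient at \<open>p\<close> arises in this way: by linearity over the local ring it is
  determined by its values on a local frame.
\<close>

lemma rank_one_limit_point:
  assumes \<xi>: "(p, \<xi>) \<in> rank_one_quotients \<Omega>" and fr: "frame_at p W b h"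
  obtains y k where "\<xi> = limit_point p b h y" "k \<noteq> h" "y $ k \<noteq> 0"
proof -
  define y :: "complex ^ 'n" where "y = (\<chi> k. \<xi> (frame_section W b h k))"
  have eq: "\<xi> \<omega> = limit_point p b h y \<omega>" for \<omega>
  proof (cases "germ p \<omega>")
    case False
    then show ?thesis using rank_one_quotientsD(5)[OF \<xi>] by (simp add: limit_point_def)
  next
    case True
    then obtain U where U: "proj_open U" "p \<in> U" "\<omega> \<in> \<Omega> U" unfolding germ_def by blast
    obtain V F where V: "proj_open V" "p \<in> V" "V \<subseteq> U" "V \<subseteq> W" "\<forall>k. regular_fun V (F k)"
      "\<forall>x\<in>V - \<H>. \<omega> x = (\<Sum>k\<in>-{h}. F k x *s log_frame c a b h k x)"
      "\<forall>y. limit_point p b h y \<omega> = (\<Sum>k\<in>-{h}. F k p * y $ k)"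
      using section_data[OF U(3,1,2) fr] by blast
    define \<phi> where "\<phi> k x = (if x \<in> V then frame_section W b h k x else 0)" for k x
    have \<phi>: "\<phi> k \<in> \<Omega> V" "\<xi> (\<phi> k) = y $ k" for k
      using log_cotangent_restrict[OF frame_section_log_cotangent[OF frame_atD(1,3)[OF fr]] V(1,4)]
        rank_one_quotientsD(4)[OF \<xi> frame_atD(1,2)[OF fr] frame_section_log_cotangent[OF frame_atD(1,3)[OF fr]] V(1,2,4)]
      by (auto simp: \<phi>_def[abs_def] y_def)
    have sum: "(\<lambda>x. \<Sum>k\<in>K. F k x *s \<phi> k x) \<in> \<Omega> V \<and>
        \<xi> (\<lambda>x. \<Sum>k\<in>K. F k x *s \<phi> k x) = (\<Sum>k\<in>K. F k p * y $ k)" if "finite K" for K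
      using that
    proof (induction K rule: finite_induct)
      case empty
      show ?case
        using log_cotangent_mult[OF \<phi>(1) regular_fun_const[OF V(1), of 0] V(1)]
          rank_one_quotientsD(3)[OF \<xi> V(1,2) \<phi>(1) regular_fun_const[OF V(1), of 0]] by simp
    next
      case (insert k K)
      have 1: "(\<lambda>x. F k x *s \<phi> k x) \<in> \<Omega> V" "\<xi> (\<lambda>x. F k x *s \<phi> k x) = F k p * y $ k"
        using log_cotangent_mult[OF \<phi>(1) _ V(1)] rank_one_quotientsD(3)[OF \<xi> V(1,2) \<phi>(1)] V(5) \<phi>(2)
        by auto
      show ?case
        using log_cotangent_add[OF 1(1) conjunct1[OF insert.IH] V(1)]
          rank_one_quotientsD(2)[OF \<xi> V(1,2) 1(1) conjunct1[OF insert.IH]] 1(2) insert by simp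
    qed
    have "(\<lambda>x. if x \<in> V then \<omega> x else 0) = (\<lambda>x. \<Sum>k\<in>-{h}. F k x *s \<phi> k x)"
    proof
      fix x
      show "(if x \<in> V then \<omega> x else 0) = (\<Sum>k\<in>-{h}. F k x *s \<phi> k x)"
        using V(4,6) log_cotangent_zero[OF U(3), of x]
        by (cases "x \<in> \<H>") (auto simp: \<phi>_def frame_section_def intro!: sum.cong)
    qed
    then have "\<xi> \<omega> = (\<Sum>k\<in>-{h}. F k p * y $ k)"
      using rank_one_quotientsD(4)[OF \<xi> U V(1-3)] sum[of "-{h}"] by simp
    then show ?thesis using V(7) by simp
  qed
  have "\<exists>k. k \<noteq> h \<and> y $ k \<noteq> 0"
  proof (rule ccontr)
    assume "\<not> ?thesis"
    then have "(\<Sum>k\<in>-{h}. y $ k * linear_form (\<omega> x) (dual_field c a b h k x)) = 0" for \<omega> x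
      by (intro sum.neutral) auto
    then have "limit_point p b h y \<omega> = 0" for \<omega>
      by (simp add: limit_point_def tendsto_Lim[OF nontrivial_limit tendsto_const])
    then show False using rank_one_quotientsD(6)[OF \<xi>] eq by simp
  qed
  then show ?thesis using that eq by blast
qed

lemma germI: "proj_open U \<Longrightarrow> p \<in> U \<Longrightarrow> \<omega> \<in> \<Omega> U \<Longrightarrow> germ p \<omega>"
  unfolding germ_def by blast

lemma tangent_point_radial:
  shows "tangent_point x (t *s x) = (\<lambda>_. 0)"
proof
  fix \<omega> show "tangent_point x (t *s x) \<omega> = 0"
    by (auto simp: tangent_point_def germ_def log_cotangent_radial)
qed

lemma tangent_point_radial_not_rank_one:
  "(x, tangent_point x (t *s x)) \<notin> rank_one_quotients \<Omega>"
  unfolding tangent_point_radial using rank_one_quotientsD(6) by blast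

lemma frame_nonzero_if_not_radial:
  assumes x: "x \<notin> \<H>" "x \<in> W" and fr: "frame_at p W b h" and v: "\<And>t. v \<noteq> t *s x"
  obtains k where "k \<noteq> h" "linear_form (log_frame c a b h k x) v \<noteq> 0"
  using log_frame_kernel[OF frame_atD(4)[OF fr] x(1) frame_atD(5)[OF fr x(2)]] v by blast

text \<open>
  Off the hyperplanes the two descriptions agree, and the tangent vector is determined up to radial
  vectors by its coordinates in a frame.
\<close>

lemma tangent_point_eq_limit_point:
  assumes fr: "frame_at x W b h" and x: "x \<notin> \<H>"
  shows "tangent_point x v = limit_point x b h (\<chi> k. linear_form (log_frame c a b h k x) v)"
proof
  fix \<omega>
  show "tangent_point x v \<omega> = limit_point x b h (\<chi> k. linear_form (log_frame c a b h k x) v) \<omega>"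
  proof (cases "germ x \<omega>")
    case True
    then obtain U where U: "proj_open U" "x \<in> U" "\<omega> \<in> \<Omega> U" unfolding germ_def by blast
    obtain V F where V: "x \<in> V" "\<forall>x\<in>V - \<H>. \<omega> x = (\<Sum>k\<in>-{h}. F k x *s log_frame c a b h k x)"
      "\<forall>y. limit_point x b h y \<omega> = (\<Sum>k\<in>-{h}. F k x * y $ k)"
      using section_data[OF U(3,1,2) fr] by blast
    then show ?thesis using True x by (simp add: tangent_point_def linear_form_sum_left)
  qed (simp add: tangent_point_def limit_point_def)
qed

lemma tangent_point_rank_one:
  assumes "x \<noteq> 0" "x \<notin> \<H>" "\<And>t. v \<noteq> t *s x"
  shows "(x, tangent_point x v) \<in> rank_one_quotients \<Omega>"
proof -
  obtain W b h where fr: "frame_at x W b h" using frame_exists[OF assms(1)] by blast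
  obtain k where "k \<noteq> h" "linear_form (log_frame c a b h k x) v \<noteq> 0"
    using frame_nonzero_if_not_radial[OF assms(2) frame_atD(2)[OF fr] fr assms(3)] by blast
  then show ?thesis
    unfolding tangent_point_eq_limit_point[OF fr assms(2)] by (intro limit_point_rank_one[OF fr]) auto
qed

lemma not_radial_if_frame_nonzero:
  assumes "x \<in> W" "frame_at p W b h" "linear_form (log_frame c a b h k x) v \<noteq> 0"
  shows "v \<noteq> t *s x"
  using assms log_frame_radial[OF frame_atD(5)[OF assms(2,1)], of k] by auto

lemma tangent_point_translate: "tangent_point x (v + t *s x) = tangent_point x v"
proof
  fix \<omega> show "tangent_point x (v + t *s x) \<omega> = tangent_point x v \<omega>"
    by (auto simp: tangent_point_def germ_def log_cotangent_radial)
qed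

lemma tangent_point_scale: "tangent_point x (t *s v) = (\<lambda>\<omega>. t * tangent_point x v \<omega>)"
  by (auto simp: tangent_point_def)

lemma tangent_point_homogeneous:
  assumes "t \<noteq> 0"
  shows "tangent_point (t *s x) (t *s v) = tangent_point x v"
proof
  fix \<omega>
  have "germ (t *s x) \<omega> \<longleftrightarrow> germ x \<omega>"
    using proj_open_scale[OF _ assms] unfolding germ_def by blast
  moreover have "linear_form (\<omega> (t *s x)) (t *s v) = linear_form (\<omega> x) v" if "germ x \<omega>"
    using that log_cotangent_scale[OF _ _ assms] assms unfolding germ_def by fastforce
  ultimately show "tangent_point (t *s x) (t *s v) \<omega> = tangent_point x v \<omega>"
    unfolding tangent_point_def by (simp del: linear_form_scale_right)
qed

end

section \<open>Sections of the powers of the tautological bundle\<close>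

text \<open>
  Off the hyperplanes a section of the \<open>m\<close>-th power becomes a function \<open>S x v\<close> of a point and a
  tangent vector, homogeneous of degree \<open>m\<close> in \<open>v\<close>.
\<close>

context arrangement
begin

text \<open>
  The first summands are the values of the logarithmic derivatives of the equations.  The last one
  accounts for the coordinates that are not logarithmic; it is normalised to be invariant under
  scaling \<open>x\<close> and \<open>v\<close> simultaneously.
\<close>

definition log_size :: "complex ^ 'n \<Rightarrow> complex ^ 'n \<Rightarrow> real" where
  "log_size x v = (\<Sum>i<c. norm (linear_form (a i) v / linear_form (a i) x)) + norm v / norm x"

lemma log_size_nonneg [simp]: "0 \<le> log_size x v"
  unfolding log_size_def by (intro add_nonneg_nonneg sum_nonneg) auto

text \<open>
  The properties of \<open>S\<close> from which the dimension estimate is derived.  They are stable under linear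
  combinations with fixed \<open>m\<close>.  Radial vectors correspond to no point of the projectivised bundle, so
  \<open>S\<close> is zero there by convention, and analyticity along lines is demanded only away from them.  The
  last property bounds the poles along the hyperplanes.
\<close>

definition log_symmetric :: "nat \<Rightarrow> (complex ^ 'n \<Rightarrow> complex ^ 'n \<Rightarrow> complex) \<Rightarrow> bool" where
  "log_symmetric m S \<longleftrightarrow>
    (\<forall>x t. S x (t *s x) = 0) \<and> (\<forall>v. S 0 v = 0) \<and>
    (\<forall>x v t. S x (v + t *s x) = S x v) \<and>
    (\<forall>x v t. x \<notin> \<H> \<and> t \<noteq> 0 \<longrightarrow> S (t *s x) (t *s v) = S x v) \<and>
    (\<forall>x v t. x \<notin> \<H> \<and> t \<noteq> 0 \<longrightarrow> S x (t *s v) = t ^ m * S x v) \<and>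
    (\<forall>x x' v v' t. x + t *s x' \<noteq> 0 \<and> x + t *s x' \<notin> \<H> \<and> (\<forall>s. v + t *s v' \<noteq> s *s (x + t *s x')) \<longrightarrow>
       (\<lambda>t. S (x + t *s x') (v + t *s v')) analytic_on {t}) \<and>
    (\<exists>K\<ge>0. \<forall>x v. x \<noteq> 0 \<and> x \<notin> \<H> \<longrightarrow> norm (S x v) \<le> K * log_size x v ^ m)"

lemma log_symmetricD:
  assumes "log_symmetric m S"
  shows "S x (t *s x) = 0" "S 0 v = 0" "S x (v + t *s x) = S x v"
    "x \<notin> \<H> \<Longrightarrow> t \<noteq> 0 \<Longrightarrow> S (t *s x) (t *s v) = S x v"
    "x \<notin> \<H> \<Longrightarrow> t \<noteq> 0 \<Longrightarrow> S x (t *s v) = t ^ m * S x v"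
    "x + t *s x' \<noteq> 0 \<Longrightarrow> x + t *s x' \<notin> \<H> \<Longrightarrow> (\<And>s. v + t *s v' \<noteq> s *s (x + t *s x')) \<Longrightarrow>
       (\<lambda>t. S (x + t *s x') (v + t *s v')) analytic_on {t}"
    "\<exists>K\<ge>0. \<forall>x v. x \<noteq> 0 \<and> x \<notin> \<H> \<longrightarrow> norm (S x v) \<le> K * log_size x v ^ m"
proof -
  note H = assms[unfolded log_symmetric_def]
  show "S x (t *s x) = 0" "S 0 v = 0" "S x (v + t *s x) = S x v" using H by simp_all
  show "x \<notin> \<H> \<Longrightarrow> t \<noteq> 0 \<Longrightarrow> S (t *s x) (t *s v) = S x v"
    "x \<notin> \<H> \<Longrightarrow> t \<noteq> 0 \<Longrightarrow> S x (t *s v) = t ^ m * S x v"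
    using H by simp_all
  have "\<forall>x x' v v' t. x + t *s x' \<noteq> 0 \<and> x + t *s x' \<notin> \<H> \<and> (\<forall>s. v + t *s v' \<noteq> s *s (x + t *s x')) \<longrightarrow>
       (\<lambda>t. S (x + t *s x') (v + t *s v')) analytic_on {t}"
    using H by (elim conjE)
  from this[rule_format, of x t x' v v']
  show "x + t *s x' \<noteq> 0 \<Longrightarrow> x + t *s x' \<notin> \<H> \<Longrightarrow> (\<And>s. v + t *s v' \<noteq> s *s (x + t *s x')) \<Longrightarrow>
       (\<lambda>t. S (x + t *s x') (v + t *s v')) analytic_on {t}" by simp
  show "\<exists>K\<ge>0. \<forall>x v. x \<noteq> 0 \<and> x \<notin> \<H> \<longrightarrow> norm (S x v) \<le> K * log_size x v ^ m"
    using H by (elim conjE)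
qed

lemma log_symmetric_add:
  assumes S: "log_symmetric m S" and T: "log_symmetric m T"
  shows "log_symmetric m (\<lambda>x v. S x v + T x v)"
proof -
  obtain K L where K: "K \<ge> 0" "\<forall>x v. x \<noteq> 0 \<and> x \<notin> \<H> \<longrightarrow> norm (S x v) \<le> K * log_size x v ^ m"
    and L: "L \<ge> 0" "\<forall>x v. x \<noteq> 0 \<and> x \<notin> \<H> \<longrightarrow> norm (T x v) \<le> L * log_size x v ^ m"
    using log_symmetricD(7)[OF S] log_symmetricD(7)[OF T] by blast
  have "norm (S x v + T x v) \<le> (K + L) * log_size x v ^ m" if "x \<noteq> 0 \<and> x \<notin> \<H>" for x v
    using norm_triangle_mono[of "S x v" "K * log_size x v ^ m" "T x v" "L * log_size x v ^ m"]
      K(2) L(2) that by (simp add: distrib_right)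
  then have "\<exists>K\<ge>0. \<forall>x v. x \<noteq> 0 \<and> x \<notin> \<H> \<longrightarrow> norm (S x v + T x v) \<le> K * log_size x v ^ m"
    using K(1) L(1) by (intro exI[of _ "K + L"]) auto
  then show ?thesis
    unfolding log_symmetric_def
    using log_symmetricD(1-6)[OF S] log_symmetricD(1-6)[OF T]
    by (simp add: algebra_simps analytic_on_add)
qed

lemma log_symmetric_scale:
  assumes S: "log_symmetric m S"
  shows "log_symmetric m (\<lambda>x v. u * S x v)"
proof -
  obtain K where K: "K \<ge> 0" "\<forall>x v. x \<noteq> 0 \<and> x \<notin> \<H> \<longrightarrow> norm (S x v) \<le> K * log_size x v ^ m"
    using log_symmetricD(7)[OF S] by blast
  have "norm (u * S x v) \<le> (norm u * K) * log_size x v ^ m" if "x \<noteq> 0 \<and> x \<notin> \<H>" for x v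
    using K(2) that by (simp add: norm_mult mult.assoc mult_left_mono)
  then have "\<exists>K\<ge>0. \<forall>x v. x \<noteq> 0 \<and> x \<notin> \<H> \<longrightarrow> norm (u * S x v) \<le> K * log_size x v ^ m"
    using K(1) by (intro exI[of _ "norm u * K"]) auto
  then show ?thesis
    unfolding log_symmetric_def
    using log_symmetricD(1-6)[OF S] by (simp add: analytic_on_mult)
qed

lemma log_symmetric_zero: "log_symmetric m (\<lambda>x v. 0)"
  unfolding log_symmetric_def by (auto intro!: exI[of _ 0])

lemma log_symmetric_sum:
  assumes "finite B" "\<And>s. s \<in> B \<Longrightarrow> log_symmetric m (S s)"
  shows "log_symmetric m (\<lambda>x v. \<Sum>s\<in>B. u s * S s x v)"
  using assms
proof (induction B rule: finite_induct)
  case (insert s B)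
  have "log_symmetric m (\<lambda>x v. \<Sum>s\<in>B. u s * S s x v)" using insert by simp
  from log_symmetric_add[OF log_symmetric_scale[OF insert.prems[of s], of "u s"] this]
  show ?case using insert.hyps by simp
qed (simp add: log_symmetric_zero)

text \<open>
  Continuity at a point over \<open>p\<close>, also if \<open>p\<close> is on a hyperplane: in a frame at \<open>p\<close> a section of the
  bundle is a combination of the coordinates of the tangent vector with coefficients continuous at \<open>p\<close>.
\<close>

lemma sym_section_tendsto:
  assumes "sym_section \<Omega> U k A" and U: "proj_open U" "p \<in> U" and fr: "frame_at p W b h"
    and X: "(X \<longlongrightarrow> p) F" "eventually (\<lambda>i. X i \<notin> \<H>) F"
    and Y: "\<And>j. j \<noteq> h \<Longrightarrow> ((\<lambda>i. linear_form (log_frame c a b h j (X i)) (V i)) \<longlongrightarrow> y $ j) F"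
  shows "((\<lambda>i. A (X i, tangent_point (X i) (V i))) \<longlongrightarrow> A (p, limit_point p b h y)) F"
  using assms(1)
proof induction
  case (scalar f)
  then show ?case using isCont_tendsto_compose[OF regular_fun_isCont[OF scalar U(2)] X(1)] by simp
next
  case (mult \<omega> k A)
  obtain Z f where Z: "proj_open Z" "p \<in> Z" "Z \<subseteq> U" "\<forall>k. regular_fun Z (f k)"
    "\<forall>x\<in>Z - \<H>. \<omega> x = (\<Sum>k\<in>-{h}. f k x *s log_frame c a b h k x)"
    "\<forall>y. limit_point p b h y \<omega> = (\<Sum>k\<in>-{h}. f k p * y $ k)"
    using section_data[OF mult.hyps(1) U fr] by blast
  have "((\<lambda>i. tangent_point (X i) (V i) \<omega>) \<longlongrightarrow> limit_point p b h y \<omega>) F"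
  proof (rule Lim_transform_eventually)
    show "((\<lambda>i. \<Sum>k\<in>-{h}. f k (X i) * linear_form (log_frame c a b h k (X i)) (V i)) \<longlongrightarrow> limit_point p b h y \<omega>) F"
      using Z(6) isCont_tendsto_compose[OF regular_fun_isCont X(1)] Z(2,4) Y
      by (auto intro!: tendsto_intros)
    have "eventually (\<lambda>i. X i \<in> Z) F"
      using topological_tendstoD[OF X(1) proj_open_imp_open[OF Z(1)] Z(2)] .
    with X(2) show "eventually (\<lambda>i. (\<Sum>k\<in>-{h}. f k (X i) * linear_form (log_frame c a b h k (X i)) (V i)) =
        tangent_point (X i) (V i) \<omega>) F"
    proof eventually_elim
      case (elim i)
      then have "germ (X i) \<omega>" using germI[OF U(1) _ mult.hyps(1)] Z(3) by blast
      then show ?case using Z(5) elim by (simp add: tangent_point_def linear_form_sum_left)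
    qed
  qed
  from tendsto_mult[OF this mult.IH] show ?case by simp
next
  case (add k A B)
  from tendsto_add[OF add.IH] show ?case by simp
qed

lemma taut_sectionsE:
  assumes "s \<in> taut_sections E m" "(p, \<xi>) \<in> rank_one_quotients E"
  obtains U k A B where "proj_open U" "p \<in> U" "sym_section E U (k + m) A" "sym_section E U k B"
    "B (p, \<xi>) \<noteq> 0"
    "\<And>x \<eta>. (x, \<eta>) \<in> rank_one_quotients E \<Longrightarrow> x \<in> U \<Longrightarrow> B (x, \<eta>) \<noteq> 0 \<Longrightarrow> s (x, \<eta>) = A (x, \<eta>) / B (x, \<eta>)"
proof -
  have "\<exists>U k A B. proj_open U \<and> p \<in> U \<and> sym_section E U (k + m) A \<and> sym_section E U k B \<and>
           B (p, \<xi>) \<noteq> 0 \<and>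
           (\<forall>(x, \<eta>) \<in> rank_one_quotients E.
              x \<in> U \<and> B (x, \<eta>) \<noteq> 0 \<longrightarrow> s (x, \<eta>) = A (x, \<eta>) / B (x, \<eta>))"
    using assms unfolding taut_sections_def by blast
  then show ?thesis using that by (elim exE conjE) blast
qed

lemma taut_sections_zero:
  "s \<in> taut_sections E m \<Longrightarrow> y \<notin> rank_one_quotients E \<Longrightarrow> s y = 0"
  unfolding taut_sections_def by blast

lemma taut_section_tendsto:
  assumes s: "s \<in> taut_sections \<Omega> m" and fr: "frame_at p W b h"
    and X: "(X \<longlongrightarrow> p) F" "eventually (\<lambda>i. X i \<notin> \<H>) F"
    and Y: "\<And>j. j \<noteq> h \<Longrightarrow> ((\<lambda>i. linear_form (log_frame c a b h j (X i)) (V i)) \<longlongrightarrow> y $ j) F"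
    and y: "k \<noteq> h" "y $ k \<noteq> 0"
  shows "((\<lambda>i. s (X i, tangent_point (X i) (V i))) \<longlongrightarrow> s (p, limit_point p b h y)) F"
proof -
  have p: "(p, limit_point p b h y) \<in> rank_one_quotients \<Omega>" by (rule limit_point_rank_one[OF fr y])
  obtain U d A B where U: "proj_open U" "p \<in> U" "sym_section \<Omega> U (d + m) A" "sym_section \<Omega> U d B"
    "B (p, limit_point p b h y) \<noteq> 0"
    and eq: "\<And>x \<eta>. (x, \<eta>) \<in> rank_one_quotients \<Omega> \<Longrightarrow> x \<in> U \<Longrightarrow> B (x, \<eta>) \<noteq> 0 \<Longrightarrow> s (x, \<eta>) = A (x, \<eta>) / B (x, \<eta>)"
    using taut_sectionsE[OF s p] by metis
  have lim: "((\<lambda>i. A' (X i, tangent_point (X i) (V i))) \<longlongrightarrow> A' (p, limit_point p b h y)) F"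
    if "sym_section \<Omega> U k' A'" for k' A'
    by (rule sym_section_tendsto[OF that U(1,2) fr X Y])
  have "((\<lambda>i. A (X i, tangent_point (X i) (V i)) / B (X i, tangent_point (X i) (V i))) \<longlongrightarrow>
      A (p, limit_point p b h y) / B (p, limit_point p b h y)) F"
    by (rule tendsto_divide[OF lim[OF U(3)] lim[OF U(4)] U(5)])
  moreover have "s (p, limit_point p b h y) = A (p, limit_point p b h y) / B (p, limit_point p b h y)"
    using eq p U by blast
  moreover have "eventually (\<lambda>i. A (X i, tangent_point (X i) (V i)) / B (X i, tangent_point (X i) (V i)) =
      s (X i, tangent_point (X i) (V i))) F"
    using tendsto_imp_eventually_ne[OF lim[OF U(4)] U(5)] tendsto_imp_eventually_ne[OF Y[OF y(1)] y(2)]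
      topological_tendstoD[OF X(1) proj_open_imp_open[OF U(1)] U(2)] X(2)
      topological_tendstoD[OF X(1) proj_open_imp_open[OF frame_atD(1)[OF fr]] frame_atD(2)[OF fr]]
  proof eventually_elim
    case (elim i)
    have "X i \<noteq> 0" using elim(5) proj_open_nonzeroD[OF frame_atD(1)[OF fr]] by blast
    then have "(X i, tangent_point (X i) (V i)) \<in> rank_one_quotients \<Omega>"
      using not_radial_if_frame_nonzero[OF elim(5) fr elim(2)] elim(4) by (intro tangent_point_rank_one)
    then show ?case using eq elim by simp
  qed
  ultimately show ?thesis using Lim_transform_eventually by force
qed

lemma line_avoids_\<H>:
  assumes "x + t *s x' \<notin> \<H>"
  shows "eventually (\<lambda>t. x + t *s x' \<notin> \<H>) (nhds t)"
  using eventually_line_in_open[of "- \<H>" x t x'] closed_\<H> assms by auto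

lemma linear_form_line_analytic: "(\<lambda>t. linear_form e (x + t *s x')) analytic_on A"
  by (simp add: analytic_on_add analytic_on_mult)

lemma analytic_eventually_nonzero:
  assumes "f analytic_on {t}" "f t \<noteq> (0::complex)"
  shows "eventually (\<lambda>s. f s \<noteq> 0) (nhds t)"
proof -
  have "isCont f t"
    using analytic_on_imp_differentiable_at[OF assms(1)] field_differentiable_imp_continuous_at by blast
  then have "(f \<longlongrightarrow> f t) (nhds t)" by (simp add: isCont_def tendsto_at_iff_tendsto_nhds)
  then show ?thesis using assms(2) by (rule tendsto_imp_eventually_ne)
qed

lemma log_frame_line_analytic:
  assumes "x + t *s x' \<notin> \<H>" "linear_form (b $ h) (x + t *s x') \<noteq> 0"
  shows "(\<lambda>t. linear_form (log_frame c a b h k (x + t *s x')) (v + t *s v')) analytic_on {t}"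
proof (rule analytic_on_eventually)
  let ?X = "\<lambda>t. x + t *s x'" and ?V = "\<lambda>t. v + t *s v'"
  let ?f = "\<lambda>t. if k \<in> log_indices c a b h then
       linear_form (b $ k) (?V t) / linear_form (b $ k) (?X t) - linear_form (b $ h) (?V t) / linear_form (b $ h) (?X t)
     else (linear_form (b $ k) (?V t) * linear_form (b $ h) (?X t) - linear_form (b $ k) (?X t) * linear_form (b $ h) (?V t)) /
       (linear_form (b $ h) (?X t))\<^sup>2"
  show "?f analytic_on {t}"
    using log_form_nonzero[OF assms(1), of k b h] assms(2)
    by (cases "k \<in> log_indices c a b h")
      (simp_all only: if_True if_False singleton_iff power2_eq_square,
       auto simp del: linear_form_add_right linear_form_scale_right
         intro!: analytic_on_diff analytic_on_divide analytic_on_mult linear_form_line_analytic)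
  have "eventually (\<lambda>t. linear_form (b $ h) (?X t) \<noteq> 0) (nhds t)"
    by (rule analytic_eventually_nonzero[OF linear_form_line_analytic assms(2)])
  with line_avoids_\<H>[OF assms(1)]
  show "eventually (\<lambda>t. ?f t = linear_form (log_frame c a b h k (?X t)) (?V t)) (nhds t)"
    by eventually_elim (rule log_frame_pairing'[symmetric])
qed

lemma sym_section_line_analytic:
  assumes "sym_section \<Omega> U k A" "proj_open U" "x + t *s x' \<in> U" "x + t *s x' \<notin> \<H>"
  shows "(\<lambda>t. A (x + t *s x', tangent_point (x + t *s x') (v + t *s v'))) analytic_on {t}"
  using assms(1)
proof induction
  case (scalar f)
  then show ?case using regular_fun_analytic_on_line[OF scalar assms(3)] by simp
next
  case (mult \<omega> k A)
  obtain Z b h f where Z: "proj_open Z" "x + t *s x' \<in> Z" "Z \<subseteq> U" "adapted_coords c a Z b h"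
    "\<forall>k. regular_fun Z (f k)"
    "\<forall>x\<in>Z - \<H>. \<omega> x = (\<Sum>k\<in>-{h}. f k x *s log_frame c a b h k x)"
    by (rule log_cotangentE[OF mult.hyps(1) assms(3)])
  have "(\<lambda>t. tangent_point (x + t *s x') (v + t *s v') \<omega>) analytic_on {t}"
  proof (rule analytic_on_eventually)
    have "linear_form (b $ h) (x + t *s x') \<noteq> 0" using Z(2,4) unfolding adapted_coords_def by blast
    then show "(\<lambda>t. \<Sum>k\<in>-{h}. f k (x + t *s x') * linear_form (log_frame c a b h k (x + t *s x')) (v + t *s v'))
        analytic_on {t}"
      using Z(5) by (intro analytic_on_sum analytic_on_mult log_frame_line_analytic[OF assms(4)]
          regular_fun_analytic_on_line[OF _ Z(2)]) auto
    show "eventually (\<lambda>t. (\<Sum>k\<in>-{h}. f k (x + t *s x') * linear_form (log_frame c a b h k (x + t *s x')) (v + t *s v')) =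
        tangent_point (x + t *s x') (v + t *s v') \<omega>) (nhds t)"
      using line_avoids_\<H>[OF assms(4)] eventually_line_in_open[OF proj_open_imp_open[OF Z(1)] Z(2)]
    proof eventually_elim
      case (elim t)
      then have "germ (x + t *s x') \<omega>" using germI[OF assms(2) _ mult.hyps(1)] Z(3) by blast
      moreover have "\<omega> (x + t *s x') = (\<Sum>k\<in>-{h}. f k (x + t *s x') *s log_frame c a b h k (x + t *s x'))"
        using Z(6) elim by blast
      ultimately show ?case
        by (simp add: tangent_point_def linear_form_sum_left del: linear_form_add_right linear_form_scale_right)
    qed
  qed
  from analytic_on_mult[OF this mult.IH] show ?case by simp
next
  case (add k A B)
  from analytic_on_add[OF add.IH] show ?case by simp
qed

lemma taut_section_line_analytic:
  assumes s: "s \<in> taut_sections \<Omega> m" and x: "x + t *s x' \<noteq> 0" "x + t *s x' \<notin> \<H>"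
    and v: "\<And>u. v + t *s v' \<noteq> u *s (x + t *s x')"
  shows "(\<lambda>t. s (x + t *s x', tangent_point (x + t *s x') (v + t *s v'))) analytic_on {t}"
proof -
  let ?X = "\<lambda>t. x + t *s x'" and ?V = "\<lambda>t. v + t *s v'"
  obtain W b h where fr: "frame_at (?X t) W b h" using frame_exists[OF x(1)] by blast
  note frD = frame_atD[OF fr]
  obtain k where k: "k \<noteq> h" "linear_form (log_frame c a b h k (?X t)) (?V t) \<noteq> 0"
    using frame_nonzero_if_not_radial[OF x(2) frD(2) fr v] by blast
  have r1: "(?X t, tangent_point (?X t) (?V t)) \<in> rank_one_quotients \<Omega>"
    by (rule tangent_point_rank_one[OF x v])
  obtain U d A B where U: "proj_open U" "?X t \<in> U" "sym_section \<Omega> U (d + m) A" "sym_section \<Omega> U d B"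
    "B (?X t, tangent_point (?X t) (?V t)) \<noteq> 0"
    and eq: "\<And>x \<eta>. (x, \<eta>) \<in> rank_one_quotients \<Omega> \<Longrightarrow> x \<in> U \<Longrightarrow> B (x, \<eta>) \<noteq> 0 \<Longrightarrow> s (x, \<eta>) = A (x, \<eta>) / B (x, \<eta>)"
    using taut_sectionsE[OF s r1] by metis
  note an = sym_section_line_analytic[OF _ U(1,2) x(2), of _ _ v v']
  show ?thesis
  proof (rule analytic_on_eventually)
    show "(\<lambda>t. A (?X t, tangent_point (?X t) (?V t)) / B (?X t, tangent_point (?X t) (?V t))) analytic_on {t}"
      using an[OF U(3)] an[OF U(4)] U(5) by (intro analytic_on_divide) auto
    show "eventually (\<lambda>t. A (?X t, tangent_point (?X t) (?V t)) / B (?X t, tangent_point (?X t) (?V t)) =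
        s (?X t, tangent_point (?X t) (?V t))) (nhds t)"
      using analytic_eventually_nonzero[OF an[OF U(4)] U(5)]
        analytic_eventually_nonzero[OF log_frame_line_analytic[OF x(2) frD(5)[OF frD(2)]] k(2)]
        line_avoids_\<H>[OF x(2)]
        eventually_line_in_open[OF proj_open_imp_open[OF frD(1)] frD(2)]
        eventually_line_in_open[OF proj_open_imp_open[OF U(1)] U(2)]
    proof eventually_elim
      case (elim t)
      then have "(?X t, tangent_point (?X t) (?V t)) \<in> rank_one_quotients \<Omega>"
        using not_radial_if_frame_nonzero[OF elim(4) fr elim(2)] proj_open_nonzeroD[OF frD(1) elim(4)] elim(3)
        by (intro tangent_point_rank_one)
      then show ?case using eq elim by simp
    qed
  qed
qed

lemma sym_section_homogeneous:
  "sym_section E U k A \<Longrightarrow> A (x, \<lambda>\<omega>. t * \<xi> \<omega>) = t ^ k * A (x, \<xi>)"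
  by (induction rule: sym_section.induct) (auto simp: algebra_simps)

lemma sym_section_scale:
  "sym_section E U k A \<Longrightarrow> x \<in> U \<Longrightarrow> t \<noteq> 0 \<Longrightarrow> A (t *s x, \<xi>) = A (x, \<xi>)"
  by (induction rule: sym_section.induct) (auto simp: regular_fun_scale)

definition pullback :: "((complex ^ 'n) \<times> ((complex ^ 'n \<Rightarrow> complex ^ 'n) \<Rightarrow> complex) \<Rightarrow> complex) \<Rightarrow>
    complex ^ 'n \<Rightarrow> complex ^ 'n \<Rightarrow> complex" where
  "pullback s x v = s (x, tangent_point x v)"

lemma pullback_radial:
  assumes "s \<in> taut_sections \<Omega> m"
  shows "pullback s x (t *s x) = 0"
  unfolding pullback_def using taut_sections_zero[OF assms tangent_point_radial_not_rank_one] .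

lemma pullback_zero:
  assumes "s \<in> taut_sections \<Omega> m"
  shows "pullback s 0 v = 0"
  unfolding pullback_def using taut_sections_zero[OF assms] rank_one_quotientsD(1) by blast

lemma pullback_power:
  assumes s: "s \<in> taut_sections \<Omega> m" and x: "x \<notin> \<H>" and t: "t \<noteq> 0"
  shows "pullback s x (t *s v) = t ^ m * pullback s x v"
proof (cases "x = 0 \<or> (\<exists>u. v = u *s x)")
  case True
  then show ?thesis
    using pullback_radial[OF s] pullback_zero[OF s] by (auto simp: vec.scale_scale)
next
  case False
  then have nr: "v \<noteq> u *s x" for u by blast
  have nr': "t *s v \<noteq> u *s x" for u
  proof
    assume "t *s v = u *s x"
    then have "inverse t *s (t *s v) = inverse t *s (u *s x)" by simp
    then show False using nr[of "inverse t * u"] t by (simp add: vec.scale_scale)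
  qed
  have r: "(x, tangent_point x v) \<in> rank_one_quotients \<Omega>"
    "(x, tangent_point x (t *s v)) \<in> rank_one_quotients \<Omega>"
    using tangent_point_rank_one[OF _ x] nr nr' False by blast+
  obtain U d A B where U: "proj_open U" "x \<in> U" "sym_section \<Omega> U (d + m) A" "sym_section \<Omega> U d B"
    "B (x, tangent_point x v) \<noteq> 0"
    and eq: "\<And>x \<eta>. (x, \<eta>) \<in> rank_one_quotients \<Omega> \<Longrightarrow> x \<in> U \<Longrightarrow> B (x, \<eta>) \<noteq> 0 \<Longrightarrow> s (x, \<eta>) = A (x, \<eta>) / B (x, \<eta>)"
    using taut_sectionsE[OF s r(1)] by metis
  have B: "B (x, tangent_point x (t *s v)) = t ^ d * B (x, tangent_point x v)"
    "A (x, tangent_point x (t *s v)) = t ^ (d + m) * A (x, tangent_point x v)"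
    unfolding tangent_point_scale by (rule sym_section_homogeneous[OF U(4)] sym_section_homogeneous[OF U(3)])+
  then show ?thesis
    using eq[OF r(1) U(2,5)] eq[OF r(2) U(2)] U(5) t by (simp add: pullback_def power_add)
qed

lemma pullback_scale:
  assumes s: "s \<in> taut_sections \<Omega> m" and x: "x \<notin> \<H>" and t: "t \<noteq> 0"
  shows "pullback s (t *s x) (t *s v) = pullback s x v"
proof (cases "x = 0 \<or> (\<exists>u. v = u *s x)")
  case True
  then show ?thesis
  proof
    assume "\<exists>u. v = u *s x"
    then obtain u where u: "v = u *s x" by blast
    then have "t *s v = u *s (t *s x)" by (simp add: vec.scale_scale mult.commute)
    then show ?thesis using pullback_radial[OF s] u by metis
  qed (use pullback_zero[OF s] in simp)
next
  case False
  then have nr: "v \<noteq> u *s x" for u by blast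
  have nr': "t *s v \<noteq> u *s (t *s x)" for u
  proof
    assume "t *s v = u *s (t *s x)"
    then have "inverse t *s (t *s v) = inverse t *s (u *s (t *s x))" by simp
    then show False using nr[of u] t by (simp add: vec.scale_scale)
  qed
  have r: "(x, tangent_point x v) \<in> rank_one_quotients \<Omega>"
    using tangent_point_rank_one[OF _ x] nr False by blast
  have "(t *s x, tangent_point (t *s x) (t *s v)) \<in> rank_one_quotients \<Omega>"
    using tangent_point_rank_one[of "t *s x" "t *s v"] nr' False x t \<H>_scale[OF t] by (auto simp: vec.scale_eq_0_iff)
  then have r': "(t *s x, tangent_point x v) \<in> rank_one_quotients \<Omega>"
    by (simp add: tangent_point_homogeneous[OF t])
  obtain U d A B where U: "proj_open U" "x \<in> U" "sym_section \<Omega> U (d + m) A" "sym_section \<Omega> U d B"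
    "B (x, tangent_point x v) \<noteq> 0"
    and eq: "\<And>x \<eta>. (x, \<eta>) \<in> rank_one_quotients \<Omega> \<Longrightarrow> x \<in> U \<Longrightarrow> B (x, \<eta>) \<noteq> 0 \<Longrightarrow> s (x, \<eta>) = A (x, \<eta>) / B (x, \<eta>)"
    using taut_sectionsE[OF s r(1)] by metis
  have "A (t *s x, tangent_point x v) = A (x, tangent_point x v)"
    "B (t *s x, tangent_point x v) = B (x, tangent_point x v)"
    by (rule sym_section_scale[OF U(3,2) t] sym_section_scale[OF U(4,2) t])+
  then show ?thesis
    using eq[OF r U(2,5)] eq[OF r'] U(2,5) proj_open_scale[OF U(1) t]
    by (simp add: pullback_def tangent_point_homogeneous[OF t])
qed

text \<open>
  In terms of the coordinates of a frame near \<open>p\<close> the section is a continuous function on a compact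
  family of unit spheres, which by homogeneity bounds it near \<open>p\<close>.
\<close>

lemma pullback_local_bound:
  assumes s: "s \<in> taut_sections \<Omega> m" and m: "m > 0" and fr: "frame_at p W b h"
  shows "\<exists>K\<ge>0. eventually (\<lambda>x. x \<notin> \<H> \<longrightarrow>
    (\<forall>v. norm (pullback s x v) \<le> K * (\<Sum>k\<in>-{h}. norm (linear_form (log_frame c a b h k x) v)) ^ m)) (nhds p)"
proof (rule ccontr)
  let ?Y = "\<lambda>x v. \<Sum>k\<in>-{h}. norm (linear_form (log_frame c a b h k x) v)"
  assume "\<not> ?thesis"
  then have neg: "\<not> eventually (\<lambda>x. x \<notin> \<H> \<longrightarrow>
    (\<forall>v. norm (pullback s x v) \<le> real j * ?Y x v ^ m)) (nhds p)" for j
    using of_nat_0_le_iff by blast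
  have "\<exists>x v. x \<in> W \<and> dist x p < inverse (Suc j) \<and> x \<notin> \<H> \<and> norm (pullback s x v) > real j * ?Y x v ^ m" for j
  proof (rule ccontr)
    assume *: "\<not> ?thesis"
    have "eventually (\<lambda>x. x \<in> W \<and> dist x p < inverse (Suc j)) (nhds p)"
      using eventually_nhds_in_open[OF proj_open_imp_open[OF frame_atD(1)[OF fr]] frame_atD(2)[OF fr]]
        eventually_nhds_in_open[OF open_ball centre_in_ball[THEN iffD2], of "inverse (Suc j)" p]
      by (auto simp: dist_commute eventually_conj_iff)
    then have "eventually (\<lambda>x. x \<notin> \<H> \<longrightarrow> (\<forall>v. norm (pullback s x v) \<le> real j * ?Y x v ^ m)) (nhds p)"
      by (rule eventually_mono) (use * in \<open>auto simp: not_less\<close>)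
    then show False using neg by blast
  qed
  then obtain X V where XV: "\<And>j. X j \<in> W" "\<And>j. dist (X j) p < inverse (Suc j)" "\<And>j. X j \<notin> \<H>"
    "\<And>j. norm (pullback s (X j) (V j)) > real j * ?Y (X j) (V j) ^ m"
    by metis
  \<comment> \<open>a violating sequence has nonradial vectors, whose frame coordinates can be normalised\<close>
  define R where "R j = ?Y (X j) (V j)" for j
  have R: "R j > 0" for j
  proof (rule ccontr)
    assume "\<not> R j > 0"
    moreover have "R j \<ge> 0" unfolding R_def by (simp add: sum_nonneg)
    ultimately have "R j = 0" by simp
    then have "linear_form (log_frame c a b h k (X j)) (V j) = 0" if "k \<noteq> h" for k
      unfolding R_def using that by (subst (asm) sum_nonneg_eq_0_iff) auto
    then have "V j = (linear_form (b $ h) (V j) / linear_form (b $ h) (X j)) *s X j"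
      using log_frame_kernel[OF frame_atD(4)[OF fr] XV(3) frame_atD(5)[OF fr XV(1)]] by blast
    then have "pullback s (X j) (V j) = 0" using pullback_radial[OF s] by metis
    then have "real j * R j ^ m < 0" using XV(4)[of j] by (simp add: R_def)
    then show False using m by (simp add: \<open>R j = 0\<close> zero_power)
  qed
  \<comment> \<open>rescaled to the unit sphere of the frame coordinates, where limit points exist\<close>
  define V' where "V' j = complex_of_real (inverse (R j)) *s V j" for j
  have big: "norm (pullback s (X j) (V' j)) > real j" for j
  proof -
    have "norm (pullback s (X j) (V' j)) = inverse (R j) ^ m * norm (pullback s (X j) (V j))"
      unfolding V'_def using R[of j] pullback_power[OF s XV(3)]
      by (simp add: norm_mult norm_power del: of_real_inverse)
    also have "\<dots> > inverse (R j) ^ m * (real j * R j ^ m)"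
      using XV(4)[of j] R[of j] by (intro mult_strict_left_mono) (auto simp: R_def)
    also have "inverse (R j) ^ m * (real j * R j ^ m) = real j"
      using R[of j] by (simp add: field_simps)
    finally show ?thesis .
  qed
  define y :: "nat \<Rightarrow> complex ^ 'n" where
    "y j = (\<chi> k. if k = h then 0 else linear_form (log_frame c a b h k (X j)) (V' j))" for j
  have y_sum: "(\<Sum>k\<in>-{h}. norm (y j $ k)) = 1" for j
  proof -
    have "(\<Sum>k\<in>-{h}. norm (y j $ k)) = (\<Sum>k\<in>-{h}. inverse (R j) * norm (linear_form (log_frame c a b h k (X j)) (V j)))"
      using R[of j] by (intro sum.cong) (auto simp: y_def V'_def norm_mult simp del: of_real_inverse)
    also have "\<dots> = inverse (R j) * R j" by (simp add: R_def sum_distrib_left)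
    finally show ?thesis using R[of j] by simp
  qed
  have "norm (y j) \<le> 1" for j
  proof -
    have "norm (y j) \<le> (\<Sum>k\<in>UNIV. norm (y j $ k))" unfolding norm_vec_def by (rule L2_set_le_sum) auto
    also have "\<dots> = (\<Sum>k\<in>-{h}. norm (y j $ k))"
      by (rule sum.mono_neutral_right) (auto simp: y_def)
    finally show ?thesis using y_sum by simp
  qed
  then have "\<forall>j. y j \<in> cball 0 1" by simp
  then obtain y0 r where r: "strict_mono r" "(y \<circ> r) \<longlonglongrightarrow> y0"
    using compact_cball[of "0 :: complex ^ 'n" 1] unfolding compact_def by blast
  have lim: "(\<lambda>j. y (r j) $ k) \<longlonglongrightarrow> y0 $ k" for k
    using tendsto_vec_nth[OF r(2)] by (simp add: comp_def)
  have "(\<lambda>j. \<Sum>k\<in>-{h}. norm (y (r j) $ k)) \<longlonglongrightarrow> (\<Sum>k\<in>-{h}. norm (y0 $ k))"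
    by (intro tendsto_sum tendsto_norm lim)
  then have "(\<Sum>k\<in>-{h}. norm (y0 $ k)) = 1" using y_sum LIMSEQ_unique by (simp add: LIMSEQ_const_iff)
  then obtain k where k: "k \<noteq> h" "y0 $ k \<noteq> 0"
    by (metis (no_types, lifting) ComplD insertI1 norm_zero singletonI sum.neutral zero_neq_one)
  have "X \<longlonglongrightarrow> p"
  proof (rule metric_tendsto_imp_tendsto)
    show "(\<lambda>j. inverse (real (Suc j))) \<longlonglongrightarrow> 0" by (rule LIMSEQ_inverse_real_of_nat)
    show "eventually (\<lambda>j. dist (X j) p \<le> dist (inverse (real (Suc j))) 0) sequentially"
      using XV(2) by (auto intro!: always_eventually less_imp_le)
  qed
  then have "(\<lambda>j. X (r j)) \<longlonglongrightarrow> p" using LIMSEQ_subseq_LIMSEQ[OF _ r(1)] by (auto simp: comp_def)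
  then have "(\<lambda>j. s (X (r j), tangent_point (X (r j)) (V' (r j)))) \<longlonglongrightarrow> s (p, limit_point p b h y0)"
  proof (rule taut_section_tendsto[OF s fr _ _ _ k])
    show "(\<lambda>i. linear_form (log_frame c a b h j (X (r i))) (V' (r i))) \<longlonglongrightarrow> y0 $ j" if "j \<noteq> h" for j
      using lim[of j] that by (simp add: y_def)
  qed (use XV(3) in auto)
  then have "Bseq (\<lambda>j. pullback s (X (r j)) (V' (r j)))"
    unfolding pullback_def by (rule convergent_imp_Bseq[OF convergentI])
  then obtain K where K: "\<And>j. norm (pullback s (X (r j)) (V' (r j))) \<le> K"
    unfolding Bseq_def by blast
  obtain j where "K < real j" using reals_Archimedean2 by blast
  also have "real j \<le> real (r j)" using seq_suble[OF r(1)] by simp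
  finally show False using K[of j] big[of "r j"] by linarith
qed

lemma linear_form_le_log_size:
  assumes "i < c"
  shows "norm (linear_form (a i) v / linear_form (a i) x) \<le> log_size x v"
proof -
  have "norm (linear_form (a i) v / linear_form (a i) x) \<le> (\<Sum>i<c. norm (linear_form (a i) v / linear_form (a i) x))"
    using assms by (intro member_le_sum) auto
  then show ?thesis unfolding log_size_def by (smt (verit) divide_nonneg_nonneg norm_ge_zero)
qed

lemma norm_le_log_size:
  assumes "x \<noteq> 0" "norm x \<le> R"
  shows "norm v \<le> R * log_size x v"
proof -
  have "norm v = norm x * (norm v / norm x)" using assms by simp
  also have "\<dots> \<le> R * log_size x v"
    using assms order_trans[OF norm_ge_zero assms(2)]
    by (intro mult_mono) (auto simp: log_size_def intro!: sum_nonneg)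
  finally show ?thesis .
qed

text \<open>
  The pairings with a frame at \<open>p\<close> have no worse poles than the logarithmic derivatives of the
  equations of the hyperplanes, because the denominator of the coordinates does not vanish near \<open>p\<close>.
\<close>

lemma log_frame_le_log_size:
  assumes fr: "frame_at p W b h"
  shows "\<exists>K\<ge>0. eventually (\<lambda>x. x \<notin> \<H> \<longrightarrow>
    (\<forall>v. norm (linear_form (log_frame c a b h k x) v) \<le> K * log_size x v)) (nhds p)"
proof -
  define \<epsilon> where "\<epsilon> = norm (linear_form (b $ h) p) / 2"
  define R where "R = norm p + 1"
  define N where "N = real CARD('n)"
  have pos: "\<epsilon> > 0" "R > 0" using frame_atD(5)[OF fr frame_atD(2)[OF fr]]
    by (auto simp: \<epsilon>_def R_def add_pos_pos add_nonneg_pos)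
  have "((\<lambda>x. norm (linear_form (b $ h) x)) \<longlongrightarrow> norm (linear_form (b $ h) p)) (nhds p)"
    by (intro tendsto_intros filterlim_ident)
  then have ev1: "eventually (\<lambda>x. norm (linear_form (b $ h) x) > \<epsilon>) (nhds p)"
    using pos(1) by (intro order_tendstoD(1)) (auto simp: \<epsilon>_def)
  have "(norm \<longlongrightarrow> norm p) (nhds p)" by (intro tendsto_intros filterlim_ident)
  then have ev2: "eventually (\<lambda>x. norm x < R) (nhds p)"
    by (intro order_tendstoD(2)) (auto simp: R_def)
  define K where "K = 1 + N * norm (b $ h) * R / \<epsilon> + N * norm (b $ k) * R / \<epsilon> +
     (N * norm (b $ k) * R) * (N * norm (b $ h) * R) / \<epsilon>\<^sup>2"
  have K0: "N * norm (b $ h) * R / \<epsilon> \<ge> 0" "N * norm (b $ k) * R / \<epsilon> \<ge> 0"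
    "(N * norm (b $ k) * R) * (N * norm (b $ h) * R) / \<epsilon>\<^sup>2 \<ge> 0"
    using pos by (auto simp: N_def)
  have "eventually (\<lambda>x. x \<notin> \<H> \<longrightarrow>
    (\<forall>v. norm (linear_form (log_frame c a b h k x) v) \<le> K * log_size x v)) (nhds p)"
    using ev1 ev2 eventually_nhds_in_open[OF proj_open_imp_open[OF frame_atD(1)[OF fr]] frame_atD(2)[OF fr]]
  proof eventually_elim
    case (elim x)
    show ?case
    proof (intro impI allI)
      fix v assume x: "x \<notin> \<H>"
      have x0: "x \<noteq> 0" using elim(3) proj_open_nonzeroD[OF frame_atD(1)[OF fr]] by blast
      note v = norm_le_log_size[OF x0 less_imp_le[OF elim(2)], of v]
      have form: "norm (linear_form e v) \<le> N * norm e * R * log_size x v" for e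
      proof -
        have "norm (linear_form e v) \<le> N * norm e * norm v" unfolding N_def by (rule norm_linear_form_le)
        also have "\<dots> \<le> N * norm e * (R * log_size x v)" using v by (intro mult_left_mono) (auto simp: N_def)
        finally show ?thesis by (simp add: mult.assoc)
      qed
      have quot: "norm (linear_form e v / linear_form (b $ h) x) \<le> N * norm e * R / \<epsilon> * log_size x v" for e
      proof -
        have "norm (linear_form e v / linear_form (b $ h) x) \<le> (N * norm e * R * log_size x v) / \<epsilon>"
          unfolding norm_divide using form[of e] elim(1) pos by (intro frac_le) (auto simp: N_def)
        then show ?thesis by simp
      qed
      show "norm (linear_form (log_frame c a b h k x) v) \<le> K * log_size x v"
      proof (cases "k \<in> log_indices c a b h")
        case True
        then obtain i where i: "i < c" "b $ k = a i" by (auto simp: log_indices_def)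
        have "norm (linear_form (log_frame c a b h k x) v) \<le>
          norm (linear_form (b $ k) v / linear_form (b $ k) x) + norm (linear_form (b $ h) v / linear_form (b $ h) x)"
          using True by (simp add: log_frame_pairing'[OF x frame_atD(5)[OF fr elim(3)]] norm_triangle_ineq4)
        also have "\<dots> \<le> log_size x v + N * norm (b $ h) * R / \<epsilon> * log_size x v"
          using linear_form_le_log_size[OF i(1), of v x] quot[of "b $ h"] by (intro add_mono) (simp_all add: i(2))
        also have "\<dots> = (1 + N * norm (b $ h) * R / \<epsilon>) * log_size x v" by (simp add: distrib_right)
        also have "\<dots> \<le> K * log_size x v"
          using K0 by (intro mult_right_mono) (auto simp: K_def)
        finally show ?thesis .
      next
        case False
        let ?B = "linear_form (b $ h) x"
        have "linear_form (log_frame c a b h k x) v =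
            linear_form (b $ k) v / ?B - (linear_form (b $ k) x / ?B) * (linear_form (b $ h) v / ?B)"
          using False frame_atD(5)[OF fr elim(3)]
          by (simp add: log_frame_pairing'[OF x frame_atD(5)[OF fr elim(3)]] field_simps power2_eq_square)
        then have "norm (linear_form (log_frame c a b h k x) v) \<le> norm (linear_form (b $ k) v / ?B) +
            norm (linear_form (b $ k) x / ?B) * norm (linear_form (b $ h) v / ?B)"
          by (metis norm_mult norm_triangle_ineq4)
        also have "norm (linear_form (b $ k) x / ?B) \<le> N * norm (b $ k) * R / \<epsilon>"
        proof -
          have "norm (linear_form (b $ k) x) \<le> N * norm (b $ k) * norm x" unfolding N_def by (rule norm_linear_form_le)
          also have "\<dots> \<le> N * norm (b $ k) * R" using elim(2) by (intro mult_left_mono) (auto simp: N_def)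
          finally show ?thesis unfolding norm_divide using elim(1) pos by (intro frac_le) (auto simp: N_def)
        qed
        also have "norm (linear_form (b $ k) v / ?B) + N * norm (b $ k) * R / \<epsilon> * norm (linear_form (b $ h) v / ?B) \<le>
            N * norm (b $ k) * R / \<epsilon> * log_size x v +
            N * norm (b $ k) * R / \<epsilon> * (N * norm (b $ h) * R / \<epsilon> * log_size x v)"
          using K0 quot by (intro add_mono mult_left_mono) auto
        also have "\<dots> = (N * norm (b $ k) * R / \<epsilon> + (N * norm (b $ k) * R) * (N * norm (b $ h) * R) / \<epsilon>\<^sup>2) * log_size x v"
          by (simp add: distrib_right power2_eq_square)
        also have "\<dots> \<le> K * log_size x v"
          using K0 by (intro mult_right_mono) (auto simp: K_def)
        finally show ?thesis by (simp add: mult_right_mono)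
      qed
    qed
  qed
  moreover have "K \<ge> 0" using K0 by (simp add: K_def)
  ultimately show ?thesis by blast
qed

lemma log_size_scale:
  assumes "t \<noteq> 0"
  shows "log_size (t *s x) (t *s v) = log_size x v"
  using assms by (simp add: log_size_def)

text \<open>
  The local bounds hold uniformly, as both sides are invariant under scaling and the unit sphere is
  compact.
\<close>

lemma pullback_bound:
  assumes s: "s \<in> taut_sections \<Omega> m" and m: "m > 0"
  shows "\<exists>K\<ge>0. \<forall>x v. x \<noteq> 0 \<and> x \<notin> \<H> \<longrightarrow> norm (pullback s x v) \<le> K * log_size x v ^ m"
proof (rule ccontr)
  assume neg: "\<not> ?thesis"
  have "\<exists>x v. x \<noteq> 0 \<and> x \<notin> \<H> \<and> norm (pullback s x v) > real j * log_size x v ^ m" for j :: nat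
    using neg of_nat_0_le_iff[of j] by (metis not_less)
  then obtain X0 V0 where X0: "\<And>j. X0 j \<noteq> 0" "\<And>j. X0 j \<notin> \<H>"
    "\<And>j. norm (pullback s (X0 j) (V0 j)) > real j * log_size (X0 j) (V0 j) ^ m"
    by metis
  define u where "u j = complex_of_real (inverse (norm (X0 j)))" for j
  have u: "u j \<noteq> 0" for j using X0(1) by (simp add: u_def)
  define X where "X j = u j *s X0 j" for j
  define V where "V j = u j *s V0 j" for j
  have X: "X j \<notin> \<H>" "norm (pullback s (X j) (V j)) > real j * log_size (X j) (V j) ^ m" for j
    unfolding X_def V_def log_size_scale[OF u] pullback_scale[OF s X0(2) u] \<H>_scale[OF u]
    using X0 by auto
  have "norm (X j) = 1" for j using X0(1) by (simp add: X_def u_def norm_inverse)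
  then have "\<forall>j. X j \<in> sphere 0 1" by simp
  then obtain p r where r: "p \<in> sphere 0 1" "strict_mono r" "(X \<circ> r) \<longlonglongrightarrow> p"
    using compact_sphere[of "0 :: complex ^ 'n" 1] unfolding compact_def by blast
  then have "p \<noteq> 0" by auto
  then obtain W b h where fr: "frame_at p W b h" using frame_exists by blast
  obtain K where K: "K \<ge> 0" "eventually (\<lambda>x. x \<notin> \<H> \<longrightarrow> (\<forall>v. norm (pullback s x v) \<le>
      K * (\<Sum>k\<in>-{h}. norm (linear_form (log_frame c a b h k x) v)) ^ m)) (nhds p)"
    using pullback_local_bound[OF s m fr] by blast
  have "\<forall>k. \<exists>L. L \<ge> 0 \<and> eventually (\<lambda>x. x \<notin> \<H> \<longrightarrow>
    (\<forall>v. norm (linear_form (log_frame c a b h k x) v) \<le> L * log_size x v)) (nhds p)"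
    using log_frame_le_log_size[OF fr] by blast
  from choice[OF this] obtain L where L: "\<And>k. L k \<ge> 0" "\<And>k. eventually (\<lambda>x. x \<notin> \<H> \<longrightarrow>
    (\<forall>v. norm (linear_form (log_frame c a b h k x) v) \<le> L k * log_size x v)) (nhds p)" by blast
  define M where "M = K * (\<Sum>k\<in>-{h}. L k) ^ m"
  have "eventually (\<lambda>x. \<forall>k\<in>UNIV. x \<notin> \<H> \<longrightarrow>
    (\<forall>v. norm (linear_form (log_frame c a b h k x) v) \<le> L k * log_size x v)) (nhds p)"
    using L(2) by (intro eventually_ball_finite) auto
  with K(2) have "eventually (\<lambda>x. x \<notin> \<H> \<longrightarrow> (\<forall>v. norm (pullback s x v) \<le> M * log_size x v ^ m)) (nhds p)"
  proof eventually_elim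
    case (elim x)
    show ?case
    proof (intro impI allI)
      fix v assume x: "x \<notin> \<H>"
      have "norm (pullback s x v) \<le> K * (\<Sum>k\<in>-{h}. norm (linear_form (log_frame c a b h k x) v)) ^ m"
        using elim(1) x by blast
      also have "\<dots> \<le> K * (\<Sum>k\<in>-{h}. L k * log_size x v) ^ m"
        using elim(2) x K(1) by (intro mult_left_mono power_mono sum_mono) (auto intro!: sum_nonneg)
      also have "\<dots> = M * log_size x v ^ m"
        by (simp add: M_def power_mult_distrib flip: sum_distrib_right)
      finally show "norm (pullback s x v) \<le> M * log_size x v ^ m" .
    qed
  qed
  from filterlim_iff[THEN iffD1, OF r(3), rule_format, OF this]
  have "eventually (\<lambda>j. norm (pullback s (X (r j)) (V (r j))) \<le> M * log_size (X (r j)) (V (r j)) ^ m) sequentially"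
    by eventually_elim (use X(1) in auto)
  moreover have "eventually (\<lambda>j. M < real j) sequentially"
    using filterlim_real_sequentially by (simp add: filterlim_at_top_dense)
  ultimately have "eventually (\<lambda>j. False) sequentially"
  proof eventually_elim
    case (elim j)
    have "real j \<le> real (r j)" using seq_suble[OF r(2)] by simp
    then have "M * log_size (X (r j)) (V (r j)) ^ m \<le> real (r j) * log_size (X (r j)) (V (r j)) ^ m"
      using elim(2) by (intro mult_right_mono) auto
    then show ?case using elim(1) X(2)[of "r j"] by linarith
  qed
  then show False by simp
qed

lemma pullback_log_symmetric:
  assumes s: "s \<in> taut_sections \<Omega> m" and m: "m > 0"
  shows "log_symmetric m (pullback s)"
  unfolding log_symmetric_def
proof (intro conjI allI impI)
  show "pullback s x (v + t *s x) = pullback s x v" for x v t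
    by (simp add: pullback_def tangent_point_translate)
  show "(\<lambda>t. pullback s (x + t *s x') (v + t *s v')) analytic_on {t}"
    if "x + t *s x' \<noteq> 0 \<and> x + t *s x' \<notin> \<H> \<and> (\<forall>s. v + t *s v' \<noteq> s *s (x + t *s x'))" for x x' v v' t
    unfolding pullback_def using that by (intro taut_section_line_analytic[OF s]) auto
qed (use pullback_radial[OF s] pullback_zero[OF s] pullback_scale[OF s] pullback_power[OF s] pullback_bound[OF s m]
      in auto)

text \<open>
  The points off the hyperplanes are dense: a combination of sections that vanishes there vanishes.
\<close>

lemma sections_zero_if_pullback_zero:
  assumes B: "finite B" "B \<subseteq> taut_sections \<Omega> m"
    and zero: "\<And>x v. (\<forall>i<C. linear_form (a i) x \<noteq> 0) \<Longrightarrow> (\<Sum>s\<in>B. u s * pullback s x v) = 0"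
  shows "(\<Sum>s\<in>B. u s * s z) = 0"
proof (cases "z \<in> rank_one_quotients \<Omega>")
  case False
  then show ?thesis using B(2) taut_sections_zero by (intro sum.neutral) fastforce
next
  case True
  obtain p \<xi> where z: "z = (p, \<xi>)" by (cases z)
  have p: "p \<noteq> 0" using rank_one_quotientsD(1) True z by blast
  obtain W b h where fr: "frame_at p W b h" using frame_exists[OF p] by blast
  obtain y k where y: "\<xi> = limit_point p b h y" "k \<noteq> h" "y $ k \<noteq> 0"
    using rank_one_limit_point[OF _ fr] True z by blast
  obtain q where q: "\<forall>i<C. linear_form (a i) q \<noteq> 0" using generic_point by blast
  define X where "X t = p + t *s q" for t
  define V where "V t = (\<Sum>k\<in>-{h}. y $ k *s dual_field c a b h k (X t))" for t
  have "((\<lambda>t. p + t *s q) \<longlongrightarrow> p + 0 *s q) (at 0)" by (intro tendsto_intros)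
  then have X: "(X \<longlongrightarrow> p) (at 0)" by (simp add: X_def[abs_def])
  have ev: "eventually (\<lambda>t. \<forall>i<C. linear_form (a i) (X t) \<noteq> 0) (at 0)"
    unfolding X_def by (rule generic_curve[OF q])
  then have ev\<H>: "eventually (\<lambda>t. X t \<notin> \<H>) (at 0)"
    by eventually_elim (use c_le in \<open>auto simp: not_in_\<H>\<close>)
  have Y: "((\<lambda>t. linear_form (log_frame c a b h j (X t)) (V t)) \<longlongrightarrow> y $ j) (at 0)" if "j \<noteq> h" for j
  proof (rule Lim_transform_eventually[OF tendsto_const])
    show "eventually (\<lambda>t. y $ j = linear_form (log_frame c a b h j (X t)) (V t)) (at 0)"
      using ev\<H> topological_tendstoD[OF X proj_open_imp_open[OF frame_atD(1)[OF fr]] frame_atD(2)[OF fr]]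
    proof eventually_elim
      case (elim t)
      have "linear_form (log_frame c a b h j (X t)) (V t) = (\<Sum>k\<in>-{h}. if j = k then y $ k else 0)"
        unfolding V_def linear_form_sum_right linear_form_scale_right
        by (intro sum.cong) (use elim that log_frame_dual_field[OF frame_atD(4)[OF fr]] frame_atD(5)[OF fr] in auto)
      then show ?case using that by simp
    qed
  qed
  have "((\<lambda>t. \<Sum>s\<in>B. u s * pullback s (X t) (V t)) \<longlongrightarrow> (\<Sum>s\<in>B. u s * s z)) (at 0)"
  proof (intro tendsto_sum tendsto_mult tendsto_const)
    fix s assume "s \<in> B"
    then have "s \<in> taut_sections \<Omega> m" using B(2) by blast
    from taut_section_tendsto[OF this fr X ev\<H> Y y(2,3)]
    show "((\<lambda>t. pullback s (X t) (V t)) \<longlongrightarrow> s z) (at 0)"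
      by (simp add: pullback_def z y(1))
  qed
  moreover have "((\<lambda>t. \<Sum>s\<in>B. u s * pullback s (X t) (V t)) \<longlongrightarrow> 0) (at 0)"
    by (rule Lim_transform_eventually[OF tendsto_const]) (use ev zero in \<open>auto elim: eventually_mono\<close>)
  ultimately show ?thesis using tendsto_unique[OF at_neq_bot] by blast
qed

end

section \<open>Entire functions of polynomial growth\<close>

lemma poly_zero_if_many_roots:
  fixes q :: "complex poly"
  assumes "finite A" "degree q < card A" "\<And>z. z \<in> A \<Longrightarrow> poly q z = 0"
  shows "q = 0"
proof (rule ccontr)
  assume "q \<noteq> 0"
  then have "card {z. poly q z = 0} \<le> degree q" "finite {z. poly q z = 0}"
    by (auto intro: card_poly_roots_bound poly_roots_finite)
  moreover have "A \<subseteq> {z. poly q z = 0}" using assms(3) by auto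
  ultimately show False using assms(2) card_mono by (metis le_trans not_less)
qed

text \<open>
  Liouville's theorem, with finitely many points where only continuity is known.
\<close>

lemma entire_polynomial_growth:
  fixes f :: "complex \<Rightarrow> complex"
  assumes cont: "continuous_on UNIV f" and hol: "f holomorphic_on - Z" and Z: "finite Z"
    and growth: "\<And>z. 1 \<le> norm z \<Longrightarrow> norm (f z) \<le> K * norm z ^ d"
  obtains q where "degree q \<le> d" "\<And>z. f z = poly q z"
proof -
  have "f holomorphic_on UNIV"
    using no_isolated_singularity[OF cont _ open_UNIV Z] hol by (simp add: Compl_eq_Diff_UNIV)
  from Liouville_polynomial[OF this growth]
  have f: "f z = (\<Sum>k\<le>d. (deriv ^^ k) f 0 / fact k * z ^ k)" for z .
  define q where "q = (\<Sum>k\<le>d. monom ((deriv ^^ k) f 0 / fact k) k)"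
  have "f z = poly q z" for z by (subst f) (simp add: q_def poly_sum poly_monom)
  moreover have "degree q \<le> d"
    unfolding q_def by (intro degree_sum_le) (auto intro: order_trans[OF degree_monom_le])
  ultimately show ?thesis using that by blast
qed

text \<open>
  Multiplied with the polynomial \<open>w\<close> that has simple zeros on \<open>Z\<close>, the function becomes a polynomial
  of degree at most that of \<open>w\<close> with the same zeros, hence a multiple of \<open>w\<close>.
\<close>

lemma bounded_off_finite_set_constant:
  fixes f :: "complex \<Rightarrow> complex"
  assumes hol: "f holomorphic_on - Z" and Z: "finite Z" and bound: "\<And>z. z \<notin> Z \<Longrightarrow> norm (f z) \<le> K"
    and "s \<notin> Z" "t \<notin> Z"
  shows "f s = f t"
proof -
  define w where "w z = (\<Prod>\<zeta>\<in>Z. z - \<zeta>)" for z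
  define g where "g z = w z * f z" for z
  have w0: "w z = 0 \<longleftrightarrow> z \<in> Z" for z using Z by (simp add: w_def)
  have contw: "isCont w z" for z unfolding w_def by (intro continuous_intros)
  have cont: "isCont g z" for z
  proof (cases "z \<in> Z")
    case False
    then have "isCont f z"
      using holomorphic_on_imp_continuous_on[OF hol] finite_imp_closed[OF Z]
      by (simp add: continuous_on_eq_continuous_at open_Compl)
    then show ?thesis unfolding g_def using contw by (intro continuous_mult) auto
  next
    case True
    have "((\<lambda>z. norm (w z) * \<bar>K\<bar>) \<longlongrightarrow> 0) (at z)"
      using tendsto_mult_right[OF tendsto_norm[OF contw[unfolded isCont_def]], of "\<bar>K\<bar>" z] True w0[of z] by simp
    moreover have "norm (g z) \<le> norm (w z) * \<bar>K\<bar>" for z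
      using bound[of z] w0[of z] unfolding g_def norm_mult
      by (cases "z \<in> Z") (auto intro!: mult_left_mono)
    ultimately have "(g \<longlongrightarrow> 0) (at z)"
      by (intro Lim_null_comparison[of g]) auto
    then show ?thesis using True w0[of z] by (simp add: isCont_def g_def)
  qed
  obtain L where L: "\<And>z. 1 \<le> norm z \<Longrightarrow> norm (w z) \<le> L * norm z ^ card Z" "L \<ge> 0"
  proof
    show "norm (w z) \<le> (\<Prod>\<zeta>\<in>Z. 1 + norm \<zeta>) * norm z ^ card Z" if "1 \<le> norm z" for z
    proof -
      have "norm (w z) \<le> (\<Prod>\<zeta>\<in>Z. (1 + norm \<zeta>) * norm z)"
        unfolding w_def prod_norm[symmetric]
      proof (intro prod_mono conjI norm_ge_zero)
        fix \<zeta>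
        have "norm (z - \<zeta>) \<le> norm z + norm \<zeta>" by (rule norm_triangle_ineq4)
        also have "norm \<zeta> \<le> norm \<zeta> * norm z" using that by (simp add: mult_le_cancel_left1)
        finally show "norm (z - \<zeta>) \<le> (1 + norm \<zeta>) * norm z" by (simp add: distrib_right)
      qed
      then show ?thesis by (simp add: prod.distrib)
    qed
    show "(\<Prod>\<zeta>\<in>Z. 1 + norm \<zeta>) \<ge> 0" by (intro prod_nonneg) simp
  qed
  have "norm (g z) \<le> (L * \<bar>K\<bar>) * norm z ^ card Z" if "1 \<le> norm z" for z
  proof -
    have "norm (g z) \<le> norm (w z) * \<bar>K\<bar>"
      using bound[of z] w0[of z] unfolding g_def norm_mult
      by (cases "z \<in> Z") (auto intro!: mult_left_mono)
    also have "\<dots> \<le> L * norm z ^ card Z * \<bar>K\<bar>" using L(1)[OF that] by (intro mult_right_mono) auto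
    finally show ?thesis by (simp add: mult_ac)
  qed
  moreover have "g holomorphic_on - Z"
    unfolding g_def w_def by (intro holomorphic_intros hol)
  ultimately obtain q where q: "degree q \<le> card Z" "\<And>z. g z = poly q z"
    using entire_polynomial_growth[of g Z "L * \<bar>K\<bar>" "card Z"] cont Z
    by (auto simp: continuous_on_eq_continuous_at)
  define P where "P = (\<Prod>\<zeta>\<in>Z. [:- \<zeta>, 1:])"
  have P: "poly P z = w z" "degree P = card Z" for z
    by (simp_all add: P_def w_def poly_prod degree_prod_eq_sum_degree)
  define r where "r = q - smult (f s) P"
  have "degree r \<le> card Z"
    unfolding r_def using q(1) P(2) by (intro degree_diff_le) (auto intro: order_trans[OF degree_smult_le])
  moreover have "poly r z = 0" if "z \<in> insert s Z" for z
    using that w0[of z] by (auto simp: r_def P(1) g_def simp flip: q(2))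
  moreover have "card (insert s Z) = Suc (card Z)" using Z assms(4) by simp
  ultimately have "r = 0"
    using Z by (intro poly_zero_if_many_roots[of "insert s Z"]) auto
  then have "poly r t = 0" by simp
  then show ?thesis using w0[of t] assms(5) by (auto simp: r_def P(1) g_def simp flip: q(2))
qed

text \<open>
  A substitute for counting monomials: the number of grid points, \<open>d + 1\<close> in each of \<open>k\<close> directions,
  bounds the dimension of a space of such functions.  One coordinate after the other is released
  from the grid.
\<close>

lemma zero_if_zero_on_grid:
  fixes Q :: "(nat \<Rightarrow> complex) \<Rightarrow> complex"
  assumes poly: "\<And>y j. j < k \<Longrightarrow> \<exists>q. degree q \<le> d \<and> (\<forall>t. Q (y(j := t)) = poly q t)"
    and grid: "\<And>y. (\<forall>j<k. y j \<in> of_nat ` {..d}) \<Longrightarrow> Q y = 0"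
  shows "Q y = 0"
proof -
  have "Q y = 0" if "l \<le> k" "\<forall>j<k. l \<le> j \<longrightarrow> y j \<in> of_nat ` {..d}" for l y
    using that
  proof (induction l arbitrary: y)
    case 0
    then show ?case using grid by simp
  next
    case (Suc l)
    obtain q where q: "degree q \<le> d" "\<And>t. Q (y(l := t)) = poly q t"
      using poly[of l y] Suc.prems(1) by auto
    have "poly q t = 0" if t: "t \<in> of_nat ` {..d}" for t
    proof -
      have "\<forall>j<k. l \<le> j \<longrightarrow> (y(l := t)) j \<in> of_nat ` {..d}"
        using Suc.prems(2) t by (auto simp: le_eq_less_or_eq)
      then have "Q (y(l := t)) = 0" by (rule Suc.IH[rotated]) (use Suc.prems(1) in simp)
      then show ?thesis using q(2) by simp
    qed
    moreover have "card (of_nat ` {..d} :: complex set) = Suc d"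
      by (subst card_image) (auto intro: inj_onI)
    ultimately have "q = 0"
      using q(1) by (intro poly_zero_if_many_roots[of "of_nat ` {..d}"]) auto
    then have "Q (y(l := y l)) = 0" by (simp only: q(2) poly_0)
    then show ?case by simp
  qed
  from this[of k y] show ?thesis by simp
qed

lemma finite_line_zeros:
  assumes "linear_form e x \<noteq> 0 \<or> linear_form e x' \<noteq> 0"
  shows "finite {t. linear_form e (x + t *s x') = 0}"
proof (cases "linear_form e x' = 0")
  case False
  then have "{t. linear_form e (x + t *s x') = 0} \<subseteq> {- linear_form e x / linear_form e x'}"
    by (auto simp: field_simps add_eq_0_iff)
  then show ?thesis by (rule finite_subset) simp
qed (use assms in auto)

text \<open>
  Along a line the radial vectors are given by the vanishing of minors, which are quadratic
  polynomials in the parameter.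
\<close>

lemma finite_or_all_radial:
  fixes x x' v v' :: "complex ^ 'n"
  shows "finite {t. x + t *s x' \<noteq> 0 \<and> (\<exists>u. v + t *s v' = u *s (x + t *s x'))} \<or>
    (\<forall>t. x + t *s x' \<noteq> 0 \<longrightarrow> (\<exists>u. v + t *s v' = u *s (x + t *s x')))"
proof -
  define M where "M i j = [: v $ i * x $ j - v $ j * x $ i,
      v' $ i * x $ j + v $ i * x' $ j - v' $ j * x $ i - v $ j * x' $ i,
      v' $ i * x' $ j - v' $ j * x' $ i :]" for i j
  have M: "poly (M i j) t = (v + t *s v') $ i * (x + t *s x') $ j - (v + t *s v') $ j * (x + t *s x') $ i" for i j t
    by (simp add: M_def algebra_simps)
  show ?thesis
  proof (cases "\<forall>i j. M i j = 0")
    case True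
    have "\<exists>u. v + t *s v' = u *s (x + t *s x')" if t: "x + t *s x' \<noteq> 0" for t
    proof -
      obtain j where j: "(x + t *s x') $ j \<noteq> 0" using t by (metis vec_eq_iff zero_index)
      have "(v + t *s v') $ i * (x + t *s x') $ j = (v + t *s v') $ j * (x + t *s x') $ i" for i
        using M[of i j t] True by simp
      then have "(v + t *s v') $ i = (((v + t *s v') $ j / (x + t *s x') $ j) *s (x + t *s x')) $ i" for i
        using j unfolding vector_smult_component by (metis (no_types) nonzero_eq_divide_eq times_divide_eq_left)
      then have "v + t *s v' = ((v + t *s v') $ j / (x + t *s x') $ j) *s (x + t *s x')"
        unfolding vec_eq_iff by blast
      then show ?thesis by blast
    qed
    then show ?thesis by blast
  next
    case False
    then obtain i j where "M i j \<noteq> 0" by blast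
    then have "finite {t. poly (M i j) t = 0}" by (rule poly_roots_finite)
    moreover have "{t. x + t *s x' \<noteq> 0 \<and> (\<exists>u. v + t *s v' = u *s (x + t *s x'))} \<subseteq> {t. poly (M i j) t = 0}"
    proof clarify
      fix t u assume eq: "v + t *s v' = u *s (x + t *s x')"
      show "poly (M i j) t = 0"
        unfolding M eq vector_smult_component by (simp only: mult_ac diff_self)
    qed
    ultimately show ?thesis using finite_subset by blast
  qed
qed


section \<open>Logarithmic symmetric forms along lines\<close>

context arrangement
begin

text \<open>
  The poles along each hyperplane have order at most \<open>m\<close>, so the \<open>m\<close>-th power of the product of the
  equations clears them.  The number \<open>e\<close> of forms in the product may exceed that of the hyperplanes
  in the divisor, in order to have at least one form.
\<close>

lemma log_symmetric_product_bound:
  assumes S: "log_symmetric m S" and e: "c \<le> e" "0 < e"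
  shows "\<exists>K\<ge>0. \<forall>x v. (\<forall>i<e. linear_form (a i) x \<noteq> 0) \<longrightarrow>
    norm ((\<Prod>i<e. linear_form (a i) x) ^ m * S x v) \<le> K * (norm v * norm x ^ (e - 1)) ^ m"
proof -
  define N where "N = real CARD('n)"
  define L where "L = 1 + (\<Sum>i<e. N * norm (a i))"
  have N: "N \<ge> 0" by (simp add: N_def)
  then have L1: "L \<ge> 1" by (simp add: L_def sum_nonneg)
  have form: "norm (linear_form (a i) x) \<le> L * norm x" if "i < e" for i x
  proof -
    have "norm (linear_form (a i) x) \<le> N * norm (a i) * norm x" unfolding N_def by (rule norm_linear_form_le)
    also have "N * norm (a i) \<le> (\<Sum>i<e. N * norm (a i))"
      using that N by (intro member_le_sum) auto
    then have "N * norm (a i) * norm x \<le> L * norm x" by (intro mult_right_mono) (auto simp: L_def)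
    finally show ?thesis .
  qed
  obtain K where K: "K \<ge> 0" "\<And>x v. x \<noteq> 0 \<Longrightarrow> x \<notin> \<H> \<Longrightarrow> norm (S x v) \<le> K * log_size x v ^ m"
    using log_symmetricD(7)[OF S] by blast
  define M where "M = real (c + 1) * L ^ e"
  have M: "M \<ge> 0" using L1 by (simp add: M_def)
  have "norm ((\<Prod>i<e. linear_form (a i) x) ^ m * S x v) \<le> (K * M ^ m) * (norm v * norm x ^ (e - 1)) ^ m"
    if nz: "\<forall>i<e. linear_form (a i) x \<noteq> 0" for x v
  proof -
    let ?\<Pi> = "\<Prod>i<e. linear_form (a i) x"
    have x: "x \<noteq> 0" "x \<notin> \<H>" using nz e by (auto simp: not_in_\<H>)
    have rest: "norm (\<Prod>j\<in>{..<e} - {i}. linear_form (a j) x) \<le> L ^ (e - 1) * norm x ^ (e - 1)" if "i < e" for i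
    proof -
      have "norm (\<Prod>j\<in>{..<e} - {i}. linear_form (a j) x) \<le> (\<Prod>j\<in>{..<e} - {i}. L * norm x)"
        unfolding prod_norm[symmetric] using form by (intro prod_mono) auto
      then show ?thesis using that by (simp add: power_mult_distrib)
    qed
    have split: "?\<Pi> = linear_form (a i) x * (\<Prod>j\<in>{..<e} - {i}. linear_form (a j) x)" if "i < e" for i
      using that by (simp add: prod.remove)
    have 1: "norm ?\<Pi> * norm (linear_form (a i) v / linear_form (a i) x) \<le> L ^ e * (norm v * norm x ^ (e - 1))"
      if "i < c" for i
    proof -
      have i: "i < e" using that e by simp
      have "norm ?\<Pi> * norm (linear_form (a i) v / linear_form (a i) x) =
        norm (linear_form (a i) v) * norm (\<Prod>j\<in>{..<e} - {i}. linear_form (a j) x)"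
        using nz i by (simp add: split[OF i] norm_mult norm_divide)
      also have "\<dots> \<le> (L * norm v) * (L ^ (e - 1) * norm x ^ (e - 1))"
        using form[OF i, of v] rest[OF i] L1 by (intro mult_mono) auto
      also have "\<dots> = L ^ e * (norm v * norm x ^ (e - 1))"
        using e(2) by (simp add: power_eq_if[of L e] mult_ac)
      finally show ?thesis .
    qed
    have 2: "norm ?\<Pi> * (norm v / norm x) \<le> L ^ e * (norm v * norm x ^ (e - 1))"
    proof -
      have "norm ?\<Pi> * (norm v / norm x) =
          norm (linear_form (a 0) x) / norm x * norm v * norm (\<Prod>j\<in>{..<e} - {0}. linear_form (a j) x)"
        by (simp add: split[OF e(2)] norm_mult)
      also have "\<dots> \<le> L * norm v * (L ^ (e - 1) * norm x ^ (e - 1))"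
        using form[OF e(2), of x] rest[OF e(2)] L1 x(1) by (intro mult_mono) (auto simp: divide_simps)
      also have "\<dots> = L ^ e * (norm v * norm x ^ (e - 1))"
        using e(2) by (simp add: power_eq_if[of L e] mult_ac)
      finally show ?thesis .
    qed
    have "norm ?\<Pi> * log_size x v = (\<Sum>i<c. norm ?\<Pi> * norm (linear_form (a i) v / linear_form (a i) x)) +
        norm ?\<Pi> * (norm v / norm x)"
      by (simp add: log_size_def distrib_left sum_distrib_left)
    also have "\<dots> \<le> (\<Sum>i<c. L ^ e * (norm v * norm x ^ (e - 1))) + L ^ e * (norm v * norm x ^ (e - 1))"
      by (intro add_mono sum_mono 1 2) simp
    also have "\<dots> = M * (norm v * norm x ^ (e - 1))" by (simp add: M_def algebra_simps)
    finally have *: "norm ?\<Pi> * log_size x v \<le> M * (norm v * norm x ^ (e - 1))" .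
    have "norm (?\<Pi> ^ m * S x v) \<le> norm ?\<Pi> ^ m * (K * log_size x v ^ m)"
      unfolding norm_mult norm_power using K(2)[OF x] by (intro mult_left_mono) auto
    also have "\<dots> = K * (norm ?\<Pi> * log_size x v) ^ m" by (simp add: power_mult_distrib)
    also have "\<dots> \<le> K * (M * (norm v * norm x ^ (e - 1))) ^ m"
      using * K(1) by (intro mult_left_mono power_mono mult_nonneg_nonneg) auto
    finally show ?thesis by (simp add: power_mult_distrib mult.assoc)
  qed
  then show ?thesis using K(1) M by (intro exI[of _ "K * M ^ m"]) auto
qed

lemma log_size_minus_radial_bound:
  assumes "log_symmetric m S"
  shows "\<exists>K\<ge>0. \<forall>x v u. x \<noteq> 0 \<and> x \<notin> \<H> \<longrightarrow> norm (S x v) \<le> K * log_size x (v - u *s x) ^ m"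
proof -
  have "S x (v - u *s x) = S x v" for x v u
    using log_symmetricD(3)[OF assms, of x "v - u *s x" u] by simp
  then show ?thesis using log_symmetricD(7)[OF assms] by metis
qed

text \<open>
  By Liouville's theorem; the exponent \<open>m + 1\<close> instead of \<open>m\<close> makes the product vanish on the
  hyperplanes, so that it is continuous whatever the values of \<open>S\<close> are there.
\<close>

lemma log_symmetric_line_polynomial:
  assumes S: "log_symmetric m S" and m: "m > 0" and e: "c \<le> e" "0 < e"
  shows "\<exists>q. degree q \<le> e * (m + 1) \<and>
    (\<forall>t. (\<Prod>i<e. linear_form (a i) (x + t *s x')) ^ (m + 1) * S (x + t *s x') (v + t *s v') = poly q t)"
proof -
  define X where "X t = x + t *s x'" for t
  define V where "V t = v + t *s v'" for t
  define w where "w t = (\<Prod>i<e. linear_form (a i) (X t))" for t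
  define g where "g t = w t ^ (m + 1) * S (X t) (V t)" for t
  have contX: "isCont X t" "isCont V t" for t
    unfolding X_def V_def isCont_def by (intro tendsto_intros)+
  have contw: "isCont w t" for t
    unfolding w_def by (intro continuous_intros contX)
  have w0: "w t \<noteq> 0 \<longleftrightarrow> (\<forall>i<e. linear_form (a i) (X t) \<noteq> 0)" for t by (auto simp: w_def)
  have wH: "X t \<noteq> 0" "X t \<notin> \<H>" if "w t \<noteq> 0" for t
    using that e unfolding w0 by (auto simp: not_in_\<H>)
  have goal: ?thesis if "\<And>t. g t = 0"
    using that by (intro exI[of _ 0]) (simp add: g_def w_def X_def V_def)
  show ?thesis
  proof (cases "(\<forall>t. w t = 0) \<or> (\<forall>t. X t \<noteq> 0 \<longrightarrow> (\<exists>u. V t = u *s X t))")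
    case True
    then have "g t = 0" for t
      using log_symmetricD(1,2)[OF S] by (cases "X t = 0") (auto simp: g_def)
    then show ?thesis by (rule goal)
  next
    case False
    then obtain t0 where t0: "w t0 \<noteq> 0" by blast
    define R where "R = {t. X t \<noteq> 0 \<and> (\<exists>u. V t = u *s X t)}"
    have finR: "finite R"
      using finite_or_all_radial[of x x' v v'] False by (auto simp: R_def X_def V_def)
    have "finite {t. linear_form (a i) (x + t *s x') = 0}" if "i < e" for i
    proof (rule finite_line_zeros)
      have "linear_form (a i) (X t0) \<noteq> 0" using t0 that by (auto simp: w0)
      then show "linear_form (a i) x \<noteq> 0 \<or> linear_form (a i) x' \<noteq> 0" by (auto simp: X_def)
    qed
    then have "finite (\<Union>i\<in>{..<e}. {t. linear_form (a i) (x + t *s x') = 0})" by simp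
    moreover have "{t. w t = 0} = (\<Union>i\<in>{..<e}. {t. linear_form (a i) (x + t *s x') = 0})"
      by (auto simp: w_def X_def)
    ultimately have finw: "finite {t. w t = 0}" by simp
    obtain K where K: "K \<ge> 0" "\<And>x v. (\<forall>i<e. linear_form (a i) x \<noteq> 0) \<Longrightarrow>
        norm ((\<Prod>i<e. linear_form (a i) x) ^ m * S x v) \<le> K * (norm v * norm x ^ (e - 1)) ^ m"
      using log_symmetric_product_bound[OF S e] by blast
    have bound: "norm (g t) \<le> norm (w t) * (K * (norm (V t) * norm (X t) ^ (e - 1)) ^ m)" for t
    proof (cases "w t = 0")
      case False
      have "norm (g t) = norm (w t) * norm (w t ^ m * S (X t) (V t))"
        by (simp add: g_def norm_mult)
      also have "\<dots> \<le> norm (w t) * (K * (norm (V t) * norm (X t) ^ (e - 1)) ^ m)"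
        using K(2)[of "X t" "V t"] False by (intro mult_left_mono) (auto simp: w0 w_def)
      finally show ?thesis .
    qed (simp add: g_def)
    have an: "g analytic_on {t}" if t: "w t \<noteq> 0" "t \<notin> R" for t
    proof -
      have "(\<lambda>t. S (X t) (V t)) analytic_on {t}"
        unfolding X_def V_def using wH[OF t(1)] t(2)
        by (intro log_symmetricD(6)[OF S]) (auto simp: R_def X_def V_def)
      moreover have "w analytic_on {t}"
        unfolding w_def X_def by (intro analytic_on_prod) (auto simp: analytic_on_add analytic_on_mult)
      ultimately show ?thesis unfolding g_def by (intro analytic_on_mult analytic_on_power)
    qed
    have cont: "isCont g t" for t
    proof -
      consider "w t = 0" | "w t \<noteq> 0" "t \<in> R" | "w t \<noteq> 0" "t \<notin> R" by blast
      then show ?thesis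
      proof cases
        case 1
        have "isCont (\<lambda>t. norm (w t) * (K * (norm (V t) * norm (X t) ^ (e - 1)) ^ m)) t"
          by (intro continuous_intros contw contX)
        then have "((\<lambda>t. norm (w t) * (K * (norm (V t) * norm (X t) ^ (e - 1)) ^ m)) \<longlongrightarrow> 0) (at t)"
          using 1 by (simp add: isCont_def)
        then have "(g \<longlongrightarrow> 0) (at t)"
          by (rule Lim_null_comparison[rotated]) (use bound in auto)
        then show ?thesis using 1 by (simp add: isCont_def g_def)
      next
        case 2
        then obtain u where u: "V t = u *s X t" by (auto simp: R_def)
        \<comment> \<open>at an isolated radial vector subtracting its radial part shows that the limit is zero\<close>
        obtain L where L: "L \<ge> 0" "\<And>x v u. x \<noteq> 0 \<Longrightarrow> x \<notin> \<H> \<Longrightarrow> norm (S x v) \<le> L * log_size x (v - u *s x) ^ m"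
          using log_size_minus_radial_bound[OF S] by blast
        let ?h = "\<lambda>s. norm (w s) ^ (m + 1) * (L * log_size (X s) (V s - u *s X s) ^ m)"
        have "isCont ?h t"
          unfolding log_size_def norm_divide using wH[OF 2(1)] c_le e
          by (intro continuous_intros contw contX)
            (auto simp: not_in_\<H> isCont_def intro!: tendsto_intros contX[unfolded isCont_def])
        then have "(?h \<longlongrightarrow> ?h t) (at t)" unfolding isCont_def .
        moreover have "?h t = 0" using m by (simp add: u log_size_def zero_power)
        ultimately have "(?h \<longlongrightarrow> 0) (at t)" by (simp only:)
        moreover have "norm (g s) \<le> ?h s" for s
        proof (cases "w s = 0")
          case False
          then show ?thesis
            unfolding g_def norm_mult norm_power using L(2)[OF wH[OF False], of "V s" u] by (intro mult_left_mono) auto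
        qed (simp add: g_def)
        ultimately have "(g \<longlongrightarrow> 0) (at t)"
          by (intro Lim_null_comparison[of g ?h]) auto
        moreover have "g t = 0" using log_symmetricD(1)[OF S] by (simp add: g_def u)
        ultimately show ?thesis by (simp add: isCont_def)
      next
        case 3
        then show ?thesis
          using analytic_on_imp_differentiable_at[OF an] field_differentiable_imp_continuous_at by blast
      qed
    qed
    define A where "A = norm x + norm x' + norm v + norm v'"
    define L where "L = (\<Prod>i<e. real CARD('n) * norm (a i) * A)"
    have A: "A \<ge> 0" by (simp add: A_def)
    have growth: "norm (g t) \<le> (L * (K * (A * A ^ (e - 1)) ^ m)) * norm t ^ (e * (m + 1))" if t: "1 \<le> norm t" for t
    proof -
      have lin: "norm y + norm t * norm y' \<le> (norm y + norm y') * norm t" for y y' :: "complex ^ 'n"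
        using mult_right_mono[OF t norm_ge_zero[of y]] by (simp add: algebra_simps)
      have "norm (y + t *s y') \<le> (norm y + norm y') * norm t" for y y' :: "complex ^ 'n"
        using norm_triangle_ineq[of y "t *s y'"] lin[of y y'] by simp
      then have XV: "norm (X t) \<le> A * norm t" "norm (V t) \<le> A * norm t"
        unfolding X_def V_def by (rule order_trans, intro mult_right_mono; simp add: A_def)+
      have "norm (w t) \<le> (\<Prod>i<e. real CARD('n) * norm (a i) * (A * norm t))"
        unfolding w_def prod_norm[symmetric]
        by (intro prod_mono conjI norm_ge_zero order_trans[OF norm_linear_form_le] mult_left_mono XV) auto
      also have "\<dots> = L * norm t ^ e"
        by (simp add: L_def prod.distrib power_mult_distrib mult_ac)
      finally have w: "norm (w t) \<le> L * norm t ^ e" .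
      have "norm (V t) * norm (X t) ^ (e - 1) \<le> (A * norm t) * (A * norm t) ^ (e - 1)"
        using XV A by (intro mult_mono power_mono) auto
      also have "\<dots> = A * A ^ (e - 1) * norm t ^ e"
        using e(2) by (simp add: power_mult_distrib power_eq_if[of "norm t" e] mult_ac)
      finally have VX: "norm (V t) * norm (X t) ^ (e - 1) \<le> A * A ^ (e - 1) * norm t ^ e" .
      have "K * (norm (V t) * norm (X t) ^ (e - 1)) ^ m \<le> K * (A * A ^ (e - 1) * norm t ^ e) ^ m"
        using K(1) by (intro mult_left_mono power_mono VX) auto
      then have "norm (g t) \<le> (L * norm t ^ e) * (K * (A * A ^ (e - 1) * norm t ^ e) ^ m)"
        using K(1) order_trans[OF norm_ge_zero w] by (intro order_trans[OF bound] mult_mono[OF w]) auto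
      also have "\<dots> = (L * (K * (A * A ^ (e - 1)) ^ m)) * norm t ^ (e * (m + 1))"
        by (simp add: power_mult_distrib power_add power_mult algebra_simps)
      finally show ?thesis .
    qed
    have "g holomorphic_on - (R \<union> {t. w t = 0})"
      using an by (intro analytic_imp_holomorphic, subst analytic_on_analytic_at) blast
    then obtain q where "degree q \<le> e * (m + 1)" "\<And>t. g t = poly q t"
      using entire_polynomial_growth[OF _ _ _ growth, of "R \<union> {t. w t = 0}"] cont finR finw
      by (auto simp: continuous_on_eq_continuous_at)
    then show ?thesis unfolding g_def w_def X_def V_def by blast
  qed
qed

text \<open>
  Where the logarithmic derivatives of all forms are constant along the line there are no poles at
  all, and the function is constant.
\<close>

lemma log_symmetric_line_constant:
  assumes S: "log_symmetric m S" and e: "c \<le> e" "CARD('n) \<le> e" "e \<le> C"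
    and x: "\<forall>i<e. linear_form (a i) x \<noteq> 0" and y: "\<forall>i<e. linear_form (a i) y \<noteq> 0"
    and nrx: "\<And>u. v \<noteq> u *s x" and nry: "\<And>u. w \<noteq> u *s y"
    and \<mu>: "\<forall>i<e. linear_form (a i) v = \<mu> i * linear_form (a i) x" "\<forall>i<e. linear_form (a i) w = \<mu> i * linear_form (a i) y"
  shows "S x v = S y w"
proof -
  define X where "X t = x + t *s (y - x)" for t
  define V where "V t = v + t *s (w - v)" for t
  have e0: "0 < e" using e(2) zero_less_card_finite[where 'a='n] by linarith
  have ends: "X 0 = x" "V 0 = v" "X 1 = y" "V 1 = w" by (simp_all add: X_def V_def)
  define Z where "Z = {t. \<exists>i<e. linear_form (a i) (X t) = 0}"
  have "Z = (\<Union>i\<in>{..<e}. {t. linear_form (a i) (x + t *s (y - x)) = 0})" by (auto simp: Z_def X_def)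
  also have "finite \<dots>" using x by (intro finite_UN_I finite_line_zeros) auto
  finally have finZ: "finite Z" .
  have offZ: "X t \<noteq> 0" "X t \<notin> \<H>" if "t \<notin> Z" for t
    using that e e0 by (auto simp: Z_def not_in_\<H>)
  have offZ0: "X t \<noteq> 0" if "t \<notin> Z" for t using offZ(1)[OF that] .
  define R where "R = {t. X t \<noteq> 0 \<and> (\<exists>u. V t = u *s X t)}"
  have finR: "finite R"
    using finite_or_all_radial[of x "y - x" v "w - v"]
  proof
    assume "\<forall>t. x + t *s (y - x) \<noteq> 0 \<longrightarrow> (\<exists>u. v + t *s (w - v) = u *s (x + t *s (y - x)))"
    from spec[OF this, of 0] have "x = 0" using nrx by auto
    then show ?thesis using x e0 by auto
  qed (simp add: R_def X_def V_def)
  have \<mu>t: "linear_form (a i) (V t) = \<mu> i * linear_form (a i) (X t)" if "i < e" for i t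
    using \<mu> that by (simp add: X_def V_def algebra_simps)
  \<comment> \<open>the size of \<open>V\<close> is controlled by that of \<open>X\<close>, because \<open>CARD('n)\<close> of the forms are coordinates\<close>
  obtain K0 where K0: "K0 \<subseteq> {..<e}" "card K0 = CARD('n)"
    using e(2) by (metis card_lessThan obtain_subset_with_card_n)
  have K0C: "K0 \<subseteq> {..<C}" using K0(1) e(3) by auto
  obtain d where d: "\<And>z. z = (\<Sum>i\<in>K0. linear_form (a i) z *s d i)"
    using dual_vectors[OF K0C K0(2)] by blast
  define M where "M = (\<Sum>i\<in>K0. norm (\<mu> i) * (real CARD('n) * norm (a i)) * norm (d i))"
  have VX: "norm (V t) \<le> M * norm (X t)" for t
  proof -
    have "norm (V t) = norm (\<Sum>i\<in>K0. linear_form (a i) (V t) *s d i)" using d[of "V t"] by simp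
    also have "\<dots> \<le> (\<Sum>i\<in>K0. norm (linear_form (a i) (V t) *s d i))" by (rule norm_sum)
    also have "\<dots> \<le> (\<Sum>i\<in>K0. norm (\<mu> i) * (real CARD('n) * norm (a i)) * norm (d i) * norm (X t))"
    proof (rule sum_mono)
      fix i assume "i \<in> K0"
      then have "norm (linear_form (a i) (V t) *s d i) = norm (\<mu> i) * norm (linear_form (a i) (X t)) * norm (d i)"
        using \<mu>t K0(1) by (auto simp: norm_mult)
      also have "\<dots> \<le> norm (\<mu> i) * (real CARD('n) * norm (a i) * norm (X t)) * norm (d i)"
        by (intro mult_right_mono mult_left_mono norm_linear_form_le) auto
      finally show "norm (linear_form (a i) (V t) *s d i) \<le>
          norm (\<mu> i) * (real CARD('n) * norm (a i)) * norm (d i) * norm (X t)"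
        by (simp add: mult_ac)
    qed
    finally show ?thesis by (simp add: M_def sum_distrib_right)
  qed
  have "log_size (X t) (V t) \<le> (\<Sum>i<c. norm (\<mu> i)) + M" if t: "t \<notin> Z" for t
  proof -
    have "(\<Sum>i<c. norm (linear_form (a i) (V t) / linear_form (a i) (X t))) = (\<Sum>i<c. norm (\<mu> i))"
      using e(1) t \<mu>t by (intro sum.cong) (auto simp: Z_def)
    moreover have "norm (V t) / norm (X t) \<le> M"
      using VX[of t] offZ0[OF t] by (simp add: divide_simps)
    ultimately show ?thesis by (simp add: log_size_def)
  qed
  moreover obtain K where K: "K \<ge> 0" "\<And>x v. x \<noteq> 0 \<Longrightarrow> x \<notin> \<H> \<Longrightarrow> norm (S x v) \<le> K * log_size x v ^ m"
    using log_symmetricD(7)[OF S] by blast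
  ultimately have bound: "norm (S (X t) (V t)) \<le> K * ((\<Sum>i<c. norm (\<mu> i)) + M) ^ m" if "t \<notin> Z" for t
    using that by (intro order_trans[OF K(2)[OF offZ[OF that]]] mult_left_mono power_mono) auto
  have "(\<lambda>t. S (X t) (V t)) analytic_on {t}" if t: "t \<notin> Z \<union> R" for t
    unfolding X_def V_def
    by (rule log_symmetricD(6)[OF S]) (use t offZ[of t] in \<open>auto simp: R_def X_def V_def\<close>)
  then have hol: "(\<lambda>t. S (X t) (V t)) holomorphic_on - (Z \<union> R)"
    by (intro analytic_imp_holomorphic, subst analytic_on_analytic_at) blast
  have "0 \<notin> Z \<union> R" "1 \<notin> Z \<union> R" using x y nrx nry by (auto simp: Z_def R_def ends)
  with bounded_off_finite_set_constant[OF hol _ bound, of 0 1] finZ finR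
  have "S (X 0) (V 0) = S (X 1) (V 1)" by auto
  then show ?thesis by (simp add: ends)
qed

end

section \<open>Solving for the point from its logarithmic derivatives\<close>

text \<open>
  The solution is normalised for the sake of the compactness argument below.
\<close>

lemma pair_system:
  fixes a :: "nat \<Rightarrow> complex ^ 'n"
  assumes "M < 2 * CARD('n)"
  shows "\<exists>x v. norm (x, v) = 1 \<and> (\<forall>i<M. \<alpha> i * linear_form (a i) v = \<beta> i * linear_form (a i) x)"
proof -
  define f where "f = (\<lambda>(k, t) i. if t then \<alpha> i * a i $ k else - (\<beta> i * a i $ k))"
  let ?B = "UNIV :: ('n \<times> bool) set"
  have "card ?B = 2 * CARD('n)" by (simp flip: UNIV_Times_UNIV add: card_cartesian_product)
  then obtain u where u: "\<exists>b\<in>?B. u b \<noteq> 0" "\<forall>i\<in>{..<M}. (\<Sum>b\<in>?B. u b * f b i) = 0"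
    using homogeneous_system[of "{..<M}" ?B f] assms by auto
  define x where "x = (\<chi> k. u (k, False))"
  define v where "v = (\<chi> k. u (k, True))"
  have "(x, v) \<noteq> 0"
  proof
    assume "(x, v) = 0"
    then have "x $ k = 0" "v $ k = 0" for k by (simp_all add: zero_prod_def)
    then have "u (k, t) = 0" for k t by (cases t) (simp_all add: x_def v_def)
    then show False using u(1) by auto
  qed
  define r where "r = complex_of_real (inverse (norm (x, v)))"
  have r: "norm r * norm (x, v) = 1" "r \<noteq> 0" using \<open>(x, v) \<noteq> 0\<close> by (simp_all add: r_def norm_inverse)
  have "norm (r *s x, r *s v) = norm r * norm (x, v)"
    by (simp add: norm_Pair power_mult_distrib real_sqrt_mult flip: distrib_left)
  then have "norm (r *s x, r *s v) = 1" using r by simp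
  moreover have "\<alpha> i * linear_form (a i) (r *s v) = \<beta> i * linear_form (a i) (r *s x)" if "i < M" for i
  proof -
    have "(\<Sum>b\<in>?B. u b * f b i) = (\<Sum>k\<in>UNIV. \<Sum>t\<in>UNIV. u (k, t) * f (k, t) i)"
      by (simp flip: UNIV_Times_UNIV add: sum.cartesian_product split_def)
    also have "\<dots> = \<alpha> i * linear_form (a i) v - \<beta> i * linear_form (a i) x"
      by (simp add: UNIV_bool f_def linear_form_def x_def v_def sum.distrib sum_subtractf sum_distrib_left mult_ac
          flip: diff_conv_add_uminus)
    finally show ?thesis using u(2) that by simp
  qed
  ultimately show ?thesis by blast
qed

context arrangement
begin

text \<open>
  Prescribing the logarithmic derivatives of \<open>2n + 1\<close> forms amounts to \<open>2n + 1\<close> linear equations in the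
  \<open>2n + 2\<close> coordinates of \<open>(x, v)\<close>, so there is a nonzero solution; the point is that \<open>x\<close> avoids the
  hyperplanes for an open set of prescriptions.  The last derivative is given by its inverse \<open>\<tau>\<close>, which
  may vanish.  The open set is found near the degenerate prescription where \<open>n\<close> of the derivatives are
  infinite: then \<open>x\<close> is forced to be the intersection point of \<open>n\<close> of the hyperplanes, the solution is
  unique up to scaling, and the nearby solutions converge to it by compactness.
\<close>

lemma open_set_of_log_derivatives:
  assumes n: "CARD('n) = n + 1" "n > 0" and C: "2 * n + 1 \<le> C"
  shows "\<exists>\<mu>0 \<delta>. \<delta> > 0 \<and> (\<forall>\<mu> \<tau>. (\<forall>i<2 * n. norm (\<mu> i - \<mu>0 i) < \<delta>) \<and> norm \<tau> < \<delta> \<longrightarrow>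
    (\<exists>x v. (\<forall>i<2 * n. linear_form (a i) v = \<mu> i * linear_form (a i) x) \<and>
       \<tau> * linear_form (a (2 * n)) v = linear_form (a (2 * n)) x \<and>
       (\<forall>i<C. i \<noteq> 2 * n \<longrightarrow> linear_form (a i) x \<noteq> 0) \<and> linear_form (a (2 * n)) v \<noteq> 0))"
proof (rule ccontr)
  assume neg: "\<not> ?thesis"
  \<comment> \<open>the forms whose logarithmic derivatives become infinite\<close>
  define J where "J = {n<..2 * n}"
  have J: "J \<subseteq> {..<C}" "card J = n" "finite J" using C by (auto simp: J_def)
  have K: "insert i J \<subseteq> {..<C}" "card (insert i J) = CARD('n)" if "i < C" "i \<notin> J" for i
    using that J n by auto
  have "0 \<notin> J" "0 < C" using C by (auto simp: J_def)
  then obtain e where e: "\<And>i j. i \<in> insert 0 J \<Longrightarrow> j \<in> insert 0 J \<Longrightarrow> linear_form (a i) (e j) = (if i = j then 1 else 0)"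
    using dual_vectors[OF K[of 0]] by blast
  \<comment> \<open>the solution of the degenerate system\<close>
  define x\<^sub>0 where "x\<^sub>0 = e 0"
  define v\<^sub>0 where "v\<^sub>0 = (\<Sum>j\<in>J. e j)"
  have x0: "linear_form (a 0) x\<^sub>0 = 1"
    using e[of 0 0] by (simp add: x\<^sub>0_def)
  have x0J: "linear_form (a j) x\<^sub>0 = 0" if "j \<in> J" for j
    using e[of j 0] that \<open>0 \<notin> J\<close> by (cases "j = 0") (simp_all add: x\<^sub>0_def)
  have x0': "linear_form (a i) x\<^sub>0 \<noteq> 0" if "i < C" "i \<notin> J" for i
  proof
    assume "linear_form (a i) x\<^sub>0 = 0"
    then have "x\<^sub>0 = 0" using common_zero_eq_0[OF K[OF that]] x0J by auto
    then show False using x0 by simp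
  qed
  have v0: "linear_form (a j) v\<^sub>0 = 1" if "j \<in> J" for j
    using that J(3) e by (simp add: v\<^sub>0_def linear_form_sum_right)
  define \<beta> where "\<beta> i = linear_form (a i) v\<^sub>0 / linear_form (a i) x\<^sub>0" for i
  define \<mu>0 where "\<mu>0 k i = (if i \<le> n then \<beta> i else of_nat (k + 2))" for k i :: nat
  define good where "good x v \<longleftrightarrow> (\<forall>i<C. i \<noteq> 2 * n \<longrightarrow> linear_form (a i) x \<noteq> 0) \<and> linear_form (a (2 * n)) v \<noteq> 0" for x v
  have "\<exists>\<mu> \<tau>. (\<forall>i<2 * n. norm (\<mu> i - \<mu>0 k i) < inverse (Suc k)) \<and> norm \<tau> < inverse (Suc k) \<and>
      (\<nexists>x v. (\<forall>i<2 * n. linear_form (a i) v = \<mu> i * linear_form (a i) x) \<and>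
       \<tau> * linear_form (a (2 * n)) v = linear_form (a (2 * n)) x \<and> good x v)" for k
  proof -
    have "inverse (real (Suc k)) > 0" by simp
    then show ?thesis using neg unfolding good_def by blast
  qed
  then obtain \<mu> \<tau> where \<mu>\<tau>: "\<And>k i. i < 2 * n \<Longrightarrow> norm (\<mu> k i - \<mu>0 k i) < inverse (Suc k)"
    "\<And>k. norm (\<tau> k) < inverse (Suc k)"
    and bad: "\<And>k x v. (\<forall>i<2 * n. linear_form (a i) v = \<mu> k i * linear_form (a i) x) \<Longrightarrow>
       \<tau> k * linear_form (a (2 * n)) v = linear_form (a (2 * n)) x \<Longrightarrow> \<not> good x v"
    by metis
  have "\<exists>x v. norm (x, v) = 1 \<and> (\<forall>i<2 * n. linear_form (a i) v = \<mu> k i * linear_form (a i) x) \<and>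
      \<tau> k * linear_form (a (2 * n)) v = linear_form (a (2 * n)) x" for k
  proof -
    obtain x v where xv: "norm (x, v) = 1" "\<forall>i<2 * n + 1. (if i = 2 * n then \<tau> k else 1) * linear_form (a i) v =
        (if i = 2 * n then 1 else \<mu> k i) * linear_form (a i) x"
      using pair_system[of "2 * n + 1" "\<lambda>i. if i = 2 * n then \<tau> k else 1" a "\<lambda>i. if i = 2 * n then 1 else \<mu> k i"] n
      by auto
    have "linear_form (a i) v = \<mu> k i * linear_form (a i) x" if "i < 2 * n" for i
      using xv(2)[rule_format, of i] that by simp
    moreover have "\<tau> k * linear_form (a (2 * n)) v = linear_form (a (2 * n)) x"
      using xv(2)[rule_format, of "2 * n"] by simp
    ultimately show ?thesis using xv(1) by blast
  qed
  then obtain X V where XV: "\<And>k. norm (X k, V k) = 1"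
    "\<And>k i. i < 2 * n \<Longrightarrow> linear_form (a i) (V k) = \<mu> k i * linear_form (a i) (X k)"
    "\<And>k. \<tau> k * linear_form (a (2 * n)) (V k) = linear_form (a (2 * n)) (X k)"
    by metis
  have "\<exists>z\<in>sphere 0 1. \<exists>r. strict_mono r \<and> ((\<lambda>k. (X k, V k)) \<circ> r) \<longlonglongrightarrow> z"
    by (rule compact_sphere[unfolded compact_def, rule_format]) (simp add: XV(1))
  then obtain z r where r: "z \<in> sphere 0 1" "strict_mono r" "((\<lambda>k. (X k, V k)) \<circ> r) \<longlonglongrightarrow> z"
    by blast
  obtain x v where z: "z = (x, v)" by (cases z)
  have lim: "(\<lambda>k. X (r k)) \<longlonglongrightarrow> x" "(\<lambda>k. V (r k)) \<longlonglongrightarrow> v"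
    using tendsto_fst[OF r(3)] tendsto_snd[OF r(3)] by (simp_all add: z comp_def)
  have inv0: "(\<lambda>k. inverse (real (Suc (r k)))) \<longlonglongrightarrow> 0"
    using LIMSEQ_subseq_LIMSEQ[OF LIMSEQ_inverse_real_of_nat r(2)] by (simp add: comp_def)
  have \<tau>0: "(\<lambda>k. \<tau> (r k)) \<longlonglongrightarrow> 0"
    by (rule Lim_null_comparison[OF _ inv0]) (use \<mu>\<tau>(2) in \<open>auto intro!: always_eventually less_imp_le\<close>)
  have \<mu>\<beta>: "(\<lambda>k. \<mu> (r k) i) \<longlonglongrightarrow> \<beta> i" if "i \<le> n" for i
  proof -
    have "norm (\<mu> k i - \<beta> i) < inverse (Suc k)" for k
      using \<mu>\<tau>(1)[of i k] that n by (simp add: \<mu>0_def)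
    then have "(\<lambda>k. \<mu> (r k) i - \<beta> i) \<longlonglongrightarrow> 0"
      by (intro Lim_null_comparison[OF _ inv0]) (auto intro!: always_eventually less_imp_le)
    then show ?thesis by (rule LIM_zero_cancel)
  qed
  have \<mu>big: "norm (\<mu> k i) > real (Suc k)" if i: "n < i" "i < 2 * n" for i k
  proof -
    have "norm (\<mu> k i - of_nat (k + 2)) < inverse (Suc k)" using \<mu>\<tau>(1)[OF i(2)] i by (simp add: \<mu>0_def)
    also have "inverse (real (Suc k)) \<le> 1" by (simp add: field_simps)
    finally have "norm (\<mu> k i - of_nat (k + 2)) < 1" .
    then show ?thesis using norm_triangle_ineq2[of "of_nat (k + 2)" "of_nat (k + 2) - \<mu> k i"]
      by (simp add: norm_minus_commute norm_of_nat del: of_nat_add of_nat_Suc)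
  qed
  have \<mu>0: "(\<lambda>k. inverse (\<mu> (r k) i)) \<longlonglongrightarrow> 0" if i: "n < i" "i < 2 * n" for i
  proof (rule Lim_null_comparison[OF _ inv0])
    show "eventually (\<lambda>k. norm (inverse (\<mu> (r k) i)) \<le> inverse (real (Suc (r k)))) sequentially"
    proof (intro always_eventually allI)
      fix k
      have "real (Suc (r k)) \<le> norm (\<mu> (r k) i)" using \<mu>big[OF i, of "r k"] by simp
      then show "norm (inverse (\<mu> (r k) i)) \<le> inverse (real (Suc (r k)))"
        unfolding norm_inverse by (intro le_imp_inverse_le) auto
    qed
  qed
  have xJ: "linear_form (a j) x = 0" if j: "j \<in> J" for j
  proof (cases "j = 2 * n")
    case True
    have "(\<lambda>k. \<tau> (r k) * linear_form (a j) (V (r k))) \<longlonglongrightarrow> 0 * linear_form (a j) v"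
      by (intro tendsto_intros \<tau>0 lim)
    then have "(\<lambda>k. linear_form (a j) (X (r k))) \<longlonglongrightarrow> 0" using XV(3) True by simp
    moreover have "(\<lambda>k. linear_form (a j) (X (r k))) \<longlonglongrightarrow> linear_form (a j) x" by (intro tendsto_intros lim)
    ultimately show ?thesis using LIMSEQ_unique by blast
  next
    case False
    then have i: "n < j" "j < 2 * n" using j by (auto simp: J_def)
    have "\<mu> k j \<noteq> 0" for k using \<mu>big[OF i, of k] by auto
    then have "linear_form (a j) (X (r k)) = inverse (\<mu> (r k) j) * linear_form (a j) (V (r k))" for k
      using XV(2)[OF i(2), of "r k"] by simp
    moreover have "(\<lambda>k. inverse (\<mu> (r k) j) * linear_form (a j) (V (r k))) \<longlonglongrightarrow> 0 * linear_form (a j) v"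
      by (intro tendsto_intros \<mu>0[OF i] lim)
    ultimately have "(\<lambda>k. linear_form (a j) (X (r k))) \<longlonglongrightarrow> 0" by simp
    moreover have "(\<lambda>k. linear_form (a j) (X (r k))) \<longlonglongrightarrow> linear_form (a j) x" by (intro tendsto_intros lim)
    ultimately show ?thesis using LIMSEQ_unique by blast
  qed
  have vI: "linear_form (a i) v = \<beta> i * linear_form (a i) x" if "i \<le> n" for i
  proof -
    have "(\<lambda>k. \<mu> (r k) i * linear_form (a i) (X (r k))) \<longlonglongrightarrow> \<beta> i * linear_form (a i) x"
      by (intro tendsto_intros \<mu>\<beta>[OF that] lim)
    then have "(\<lambda>k. linear_form (a i) (V (r k))) \<longlonglongrightarrow> \<beta> i * linear_form (a i) x"
      using XV(2)[of i] that n by simp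
    moreover have "(\<lambda>k. linear_form (a i) (V (r k))) \<longlonglongrightarrow> linear_form (a i) v" by (intro tendsto_intros lim)
    ultimately show ?thesis using LIMSEQ_unique by blast
  qed
  define l where "l = linear_form (a 0) x"
  have "x - l *s x\<^sub>0 = 0"
    using \<open>0 < C\<close> \<open>0 \<notin> J\<close> xJ x0 x0J by (intro common_zero_eq_0[OF K[of 0]]) (auto simp: l_def)
  then have x: "x = l *s x\<^sub>0" by simp
  have "v - l *s v\<^sub>0 = 0"
  proof (rule common_zero_eq_0[of "{..n}"])
    fix i assume i: "i \<in> {..n}"
    then have "linear_form (a i) x\<^sub>0 \<noteq> 0" using C by (intro x0') (auto simp: J_def)
    then show "linear_form (a i) (v - l *s v\<^sub>0) = 0" using vI[of i] i x by (simp add: \<beta>_def)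
  qed (use n C in auto)
  then have v: "v = l *s v\<^sub>0" by simp
  have l: "l \<noteq> 0"
  proof
    assume "l = 0"
    then have "z = 0" using z x v by (simp add: zero_prod_def)
    then show False using r(1) by simp
  qed
  have ev1: "eventually (\<lambda>k. linear_form (a i) (X (r k)) \<noteq> 0) sequentially" if "i < C" "i \<notin> J" for i
  proof (rule tendsto_imp_eventually_ne)
    show "(\<lambda>k. linear_form (a i) (X (r k))) \<longlonglongrightarrow> linear_form (a i) x" by (intro tendsto_intros lim)
    show "linear_form (a i) x \<noteq> 0" using x x0'[OF that] l by simp
  qed
  have ev2: "eventually (\<lambda>k. linear_form (a i) (V (r k)) \<noteq> 0) sequentially" if "i \<in> J" for i
  proof (rule tendsto_imp_eventually_ne)
    show "(\<lambda>k. linear_form (a i) (V (r k))) \<longlonglongrightarrow> linear_form (a i) v" by (intro tendsto_intros lim)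
    show "linear_form (a i) v \<noteq> 0" using v v0[OF that] l by simp
  qed
  have "eventually (\<lambda>k. \<forall>i\<in>{..<C} - J. linear_form (a i) (X (r k)) \<noteq> 0) sequentially"
    "eventually (\<lambda>k. \<forall>i\<in>J. linear_form (a i) (V (r k)) \<noteq> 0) sequentially"
    using ev1 ev2 J(3) by (auto intro!: eventually_ball_finite)
  then have "eventually (\<lambda>k. False) sequentially"
  proof eventually_elim
    case (elim k)
    have "linear_form (a i) (X (r k)) \<noteq> 0" if i: "i < C" "i \<noteq> 2 * n" for i
    proof (cases "i \<in> J")
      case False
      then show ?thesis using elim(1) i by blast
    next
      case True
      then have "i < 2 * n" using i by (auto simp: J_def)
      then show ?thesis using XV(2)[of i "r k"] elim(2) True by auto
    qed
    moreover have "2 * n \<in> J" using n by (simp add: J_def)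
    ultimately have "good (X (r k)) (V (r k))" using elim(2) by (auto simp: good_def)
    then show ?case using bad[of "V (r k)" "r k" "X (r k)"] XV(2,3) by blast
  qed
  then show False by simp
qed


section \<open>Restriction to an auxiliary hyperplane\<close>

text \<open>
  The heart of the upper bound.  The points and tangent vectors where \<open>2n\<close> logarithmic derivatives have
  given values form at least a line, and there \<open>S\<close> is constant.  The line contains a point of the
  auxiliary hyperplane with index \<open>2n\<close>, so \<open>S\<close> is determined by its restriction to that hyperplane.
\<close>

lemma zero_if_zero_on_hyperplane:
  assumes n: "CARD('n) = n + 1" "n > 0" and C: "2 * n + 1 \<le> C" "c \<le> 2 * n"
    and S: "log_symmetric m S" and m: "m > 0"
    and zero: "\<And>x v. linear_form (a (2 * n)) x = 0 \<Longrightarrow> (\<forall>i<2 * n. linear_form (a i) x \<noteq> 0) \<Longrightarrow>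
      linear_form (a (2 * n)) v \<noteq> 0 \<Longrightarrow> S x v = 0"
    and x: "\<forall>i<2 * n. linear_form (a i) x \<noteq> 0"
  shows "S x v = 0"
proof -
  obtain \<mu>0 \<delta> where \<delta>: "\<delta> > 0" and sol: "\<And>\<mu> \<tau>. (\<forall>i<2 * n. norm (\<mu> i - \<mu>0 i) < \<delta>) \<Longrightarrow> norm \<tau> < \<delta> \<Longrightarrow>
    (\<exists>x v. (\<forall>i<2 * n. linear_form (a i) v = \<mu> i * linear_form (a i) x) \<and>
       \<tau> * linear_form (a (2 * n)) v = linear_form (a (2 * n)) x \<and>
       (\<forall>i<C. i \<noteq> 2 * n \<longrightarrow> linear_form (a i) x \<noteq> 0) \<and> linear_form (a (2 * n)) v \<noteq> 0)"
    using open_set_of_log_derivatives[OF n C(1)] by blast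
  obtain y w where y: "\<And>i. i < 2 * n \<Longrightarrow> linear_form (a i) w = \<mu>0 i * linear_form (a i) y"
    "\<And>i. i < 2 * n \<Longrightarrow> linear_form (a i) y \<noteq> 0"
    using sol[of \<mu>0 0] \<delta> C by fastforce
  define X where "X t = y + t *s (x - y)" for t
  define V where "V t = w + t *s (v - w)" for t
  have ev: "eventually (\<lambda>t. linear_form (a i) (X t) \<noteq> 0 \<and>
      norm (linear_form (a i) (V t) / linear_form (a i) (X t) - \<mu>0 i) < \<delta>) (nhds 0)" if i: "i < 2 * n" for i
  proof -
    have X: "((\<lambda>t. linear_form (a i) (X t)) \<longlongrightarrow> linear_form (a i) (X 0)) (nhds 0)"
      unfolding X_def by (intro tendsto_intros filterlim_ident)
    have V: "((\<lambda>t. linear_form (a i) (V t)) \<longlongrightarrow> linear_form (a i) (V 0)) (nhds 0)"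
      unfolding V_def by (intro tendsto_intros filterlim_ident)
    have nz: "linear_form (a i) (X 0) \<noteq> 0" using y(2)[OF i] by (simp add: X_def)
    have "((\<lambda>t. norm (linear_form (a i) (V t) / linear_form (a i) (X t) - \<mu>0 i)) \<longlongrightarrow>
        norm (linear_form (a i) (V 0) / linear_form (a i) (X 0) - \<mu>0 i)) (nhds 0)"
      by (intro tendsto_norm tendsto_diff tendsto_divide X V nz tendsto_const)
    moreover have "norm (linear_form (a i) (V 0) / linear_form (a i) (X 0) - \<mu>0 i) = 0"
      using y[OF i] by (simp add: X_def V_def)
    ultimately have "eventually (\<lambda>t. norm (linear_form (a i) (V t) / linear_form (a i) (X t) - \<mu>0 i) < \<delta>) (nhds 0)"
      using \<delta> by (simp add: order_tendstoD(2))
    then show ?thesis using tendsto_imp_eventually_ne[OF X nz] by eventually_elim auto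
  qed
  \<comment> \<open>near the base point \<open>(y, w)\<close> the derivatives are in the open set, where \<open>\<tau> = 0\<close> gives a point of the hyperplane\<close>
  have "eventually (\<lambda>t. \<forall>i\<in>{..<2 * n}. linear_form (a i) (X t) \<noteq> 0 \<and>
      norm (linear_form (a i) (V t) / linear_form (a i) (X t) - \<mu>0 i) < \<delta>) (nhds 0)"
    using ev by (intro eventually_ball_finite) auto
  then have small: "eventually (\<lambda>t. S (X t) (V t) = 0) (nhds 0)"
  proof eventually_elim
    case (elim t)
    define \<mu> where "\<mu> i = linear_form (a i) (V t) / linear_form (a i) (X t)" for i
    have \<mu>: "\<forall>i<2 * n. linear_form (a i) (V t) = \<mu> i * linear_form (a i) (X t)"
      using elim by (simp add: \<mu>_def)
    have Xnz: "\<forall>i<2 * n. linear_form (a i) (X t) \<noteq> 0" using elim by blast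
    have "\<forall>i<2 * n. norm (\<mu> i - \<mu>0 i) < \<delta>" using elim by (simp add: \<mu>_def)
    from sol[OF this, of 0] \<delta> obtain x1 v1 where x1: "\<forall>i<2 * n. linear_form (a i) v1 = \<mu> i * linear_form (a i) x1"
      "linear_form (a (2 * n)) x1 = 0" "\<forall>i<C. i \<noteq> 2 * n \<longrightarrow> linear_form (a i) x1 \<noteq> 0"
      "linear_form (a (2 * n)) v1 \<noteq> 0" by auto
    have x1nz: "\<forall>i<2 * n. linear_form (a i) x1 \<noteq> 0" using x1(3) C by auto
    show ?case
    proof (cases "\<exists>u. V t = u *s X t")
      case True
      then show ?thesis using log_symmetricD(1)[OF S] by auto
    next
      case False
      have "S (X t) (V t) = S x1 v1"
        by (rule log_symmetric_line_constant[OF S C(2) _ _ Xnz x1nz _ _ \<mu> x1(1)])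
          (use n C False x1 in auto)
      also have "S x1 v1 = 0" by (rule zero[OF x1(2) x1nz x1(4)])
      finally show ?thesis .
    qed
  qed
  obtain q where q: "\<And>t. (\<Prod>i<2 * n. linear_form (a i) (X t)) ^ (m + 1) * S (X t) (V t) = poly q t"
    using log_symmetric_line_polynomial[OF S m C(2), of y "x - y" w "v - w"] n unfolding X_def V_def by auto
  have "q = 0"
  proof (rule ccontr)
    assume "q \<noteq> 0"
    then have "finite {t. poly q t = 0}" by (rule poly_roots_finite)
    moreover obtain A where A: "open A" "0 \<in> A" "\<And>t. t \<in> A \<Longrightarrow> S (X t) (V t) = 0"
      using small by (auto simp: eventually_nhds)
    have "A \<subseteq> {t. poly q t = 0}" using A(3) by (auto simp flip: q)
    ultimately have "finite A" using finite_subset by blast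
    moreover obtain e where "e > 0" "ball 0 e \<subseteq> A" using A openE by blast
    ultimately show False
      using uncountable_ball[of e "0 :: complex"] countable_finite finite_subset by blast
  qed
  moreover have "X 1 = x" "V 1 = v" by (simp_all add: X_def V_def)
  ultimately have "(\<Prod>i<2 * n. linear_form (a i) x) ^ (m + 1) * S x v = 0" using q[of 1] by simp
  then show ?thesis using x by auto
qed

end

section \<open>Dimensions of spaces of functions\<close>

lemma module_fun: "module (\<lambda>t (s :: 'a \<Rightarrow> complex) y. t * s y)"
  by unfold_locales (auto simp: fun_eq_iff algebra_simps)

lemma fun_independent_iff:
  fixes B :: "('a \<Rightarrow> complex) set"
  assumes "finite B"
  shows "\<not> module.dependent (\<lambda>t s y. t * s y) B \<longleftrightarrow>
    (\<forall>u. (\<forall>y. (\<Sum>s\<in>B. u s * s y) = 0) \<longrightarrow> (\<forall>s\<in>B. u s = 0))"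
proof -
  have sum_apply: "(\<Sum>s\<in>T. (\<lambda>y. u s * s y)) = (\<lambda>y. \<Sum>s\<in>T. u s * s y)" for T :: "('a \<Rightarrow> complex) set" and u
    by (induction T rule: infinite_finite_induct) (auto simp: fun_eq_iff)
  show ?thesis
    unfolding module.dependent_explicit[OF module_fun] sum_apply
  proof safe
    fix u s
    assume "\<nexists>t u. finite t \<and> t \<subseteq> B \<and> (\<lambda>y. \<Sum>s\<in>t. u s * s y) = 0 \<and> (\<exists>v\<in>t. u v \<noteq> 0)"
      "\<forall>y. (\<Sum>s\<in>B. u s * s y) = 0" "s \<in> B"
    then show "u s = 0" using assms by (auto simp: fun_eq_iff)
  next
    fix T u s
    assume *: "\<forall>u. (\<forall>y. (\<Sum>s\<in>B. u s * s y) = 0) \<longrightarrow> (\<forall>s\<in>B. u s = 0)"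
      and T: "T \<subseteq> B" "(\<lambda>y. \<Sum>s\<in>T. u s * s y) = 0" "s \<in> T" "u s \<noteq> 0"
    have "(\<Sum>s\<in>B. (if s \<in> T then u s else 0) * s y) = (\<Sum>s\<in>T. u s * s y)" for y
      using assms T(1) by (intro sum.mono_neutral_cong_right) auto
    then have "\<forall>y. (\<Sum>s\<in>B. (if s \<in> T then u s else 0) * s y) = 0" using T(2) by (simp add: fun_eq_iff)
    from mp[OF spec[OF *] this] have "\<forall>s\<in>B. (if s \<in> T then u s else 0) = 0" .
    then have "(if s \<in> T then u s else 0) = 0" using T(1,3) by blast
    then show False using T(3,4) by simp
  qed
qed

lemma fun_dim_le:
  assumes "\<And>B. finite B \<Longrightarrow> B \<subseteq> V \<Longrightarrow> M < card B \<Longrightarrow>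
    \<exists>u. (\<exists>s\<in>B. u s \<noteq> 0) \<and> (\<forall>y. (\<Sum>s\<in>B. u s * s y) = 0)"
  shows "fun_dim V \<le> enat M"
  unfolding fun_dim_def
proof (rule SUP_least, clarify)
  fix B assume B: "B \<subseteq> V" "finite B" "\<not> module.dependent (\<lambda>t s y. t * s y) B"
  show "enat (card B) \<le> enat M"
  proof (rule ccontr)
    assume "\<not> ?thesis"
    then have "M < card B" by simp
    with assms[OF B(2,1)] show False using B(3) unfolding fun_independent_iff[OF B(2)] by blast
  qed
qed

lemma fun_dim_ge:
  fixes s :: "nat \<Rightarrow> 'a \<Rightarrow> complex"
  assumes V: "\<And>N. N < M \<Longrightarrow> s N \<in> V"
    and ind: "\<And>u N. (\<And>y. (\<Sum>N<M. u N * s N y) = 0) \<Longrightarrow> N < M \<Longrightarrow> u N = 0"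
  shows "enat M \<le> fun_dim V"
proof -
  have inj: "inj_on s {..<M}"
  proof (rule inj_onI, rule ccontr)
    fix K L assume KL: "K \<in> {..<M}" "L \<in> {..<M}" "s K = s L" "K \<noteq> L"
    define u :: "nat \<Rightarrow> complex" where "u N = (if N = K then 1 else if N = L then -1 else 0)" for N
    have "(\<Sum>N<M. u N * s N y) = (\<Sum>N\<in>{K, L}. u N * s N y)" for y
      using KL by (intro sum.mono_neutral_right) (auto simp: u_def)
    then have "(\<Sum>N<M. u N * s N y) = 0" for y using KL(3,4) by (simp add: u_def)
    then have "u K = 0" using ind[of u K] KL(1) by simp
    then show False by (simp add: u_def)
  qed
  have "\<not> module.dependent (\<lambda>t s y. t * s y) (s ` {..<M})"
    unfolding fun_independent_iff[OF finite_imageI[OF finite_lessThan]]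
  proof (intro allI impI ballI)
    fix u f assume "\<forall>y. (\<Sum>f\<in>s ` {..<M}. u f * f y) = 0" "f \<in> s ` {..<M}"
    then show "u f = 0" using ind[of "\<lambda>N. u (s N)"] by (auto simp: sum.reindex[OF inj])
  qed
  then have "enat (card (s ` {..<M})) \<le> fun_dim V"
    unfolding fun_dim_def using V by (intro SUP_upper) auto
  then show ?thesis by (simp add: card_image[OF inj])
qed

lemma sum_fun_upd:
  fixes f :: "'b \<Rightarrow> complex ^ 'n"
  assumes "finite J" "j \<in> J"
  shows "(\<Sum>i\<in>J. (y(j := t)) i *s f i) = (\<Sum>i\<in>J. (y(j := 0)) i *s f i) + t *s f j"
  using assms by (simp add: sum.remove[OF assms] add.commute)

section \<open>Few sections for at most \<open>2n\<close> hyperplanes\<close>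

context arrangement
begin

text \<open>
  Modulo radial vectors and scaling the general pairs \<open>(x, v)\<close> with \<open>x\<close> on a hyperplane form an affine
  space of dimension \<open>2n - 2\<close>, in which sections become polynomials of degree at most \<open>2n (m + 1)\<close> in
  each coordinate after clearing poles.  More sections than points in a grid for this degree have a
  combination that vanishes on the grid, hence on the hyperplane, hence everywhere.
\<close>

lemma few_sections:
  assumes n: "CARD('n) = n + 1" "n \<ge> 2" and C: "2 * n + 1 \<le> C" "c \<le> 2 * n" and m: "m > 0"
  shows "fun_dim (taut_sections \<Omega> m) \<le> enat ((2 * n * (m + 1) + 1) ^ (2 * n - 2))"
proof (rule fun_dim_le)
  define d where "d = 2 * n * (m + 1)"
  define k where "k = 2 * n - 2"
  fix B assume B: "finite B" "B \<subseteq> taut_sections \<Omega> m" and "(2 * n * (m + 1) + 1) ^ (2 * n - 2) < card B"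
  then have card: "(d + 1) ^ k < card B" by (simp add: d_def k_def)
  define K where "K = insert (2 * n) {..<n}"
  have K: "K \<subseteq> {..<C}" "card K = CARD('n)" "finite K" using C n by (auto simp: K_def)
  obtain e where e: "\<And>i j. i \<in> K \<Longrightarrow> j \<in> K \<Longrightarrow> linear_form (a i) (e j) = (if i = j then 1 else 0)"
    "\<And>x. x = (\<Sum>i\<in>K. linear_form (a i) x *s e i)"
    using dual_vectors[OF K(1,2)] by blast
  \<comment> \<open>the slice where the forms with indices \<open>0\<close> and \<open>2n\<close> take the values \<open>1\<close> and \<open>0\<close> on \<open>x\<close>, and \<open>0\<close> and \<open>1\<close> on \<open>v\<close>\<close>
  define X where "X y = e 0 + (\<Sum>i<n - 1. y i *s e (i + 1))" for y
  define V where "V y = e (2 * n) + (\<Sum>i<n - 1. y (n - 1 + i) *s e (i + 1))" for y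
  define T where "T = {..<k} \<rightarrow>\<^sub>E (of_nat ` {..d} :: complex set)"
  have T: "finite T" "card T = (d + 1) ^ k"
    by (auto simp: T_def finite_PiE card_PiE card_image inj_on_def)
  obtain u where u: "\<exists>s\<in>B. u s \<noteq> 0" "\<And>y. y \<in> T \<Longrightarrow> (\<Sum>s\<in>B. u s * pullback s (X y) (V y)) = 0"
    using homogeneous_system[OF T(1) B(1), of "\<lambda>s y. pullback s (X y) (V y)"] card T(2) by auto
  define S where "S x v = (\<Sum>s\<in>B. u s * pullback s x v)" for x v
  have S: "log_symmetric m S"
    unfolding S_def using B m by (intro log_symmetric_sum pullback_log_symmetric) auto
  define Q where "Q y = (\<Prod>i<2 * n. linear_form (a i) (X y)) ^ (m + 1) * S (X y) (V y)" for y
  have Q: "Q y = 0" for y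
  proof (rule zero_if_zero_on_grid[of k d Q])
    fix y :: "nat \<Rightarrow> complex" and j assume j: "j < k"
    show "\<exists>q. degree q \<le> d \<and> (\<forall>t. Q (y(j := t)) = poly q t)"
    proof (cases "j < n - 1")
      case True
      have sum: "(\<Sum>i<n - 1. (y(j := t)) i *s e (i + 1)) = (\<Sum>i<n - 1. (y(j := 0)) i *s e (i + 1)) + t *s e (j + 1)" for t
        using True by (intro sum_fun_upd) auto
      have "X (y(j := t)) = X (y(j := 0)) + t *s e (j + 1)" for t
        unfolding X_def sum[of t] by (simp only: add.assoc)
      moreover have "V (y(j := t)) = V y + t *s 0" for t
        using True by (auto simp: V_def intro!: sum.cong)
      ultimately have line: "Q (y(j := t)) = (\<Prod>i<2 * n. linear_form (a i) (X (y(j := 0)) + t *s e (j + 1))) ^ (m + 1) *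
          S (X (y(j := 0)) + t *s e (j + 1)) (V y + t *s 0)" for t
        unfolding Q_def by metis
      show ?thesis
        unfolding line d_def using n by (intro log_symmetric_line_polynomial[OF S m C(2)]) simp
    next
      case False
      then have j': "j - (n - 1) < n - 1" "n - 1 + (j - (n - 1)) = j" using j by (auto simp: k_def)
      have shift: "(\<lambda>i. (y(j := t)) (n - 1 + i)) = (\<lambda>i. y (n - 1 + i))(j - (n - 1) := t)" for t
        using False by (auto simp: fun_eq_iff)
      have sum: "(\<Sum>i<n - 1. (y(j := t)) (n - 1 + i) *s e (i + 1)) =
          (\<Sum>i<n - 1. (y(j := 0)) (n - 1 + i) *s e (i + 1)) + t *s e (j - (n - 1) + 1)" for t
        using sum_fun_upd[of "{..<n - 1}" "j - (n - 1)" "\<lambda>i. y (n - 1 + i)" t "\<lambda>i. e (i + 1)",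
            folded shift] j'(1) by simp
      have "V (y(j := t)) = V (y(j := 0)) + t *s e (j - (n - 1) + 1)" for t
        unfolding V_def sum[of t] by (simp only: add.assoc)
      moreover have "X (y(j := t)) = X y + t *s 0" for t
        using False by (auto simp: X_def intro!: sum.cong)
      ultimately have line: "Q (y(j := t)) = (\<Prod>i<2 * n. linear_form (a i) (X y + t *s 0)) ^ (m + 1) *
          S (X y + t *s 0) (V (y(j := 0)) + t *s e (j - (n - 1) + 1))" for t
        unfolding Q_def by metis
      show ?thesis
        unfolding line d_def using n by (intro log_symmetric_line_polynomial[OF S m C(2)]) simp
    qed
  next
    fix y :: "nat \<Rightarrow> complex" assume y: "\<forall>j<k. y j \<in> of_nat ` {..d}"
    let ?y = "restrict y {..<k}"
    have "X y = X ?y" "V y = V ?y"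
      by (auto simp: X_def V_def k_def intro!: sum.cong)
    moreover have "?y \<in> T" using y by (auto simp: T_def)
    ultimately show "Q y = 0" using u(2) by (simp add: Q_def S_def)
  qed
  have zero: "S x v = 0" if x: "linear_form (a (2 * n)) x = 0" "\<forall>i<2 * n. linear_form (a i) x \<noteq> 0"
    and v: "linear_form (a (2 * n)) v \<noteq> 0" for x v
  proof -
    \<comment> \<open>move \<open>(x, v)\<close> into the slice by scaling and by subtracting a radial vector\<close>
    define l where "l = inverse (linear_form (a 0) x)"
    have l: "l \<noteq> 0" "l * linear_form (a 0) x = 1" using x(2) n by (auto simp: l_def)
    define x' where "x' = l *s x"
    have xH: "x \<notin> \<H>" "x' \<notin> \<H>" using x(2) C \<H>_scale[OF l(1)] by (auto simp: x'_def not_in_\<H>)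
    define v' where "v' = l *s v + (- linear_form (a 0) (l *s v)) *s x'"
    have x': "linear_form (a 0) x' = 1" "linear_form (a (2 * n)) x' = 0" using l x(1) by (auto simp: x'_def)
    have v': "linear_form (a 0) v' = 0" "linear_form (a (2 * n)) v' \<noteq> 0"
      using x' v l by (auto simp: v'_def)
    define r where "r = linear_form (a (2 * n)) v'"
    define v'' where "v'' = inverse r *s v'"
    have v'': "linear_form (a 0) v'' = 0" "linear_form (a (2 * n)) v'' = 1" "v' = r *s v''" "r \<noteq> 0"
      using v' by (auto simp: v''_def r_def vec.scale_scale)
    define y where "y i = (if i < n - 1 then linear_form (a (i + 1)) x' else linear_form (a (i - (n - 1) + 1)) v'')" for i
    have split: "(\<Sum>i\<in>K. f i) = f (2 * n) + (f 0 + (\<Sum>i<n - 1. f (i + 1)))" for f :: "nat \<Rightarrow> complex ^ 'n"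
    proof -
      have "(\<Sum>i<n. f i) = f 0 + (\<Sum>i<n - 1. f (i + 1))"
        using n sum.lessThan_Suc_shift[of f "n - 1"] by simp
      then show ?thesis by (simp add: K_def)
    qed
    have "X y = x'" using e(2)[of x'] x' by (simp add: X_def y_def split)
    moreover have "V y = v''"
    proof -
      have "y (n - 1 + i) = linear_form (a (i + 1)) v''" for i by (simp add: y_def)
      then have "V y = e (2 * n) + (\<Sum>i<n - 1. linear_form (a (i + 1)) v'' *s e (i + 1))"
        unfolding V_def by (simp only:)
      also have "\<dots> = v''" using e(2)[of v''] v''(1,2) by (simp add: split)
      finally show ?thesis .
    qed
    ultimately have "(\<Prod>i<2 * n. linear_form (a i) x') ^ (m + 1) * S x' v'' = 0" using Q[of y] by (simp add: Q_def)
    moreover have "(\<Prod>i<2 * n. linear_form (a i) x') \<noteq> 0" using x(2) l by (auto simp: x'_def)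
    ultimately have "S x' v'' = 0" by simp
    then have "S x' v' = 0" using log_symmetricD(5)[OF S xH(2) v''(4), of v''] v''(3) by simp
    then have "S x' (l *s v) = 0" unfolding v'_def log_symmetricD(3)[OF S] .
    then show "S x v = 0" using log_symmetricD(4)[OF S xH(1) l(1), of v] by (simp add: x'_def)
  qed
  have "S x v = 0" if "\<forall>i<C. linear_form (a i) x \<noteq> 0" for x v
    by (rule zero_if_zero_on_hyperplane[OF n(1) _ C S m zero]) (use n C that in auto)
  then have "\<forall>z. (\<Sum>s\<in>B. u s * s z) = 0"
    using sections_zero_if_pullback_zero[OF B, of u] by (simp add: S_def)
  then show "\<exists>u. (\<exists>s\<in>B. u s \<noteq> 0) \<and> (\<forall>y. (\<Sum>s\<in>B. u s * s y) = 0)" using u(1) by blast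
qed

end


section \<open>Many sections for at least \<open>2n + 1\<close> hyperplanes\<close>

lemma case_prod_const: "(\<lambda>(x, y). t) = (\<lambda>_. t)"
  by (simp add: fun_eq_iff)

lemma sym_section_monomial:
  assumes "proj_open U" "finite J" "\<And>j. j \<in> J \<Longrightarrow> \<omega> j \<in> E U"
  shows "sym_section E U (\<Sum>j\<in>J. d j) (\<lambda>(x, \<xi>). \<Prod>j\<in>J. \<xi> (\<omega> j) ^ d j)"
  using assms(2,3)
proof (induction J rule: finite_induct)
  case empty
  show ?case
    using sym_section.scalar[OF regular_fun_const[OF assms(1), of 1], of E] by (simp add: case_prod_const)
next
  case (insert i J)
  have "sym_section E U (l + (\<Sum>j\<in>J. d j)) (\<lambda>(x, \<xi>). \<xi> (\<omega> i) ^ l * (\<Prod>j\<in>J. \<xi> (\<omega> j) ^ d j))" for l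
  proof (induction l)
    case 0
    then show ?case using insert by simp
  next
    case (Suc l)
    have eq: "(\<lambda>(x, \<xi>). \<xi> (\<omega> i) ^ Suc l * (\<Prod>j\<in>J. \<xi> (\<omega> j) ^ d j)) =
      (\<lambda>(x, \<xi>). \<xi> (\<omega> i) * (case (x, \<xi>) of (x, \<xi>) \<Rightarrow> \<xi> (\<omega> i) ^ l * (\<Prod>j\<in>J. \<xi> (\<omega> j) ^ d j)))"
      by (auto simp: fun_eq_iff mult.assoc)
    show ?case
      unfolding eq add_Suc by (rule sym_section.mult[OF _ Suc]) (use insert.prems in simp)
  qed
  then show ?case using insert.hyps by simp
qed

lemma monomial_taut_section:
  fixes E :: "(complex ^ 'n) set \<Rightarrow> (complex ^ 'n \<Rightarrow> complex ^ 'm) set"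
  assumes "finite J" "\<And>j. j \<in> J \<Longrightarrow> \<omega> j \<in> E (- {0})"
  shows "(\<lambda>(x, \<xi>). if (x, \<xi>) \<in> rank_one_quotients E then \<Prod>j\<in>J. \<xi> (\<omega> j) ^ d j else 0)
    \<in> taut_sections E (\<Sum>j\<in>J. d j)"
  unfolding taut_sections_def
proof (intro CollectI conjI ballI)
  let ?A = "\<lambda>(x :: complex ^ 'n, \<xi> :: (complex ^ 'n \<Rightarrow> complex ^ 'm) \<Rightarrow> complex). \<Prod>j\<in>J. \<xi> (\<omega> j) ^ d j"
  have A: "sym_section E (- {0}) (0 + (\<Sum>j\<in>J. d j)) ?A"
    using sym_section_monomial[of "- {0}" J \<omega> E d, OF proj_open_nonzero assms] by simp
  have B: "sym_section E (- {0}) 0 (\<lambda>_. 1)"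
    using sym_section.scalar[OF regular_fun_const[OF proj_open_nonzero, of 1], of E] by (simp add: case_prod_const)
  fix y assume y: "y \<in> rank_one_quotients E"
  then have "fst y \<noteq> 0" by (auto simp: rank_one_quotients_def)
  then show "case y of (p, \<xi>) \<Rightarrow> \<exists>U k A B. proj_open U \<and> p \<in> U \<and> sym_section E U (k + (\<Sum>j\<in>J. d j)) A \<and>
      sym_section E U k B \<and> B (p, \<xi>) \<noteq> 0 \<and>
      (\<forall>(x, \<eta>)\<in>rank_one_quotients E. x \<in> U \<and> B (x, \<eta>) \<noteq> 0 \<longrightarrow>
         (case (x, \<eta>) of (x, \<xi>) \<Rightarrow> if (x, \<xi>) \<in> rank_one_quotients E then \<Prod>j\<in>J. \<xi> (\<omega> j) ^ d j else 0) =
         A (x, \<eta>) / B (x, \<eta>))"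
  proof (cases y)
    case (Pair p \<xi>)
    show ?thesis
      unfolding Pair prod.case
      by (rule exI[of _ "- {0}"], rule exI[of _ "0 :: nat"], rule exI[of _ ?A], rule exI[of _ "\<lambda>_. 1"])
        (use A B proj_open_nonzero \<open>fst y \<noteq> 0\<close> Pair in auto)
  qed
qed auto

definition digit :: "nat \<Rightarrow> nat \<Rightarrow> nat \<Rightarrow> nat" where
  "digit b N j = (N div b ^ j) mod b"

lemma digit_sum: "(\<Sum>j<k. digit b N j * b ^ j) = N mod b ^ k"
proof (induction k)
  case (Suc k)
  have "N mod b ^ Suc k = b ^ k * (N div b ^ k mod b) + N mod b ^ k"
    by (metis mod_mult2_eq mult.commute power_Suc)
  then show ?case using Suc by (simp add: digit_def)
qed simp

lemma avoid_finite_in_ball: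
  fixes F :: "complex set"
  assumes "finite F" "\<delta> > 0"
  obtains z where "norm z < \<delta>" "z \<notin> F"
proof -
  have "\<not> ball 0 \<delta> \<subseteq> F"
    using assms uncountable_ball[of \<delta> "0 :: complex"] countable_finite finite_subset by blast
  then obtain z where "z \<in> ball 0 \<delta>" "z \<notin> F" by blast
  then show ?thesis using that[of z] by simp
qed

context arrangement
begin

text \<open>
  The sections are monomials of degree \<open>m\<close> in the \<open>2n\<close> forms \<open>dl_i/l_i - dl_0/l_0\<close>.  The exponents of all
  but the last one are the digits of a number in base \<open>m div (2n) + 1\<close>, and the last exponent supplies
  the missing degree.  Since \<open>2n + 1\<close> logarithmic derivatives can be prescribed freely in an open set,
  the last form can be kept constant and the others made to take the values \<open>w j * z ^ (b ^ j)\<close> for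
  \<open>z\<close> near \<open>1\<close>.  This Kronecker substitution turns the monomials into multiples of distinct powers
  of \<open>z\<close>.
\<close>

lemma many_sections:
  assumes n: "CARD('n) = n + 1" "n > 0" and c: "2 * n + 1 \<le> c"
  shows "enat ((m div (2 * n) + 1) ^ (2 * n - 1)) \<le> fun_dim (taut_sections \<Omega> m)"
proof -
  define b where "b = m div (2 * n) + 1"
  define k where "k = 2 * n - 1"
  define M where "M = b ^ k"
  have k: "2 * n = Suc k" using n by (simp add: k_def)
  have C: "2 * n + 1 \<le> C" using c c_le by simp
  define \<omega> where "\<omega> j = dlog_ratio (Suc j) 0" for j
  define d where "d N j = (if j < k then digit b N j else m - (\<Sum>j<k. digit b N j))" for N j
  define s where "s N = (\<lambda>(x, \<xi>). if (x, \<xi>) \<in> rank_one_quotients \<Omega> then \<Prod>j<2 * n. \<xi> (\<omega> j) ^ d N j else 0)" for N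
  have "(\<Sum>j<k. digit b N j) \<le> m" for N
  proof -
    have "(\<Sum>j<k. digit b N j) \<le> (\<Sum>j<k. m div (2 * n))"
      by (intro sum_mono) (simp add: digit_def b_def flip: less_Suc_eq_le)
    also have "\<dots> \<le> 2 * n * (m div (2 * n))" by (simp add: k)
    also have "\<dots> \<le> m" by simp
    finally show ?thesis .
  qed
  then have deg: "(\<Sum>j<2 * n. d N j) = m" for N by (simp add: k d_def)
  have s: "s N \<in> taut_sections \<Omega> m" for N
    using monomial_taut_section[of "{..<2 * n}" \<omega> \<Omega> "d N"] dlog_ratio_log_cotangent c
    unfolding deg by (simp add: s_def \<omega>_def)
  obtain \<mu>0 \<delta> where \<delta>: "\<delta> > 0" and sol: "\<And>\<mu> \<tau>. (\<forall>i<2 * n. norm (\<mu> i - \<mu>0 i) < \<delta>) \<Longrightarrow> norm \<tau> < \<delta> \<Longrightarrow>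
    (\<exists>x v. (\<forall>i<2 * n. linear_form (a i) v = \<mu> i * linear_form (a i) x) \<and>
       \<tau> * linear_form (a (2 * n)) v = linear_form (a (2 * n)) x \<and>
       (\<forall>i<C. i \<noteq> 2 * n \<longrightarrow> linear_form (a i) x \<noteq> 0) \<and> linear_form (a (2 * n)) v \<noteq> 0)"
    using open_set_of_log_derivatives[OF n C] by blast
  \<comment> \<open>a base point in the open set where no difference \<open>\<mu> j - \<mu> 0\<close> vanishes\<close>
  obtain \<epsilon> where \<epsilon>: "norm \<epsilon> < \<delta>" "\<epsilon> \<notin> (\<lambda>i. \<mu>0 i - \<mu>0 0) ` {..<2 * n}"
    by (rule avoid_finite_in_ball[OF _ \<delta>, of "(\<lambda>i. \<mu>0 i - \<mu>0 0) ` {..<2 * n}"]) auto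
  define \<nu> where "\<nu> = \<mu>0 0 + \<epsilon>"
  obtain \<tau> where "norm \<tau> < \<delta>" "\<tau> \<notin> {0, inverse \<nu>}"
    by (rule avoid_finite_in_ball[OF _ \<delta>, of "{0, inverse \<nu>}"]) auto
  then have \<tau>: "norm \<tau> < \<delta>" "\<tau> \<noteq> 0" "\<tau> * \<nu> \<noteq> 1"
    using inverse_unique[of \<nu> \<tau>] by (auto simp: mult.commute)
  define w where "w j = (if j < k then \<mu>0 (Suc j) else inverse \<tau>) - \<nu>" for j
  have w: "w j \<noteq> 0" if "j < 2 * n" for j
  proof (cases "j < k")
    case True
    then have "Suc j < 2 * n" using k by simp
    then have "\<epsilon> \<noteq> \<mu>0 (Suc j) - \<mu>0 0" using \<epsilon>(2) by blast
    then show ?thesis using True by (auto simp: w_def \<nu>_def algebra_simps)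
  next
    case False
    then show ?thesis using \<tau>(2,3) by (auto simp: w_def)
  qed
  define \<kappa> where "\<kappa> N = (\<Prod>j<2 * n. w j ^ d N j)" for N
  have \<kappa>: "\<kappa> N \<noteq> 0" for N using w by (simp add: \<kappa>_def)
  \<comment> \<open>along this curve the section \<open>s N\<close> restricts to a multiple of \<open>z ^ N\<close>\<close>
  define Y where "Y z j = w j * (if j < k then z ^ (b ^ j) else 1)" for z j
  have Y: "(\<Prod>j<2 * n. Y z j ^ d N j) = \<kappa> N * z ^ N" if "N < M" for N z
  proof -
    have "(\<Prod>j<2 * n. (if j < k then z ^ (b ^ j) else 1) ^ d N j) = (\<Prod>j<k. z ^ (digit b N j * b ^ j))"
      unfolding k by (simp add: d_def mult.commute flip: power_mult)
    also have "\<dots> = z ^ N" using that digit_sum[of b N k] by (simp add: M_def flip: power_sum)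
    finally show ?thesis by (simp add: Y_def \<kappa>_def power_mult_distrib prod.distrib)
  qed
  define \<mu> where "\<mu> z i = (if i = 0 then \<nu> else \<nu> + Y z (i - 1))" for z i
  have near: "eventually (\<lambda>z. norm (\<mu> z i - \<mu>0 i) < \<delta>) (nhds 1)" if i: "i < 2 * n" for i
  proof (cases "i = 0")
    case True
    then show ?thesis using \<epsilon>(1) by (simp add: \<mu>_def \<nu>_def)
  next
    case False
    then have i': "i - 1 < k" using i k by auto
    have "((\<lambda>z. norm (\<nu> + w (i - 1) * z ^ (b ^ (i - 1)) - \<mu>0 i)) \<longlongrightarrow>
        norm (\<nu> + w (i - 1) * 1 ^ (b ^ (i - 1)) - \<mu>0 i)) (nhds 1)"
      by (intro tendsto_intros filterlim_ident)
    then have "((\<lambda>z. norm (\<mu> z i - \<mu>0 i)) \<longlongrightarrow> norm (\<mu> 1 i - \<mu>0 i)) (nhds 1)"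
      using False i' by (simp add: \<mu>_def Y_def)
    moreover have "norm (\<mu> 1 i - \<mu>0 i) = 0" using False i' by (simp add: \<mu>_def Y_def w_def)
    ultimately show ?thesis using \<delta> by (simp add: order_tendstoD(2))
  qed
  have "eventually (\<lambda>z. \<forall>i\<in>{..<2 * n}. norm (\<mu> z i - \<mu>0 i) < \<delta>) (nhds 1)"
    using near by (intro eventually_ball_finite) auto
  then obtain A where A: "open A" "1 \<in> A" "\<And>z i. z \<in> A \<Longrightarrow> i < 2 * n \<Longrightarrow> norm (\<mu> z i - \<mu>0 i) < \<delta>"
    unfolding eventually_nhds by fastforce
  have points: "\<exists>y. \<forall>N<M. s N y = \<kappa> N * z ^ N" if z: "z \<in> A" for z
  proof -
    obtain x v where xv: "\<And>i. i < 2 * n \<Longrightarrow> linear_form (a i) v = \<mu> z i * linear_form (a i) x"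
       "\<tau> * linear_form (a (2 * n)) v = linear_form (a (2 * n)) x"
       "\<And>i. i < C \<Longrightarrow> i \<noteq> 2 * n \<Longrightarrow> linear_form (a i) x \<noteq> 0" "linear_form (a (2 * n)) v \<noteq> 0"
      using sol[of "\<mu> z" \<tau>] A(3)[OF z] \<tau>(1) by blast
    have nz: "linear_form (a i) x \<noteq> 0" if "i < C" for i
      using xv(2) xv(3)[of i] xv(4) that \<tau>(2) by (cases "i = 2 * n") auto
    have "0 < C" using C by simp
    then have x: "x \<notin> \<H>" "x \<noteq> 0" using nz nz[of 0] c_le by (auto simp: not_in_\<H>)
    have ratio: "linear_form (a i) v / linear_form (a i) x = \<mu> z i" if "i \<le> 2 * n" for i
    proof (cases "i = 2 * n")
      case True
      have "\<mu> z i = inverse \<tau>" using True k by (simp add: \<mu>_def Y_def w_def)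
      moreover have "linear_form (a i) x = \<tau> * linear_form (a i) v" using xv(2) True by simp
      moreover have "linear_form (a i) v \<noteq> 0" using xv(4) True by simp
      ultimately show ?thesis using \<tau>(2) by (simp only:) (simp add: divide_simps)
    next
      case False
      then show ?thesis using xv(1)[of i] nz[of i] that C by simp
    qed
    have \<omega>: "tangent_point x v (\<omega> j) = Y z j" if j: "j < 2 * n" for j
    proof -
      have "\<omega> j \<in> \<Omega> (- {0})" unfolding \<omega>_def using j c by (intro dlog_ratio_log_cotangent) auto
      then have "tangent_point x v (\<omega> j) = linear_form (\<omega> j x) v"
        using germI[OF proj_open_nonzero] x by (simp add: tangent_point_def)
      also have "\<dots> = linear_form (a (Suc j)) v / linear_form (a (Suc j)) x - linear_form (a 0) v / linear_form (a 0) x"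
        using x by (simp add: \<omega>_def dlog_ratio_def divide_inverse mult.commute)
      also have "\<dots> = \<mu> z (Suc j) - \<mu> z 0" using ratio[of "Suc j"] ratio[of 0] j by simp
      finally show ?thesis by (simp add: \<mu>_def)
    qed
    have "v \<noteq> t *s x" for t
    proof
      assume "v = t *s x"
      then have "tangent_point x v (\<omega> k) = 0" by (simp add: tangent_point_radial)
      then show False using \<omega>[of k] w[of k] k by (simp add: Y_def)
    qed
    then have "(x, tangent_point x v) \<in> rank_one_quotients \<Omega>" by (rule tangent_point_rank_one[OF x(2,1)])
    then have "s N (x, tangent_point x v) = \<kappa> N * z ^ N" if "N < M" for N
      using \<omega> by (simp add: s_def flip: Y[OF that])
    then show ?thesis by blast
  qed
  have "enat M \<le> fun_dim (taut_sections \<Omega> m)"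
  proof (rule fun_dim_ge[of M s])
    fix u N assume u: "\<And>y. (\<Sum>N<M. u N * s N y) = 0" and N: "N < M"
    define q where "q = (\<Sum>N<M. monom (u N * \<kappa> N) N)"
    have "poly q z = 0" if zA: "z \<in> A" for z
    proof -
      obtain y where y: "\<forall>N<M. s N y = \<kappa> N * z ^ N" using points[OF zA] by blast
      have "poly q z = (\<Sum>N<M. u N * s N y)"
        unfolding q_def poly_sum poly_monom by (intro sum.cong) (use y in auto)
      then show ?thesis using u by simp
    qed
    then have "A \<subseteq> {z. poly q z = 0}" by blast
    moreover obtain e where "e > 0" "ball 1 e \<subseteq> A" using openE[OF A(1,2)] by blast
    ultimately have ball: "ball 1 e \<subseteq> {z. poly q z = 0}" by auto
    have "q = 0"
    proof (rule ccontr)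
      assume "q \<noteq> 0"
      then have "finite {z. poly q z = 0}" by (rule poly_roots_finite)
      then have "countable (ball (1 :: complex) e)"
        using finite_subset[OF ball] by (intro countable_finite)
      then show False using uncountable_ball[OF \<open>e > 0\<close>] by blast
    qed
    then have "coeff q N = 0" by simp
    moreover have "coeff q N = u N * \<kappa> N"
      using N by (simp add: q_def coeff_sum coeff_monom if_distrib cong: if_cong)
    ultimately show "u N = 0" using \<kappa> by simp
  qed (rule s)
  then show ?thesis by (simp add: M_def b_def k_def)
qed

end

section \<open>General tuples of hyperplanes\<close>

definition coord_index :: "'n::finite \<Rightarrow> nat" where
  "coord_index = (SOME f. bij_betw f UNIV {..<CARD('n)})"

lemma coord_index_bij: "bij_betw (coord_index :: 'n::finite \<Rightarrow> nat) UNIV {..<CARD('n)}"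
proof -
  have "\<exists>f :: 'n \<Rightarrow> nat. bij_betw f UNIV {..<CARD('n)}"
    by (intro finite_same_card_bij) auto
  then show ?thesis unfolding coord_index_def by (rule someI_ex)
qed

text \<open>
  The moment curve provides infinitely many points in general position, by the nonvanishing of
  Vandermonde determinants.
\<close>

definition moment :: "nat \<Rightarrow> complex ^ 'n" where
  "moment i = (\<chi> k. of_nat i ^ coord_index k)"

lemma det_moment_nonzero:
  fixes \<sigma> :: "'n::finite \<Rightarrow> nat"
  assumes "inj \<sigma>"
  shows "det ((\<chi> k. moment (\<sigma> k)) :: complex ^ 'n ^ 'n) \<noteq> 0"
proof -
  let ?A = "(\<chi> k. moment (\<sigma> k)) :: complex ^ 'n ^ 'n"
  note idx = coord_index_bij[where 'n = 'n]
  have "w = 0" if "?A *v w = 0" for w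
  proof -
    \<comment> \<open>a vector in the kernel is a polynomial of degree less than \<open>CARD('n)\<close> with \<open>CARD('n)\<close> roots\<close>
    define q where "q = (\<Sum>l\<in>UNIV. monom (w $ l) (coord_index l))"
    have "degree q < CARD('n)"
      unfolding q_def
    proof (rule degree_sum_less)
      fix l :: 'n
      have "coord_index l < CARD('n)" using idx by (auto simp: bij_betw_def)
      then show "degree (monom (w $ l) (coord_index l)) < CARD('n)"
        using degree_monom_le le_less_trans by blast
    qed simp
    moreover have "poly q z = 0" if z_in: "z \<in> (\<lambda>k. of_nat (\<sigma> k)) ` UNIV" for z
    proof -
      obtain k where z: "z = of_nat (\<sigma> k)" using z_in by blast
      have "poly q z = (?A *v w) $ k"
        by (simp add: q_def poly_sum poly_monom z matrix_vector_mult_def moment_def mult.commute)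
      then show ?thesis using \<open>?A *v w = 0\<close> by simp
    qed
    moreover have "card (range (\<lambda>k. of_nat (\<sigma> k) :: complex)) = CARD('n)"
      using assms by (intro card_image) (auto simp: inj_on_def)
    ultimately have "q = 0" by (intro poly_zero_if_many_roots[of "range (\<lambda>k. of_nat (\<sigma> k))"]) auto
    have "w $ l = 0" for l
    proof -
      have "inj (coord_index :: 'n \<Rightarrow> nat)" using idx by (auto simp: bij_betw_def)
      then have "coeff q (coord_index l) = (\<Sum>j\<in>UNIV. if j = l then w $ j else 0)"
        unfolding q_def coeff_sum coeff_monom by (intro sum.cong) (auto simp: inj_eq)
      then show ?thesis using \<open>q = 0\<close> by simp
    qed
    then show "w = 0" by (simp add: vec_eq_iff)
  qed
  then have "\<exists>B. B ** ?A = mat 1" using matrix_left_invertible_ker by blast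
  then have "invertible ?A" by (simp add: invertible_left_inverse)
  then show ?thesis by (simp add: invertible_det_nz)
qed

lemma moment_nonzero: "moment i \<noteq> (0 :: complex ^ 'n)"
proof
  assume zero: "moment i = (0 :: complex ^ 'n)"
  have "0 \<in> coord_index ` (UNIV :: 'n set)"
    using coord_index_bij[where 'n = 'n] zero_less_card_finite[where 'a = 'n] by (auto simp: bij_betw_def)
  then obtain k :: 'n where "coord_index k = 0" by auto
  then have "(moment i :: complex ^ 'n) $ k = 1" by (simp add: moment_def)
  then show False using zero by simp
qed

text \<open>
  Hyperplanes on the moment curve serve as the auxiliary ones, so that a general tuple has to be
  general also with respect to these.
\<close>

definition pad :: "nat \<Rightarrow> (nat \<Rightarrow> complex ^ 'n) \<Rightarrow> nat \<Rightarrow> complex ^ 'n" where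
  "pad c a i = (if i < c then a i else moment i)"

definition index_maps :: "nat \<Rightarrow> ('n::finite \<Rightarrow> nat) set" where
  "index_maps C = {\<sigma>. inj \<sigma> \<and> range \<sigma> \<subseteq> {..<C}}"

lemma finite_index_maps: "finite (index_maps C :: ('n::finite \<Rightarrow> nat) set)"
proof (rule finite_subset)
  show "index_maps C \<subseteq> (UNIV :: 'n set) \<rightarrow>\<^sub>E {..<C}" by (auto simp: index_maps_def)
qed (simp add: finite_PiE)

text \<open>
  The multihomogeneous polynomial whose nonvanishing locus is the open set of tuples in the theorem:
  the product of all maximal minors of the padded tuple.
\<close>

definition position_form :: "nat \<Rightarrow> nat \<Rightarrow> (nat \<Rightarrow> complex ^ 'n) \<Rightarrow> complex" where
  "position_form c C a = (\<Prod>\<sigma>\<in>index_maps C. det (\<chi> k. pad c a (\<sigma> k)))"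

lemma polynomials_sum:
  "finite K \<Longrightarrow> (\<And>k. k \<in> K \<Longrightarrow> P k \<in> polynomials X) \<Longrightarrow> (\<lambda>y. \<Sum>k\<in>K. P k y) \<in> polynomials X"
  by (induction K rule: finite_induct) (auto intro: polynomials.const polynomials.add)

lemma polynomials_prod:
  "finite K \<Longrightarrow> (\<And>k. k \<in> K \<Longrightarrow> P k \<in> polynomials X) \<Longrightarrow> (\<lambda>y. \<Prod>k\<in>K. P k y) \<in> polynomials X"
  by (induction K rule: finite_induct) (auto intro: polynomials.const polynomials.mult)

lemma position_form_multiform:
  "(position_form c C :: (nat \<Rightarrow> complex ^ 'n) \<Rightarrow> complex) \<in> multiforms c (\<lambda>i. card {\<sigma> \<in> index_maps C :: ('n::finite \<Rightarrow> nat) set. i \<in> range \<sigma>})"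
  for c C :: nat
  unfolding multiforms_def
proof (intro CollectI conjI allI)
  let ?X = "{\<lambda>a :: nat \<Rightarrow> complex ^ 'n. a i $ k | i k. i < c}"
  have entry: "(\<lambda>a. pad c a i $ k) \<in> polynomials ?X" for i k
    by (cases "i < c") (auto simp: pad_def intro: polynomials.coord polynomials.const)
  show "position_form c C \<in> polynomials ?X"
    unfolding position_form_def[abs_def] det_def vec_lambda_beta
    by (intro polynomials_prod polynomials_sum polynomials.mult polynomials.const finite_index_maps
        entry finite_permutations finite)
next
  fix t :: "nat \<Rightarrow> complex" and a :: "nat \<Rightarrow> complex ^ 'n"
  define r where "r i = (if i < c then t i else 1)" for i
  have pad: "pad c (\<lambda>i. t i *s a i) i = r i *s pad c a i" for i
    by (simp add: pad_def r_def)
  have det: "det (\<chi> k. pad c (\<lambda>i. t i *s a i) (\<sigma> k)) =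
      (\<Prod>i<c. if i \<in> range \<sigma> then t i else 1) * det (\<chi> k. pad c a (\<sigma> k))"
    if \<sigma>: "\<sigma> \<in> index_maps C" for \<sigma> :: "'n \<Rightarrow> nat"
  proof -
    have "(\<Prod>k\<in>UNIV. r (\<sigma> k)) = (\<Prod>i\<in>range \<sigma>. r i)"
      using \<sigma> by (simp add: index_maps_def prod.reindex)
    also have "\<dots> = (\<Prod>i\<in>range \<sigma> \<inter> {..<c}. t i)"
      by (intro prod.mono_neutral_cong_right) (auto simp: r_def)
    also have "\<dots> = (\<Prod>i<c. if i \<in> range \<sigma> then t i else 1)"
      by (simp add: prod.If_cases Int_commute)
    finally show ?thesis unfolding pad by (simp add: det_rows_mul)
  qed
  have "(\<Prod>\<sigma>\<in>index_maps C. \<Prod>i<c. if i \<in> range (\<sigma> :: 'n \<Rightarrow> nat) then t i else 1) =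
      (\<Prod>i<c. t i ^ card {\<sigma> \<in> index_maps C :: ('n \<Rightarrow> nat) set. i \<in> range \<sigma>})"
  proof (subst prod.swap, intro prod.cong refl)
    fix i
    show "(\<Prod>\<sigma>\<in>index_maps C. if i \<in> range (\<sigma> :: 'n \<Rightarrow> nat) then t i else 1) =
        t i ^ card {\<sigma> \<in> index_maps C :: ('n \<Rightarrow> nat) set. i \<in> range \<sigma>}"
      by (subst prod.inter_filter[OF finite_index_maps, symmetric]) (rule prod_constant)
  qed
  then show "position_form c C (\<lambda>i. t i *s a i) =
      (\<Prod>i<c. t i ^ card {\<sigma> \<in> index_maps C :: ('n \<Rightarrow> nat) set. i \<in> range \<sigma>}) * position_form c C a"
    by (simp add: position_form_def det prod.distrib cong: prod.cong)
qed

lemma position_form_general_position: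
  fixes a :: "nat \<Rightarrow> complex ^ 'n"
  assumes nz: "position_form c C a \<noteq> 0" and C: "CARD('n) \<le> C"
  shows "general_position C (pad c a)"
  unfolding general_position_def
proof (intro allI impI)
  fix J assume J: "J \<subseteq> {..<C}" "card J = min C CARD('n)"
  then have card: "card J = CARD('n)" and fin: "finite J" using C finite_subset by (auto simp: min_def)
  then obtain \<sigma> :: "'n \<Rightarrow> nat" where \<sigma>: "bij_betw \<sigma> UNIV J"
    using finite_same_card_bij[of "UNIV :: 'n set" J] by auto
  let ?A = "\<chi> k. pad c a (\<sigma> k)"
  have "\<sigma> \<in> index_maps C" using \<sigma> J(1) by (auto simp: index_maps_def bij_betw_def)
  then have det: "det ?A \<noteq> 0" using nz by (auto simp: position_form_def finite_index_maps)
  have "rows ?A = pad c a ` J"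
    using \<sigma> by (auto simp: rows_def row_def bij_betw_def)
  then have "vec.independent (pad c a ` J)" using det_dependent_rows[of ?A] det by auto
  moreover have "inj_on (pad c a) J"
  proof (rule inj_onI, rule ccontr)
    fix i j assume ij: "i \<in> J" "j \<in> J" "pad c a i = pad c a j" "i \<noteq> j"
    then obtain k l where "i = \<sigma> k" "j = \<sigma> l" using \<sigma> unfolding bij_betw_def by blast
    then have "k \<noteq> l" "row k ?A = row l ?A" using ij by (auto simp: row_def)
    then show False using det_identical_rows det by blast
  qed
  ultimately show "inj_on (pad c a) J \<and> vec.independent (pad c a ` J)" by blast
qed

lemma general_position_initial:
  fixes a :: "nat \<Rightarrow> complex ^ 'n"
  assumes "general_position C (pad c a)" "CARD('n) \<le> C" "c \<le> C"
  shows "general_position c a"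
  unfolding general_position_def
proof (intro allI impI)
  fix J assume J: "J \<subseteq> {..<c}" "card J = min c CARD('n)"
  obtain K where K: "J \<subseteq> K" "K \<subseteq> {..<C}" "card K = CARD('n)"
  proof -
    have "J \<subseteq> {..<C}" using J(1) assms(3) by auto
    then show ?thesis using exists_subset_between[of J "CARD('n)" "{..<C}"] J(2) assms(2) that by auto
  qed
  have "inj_on (pad c a) K" "vec.independent (pad c a ` K)"
    using assms K unfolding general_position_def by (auto simp: min_def)
  then have "inj_on (pad c a) J" "vec.independent (pad c a ` J)"
    using K(1) inj_on_subset vec.independent_mono image_mono by metis+
  moreover have "pad c a ` J = a ` J" "inj_on (pad c a) J = inj_on a J"
    using J(1) by (auto simp: pad_def intro!: image_cong inj_on_cong)
  ultimately show "inj_on a J \<and> vec.independent (a ` J)" by simp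
qed

lemma log_cotangent_cong:
  assumes "\<And>i. i < c \<Longrightarrow> a i = a' i"
  shows "log_cotangent c a = log_cotangent c a'"
proof -
  have "hyperplane_sum c a = hyperplane_sum c a'" using assms by (auto simp: hyperplane_sum_def)
  moreover have "log_indices c a b h = log_indices c a' b h" for b h
    using assms by (auto simp: log_indices_def image_iff)
  ultimately show ?thesis
    by (simp add: log_cotangent_def[abs_def] adapted_coords_def log_frame_def[abs_def])
qed


section \<open>Growth of the number of sections\<close>

text \<open>
  A bound of order \<open>m ^ (2n - 2)\<close> is one order too small for bigness.
\<close>

lemma not_big_if_small:
  assumes n: "n > 0" and bound: "\<And>m. m > 0 \<Longrightarrow> fun_dim (\<Gamma> m) \<le> enat ((2 * n * (m + 1) + 1) ^ (2 * n - 2))"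
  shows "\<not> big_line_bundle (2 * n - 1) \<Gamma>"
proof -
  define K where "K = real (5 * n) ^ (2 * n - 2)"
  have "eventually (\<lambda>m. ereal_of_enat (fun_dim (\<Gamma> m)) / ereal (real m ^ (2 * n - 1)) \<le> ereal (K / real m)) sequentially"
    using eventually_gt_at_top[of 0]
  proof eventually_elim
    case (elim m)
    have "2 * n * (m + 1) + 1 \<le> 5 * n * m"
    proof -
      have "2 * n \<le> 2 * n * m" "1 \<le> n * m" using elim n by auto
      moreover have "2 * n * (m + 1) + 1 = 2 * n * m + 2 * n + 1" "5 * n * m = 2 * n * m + 2 * n * m + n * m" by algebra+
      ultimately show ?thesis by linarith
    qed
    then have "(2 * n * (m + 1) + 1) ^ (2 * n - 2) \<le> (5 * n * m) ^ (2 * n - 2)" by (rule power_mono) simp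
    then have "fun_dim (\<Gamma> m) \<le> enat ((5 * n * m) ^ (2 * n - 2))"
      using bound[OF elim] by (metis enat_ord_simps(1) order_trans)
    then have "ereal_of_enat (fun_dim (\<Gamma> m)) \<le> ereal_of_enat (enat ((5 * n * m) ^ (2 * n - 2)))"
      by (simp only: ereal_of_enat_le_iff)
    also have "\<dots> = ereal (K * real m ^ (2 * n - 2))" by (simp add: K_def power_mult_distrib)
    finally have "ereal_of_enat (fun_dim (\<Gamma> m)) / ereal (real m ^ (2 * n - 1)) \<le>
        ereal (K * real m ^ (2 * n - 2)) / ereal (real m ^ (2 * n - 1))"
      using elim by (intro ereal_divide_right_mono) auto
    also have "\<dots> = ereal (K * real m ^ (2 * n - 2) / real m ^ (2 * n - 1))" using elim by simp
    also have "K * real m ^ (2 * n - 2) / real m ^ (2 * n - 1) = K / real m"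
    proof -
      have "2 * n - 1 = Suc (2 * n - 2)" using n by simp
      then show ?thesis using elim by simp
    qed
    finally show ?case .
  qed
  then have "limsup (\<lambda>m. ereal_of_enat (fun_dim (\<Gamma> m)) / ereal (real m ^ (2 * n - 1))) \<le> limsup (\<lambda>m. ereal (K / real m))"
    by (rule Limsup_mono)
  also have "limsup (\<lambda>m. ereal (K / real m)) = 0"
  proof (rule lim_imp_Limsup)
    have "(\<lambda>m. K / real m) \<longlonglongrightarrow> 0" by (rule lim_const_over_n)
    then show "(\<lambda>m. ereal (K / real m)) \<longlonglongrightarrow> 0" by (simp add: zero_ereal_def)
  qed simp
  finally show ?thesis by (simp add: big_line_bundle_def not_less)
qed

lemma big_if_large:
  assumes n: "n > 0" and bound: "\<And>m. enat ((m div (2 * n) + 1) ^ (2 * n - 1)) \<le> fun_dim (\<Gamma> m)"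
  shows "big_line_bundle (2 * n - 1) \<Gamma>"
proof -
  define K where "K = 1 / real (2 * n) ^ (2 * n - 1)"
  have "eventually (\<lambda>m. ereal K \<le> ereal_of_enat (fun_dim (\<Gamma> m)) / ereal (real m ^ (2 * n - 1))) sequentially"
    using eventually_gt_at_top[of 0]
  proof eventually_elim
    case (elim m)
    have "real m \<le> real (2 * n) * real (m div (2 * n) + 1)"
    proof -
      have "m < 2 * n * (m div (2 * n) + 1)" using n by (simp add: dividend_less_times_div)
      then show ?thesis by (metis less_imp_le of_nat_le_iff of_nat_mult)
    qed
    then have "real m ^ (2 * n - 1) \<le> (real (2 * n) * real (m div (2 * n) + 1)) ^ (2 * n - 1)"
      by (rule power_mono) simp
    moreover have "0 < real (2 * n) ^ (2 * n - 1)" using n by simp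
    ultimately have "real m ^ (2 * n - 1) / real (2 * n) ^ (2 * n - 1) \<le> real (m div (2 * n) + 1) ^ (2 * n - 1)"
      by (simp only: pos_divide_le_eq power_mult_distrib mult.commute)
    then have "K * real m ^ (2 * n - 1) \<le> real ((m div (2 * n) + 1) ^ (2 * n - 1))"
      by (simp add: K_def)
    then have "ereal (K * real m ^ (2 * n - 1)) \<le> ereal_of_enat (enat ((m div (2 * n) + 1) ^ (2 * n - 1)))" by simp
    also have "\<dots> \<le> ereal_of_enat (fun_dim (\<Gamma> m))" using bound by (simp only: ereal_of_enat_le_iff)
    finally have "ereal (K * real m ^ (2 * n - 1)) / ereal (real m ^ (2 * n - 1)) \<le>
        ereal_of_enat (fun_dim (\<Gamma> m)) / ereal (real m ^ (2 * n - 1))"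
      using elim by (intro ereal_divide_right_mono) auto
    then show ?case using elim by simp
  qed
  then have "ereal K \<le> limsup (\<lambda>m. ereal_of_enat (fun_dim (\<Gamma> m)) / ereal (real m ^ (2 * n - 1)))"
    by (intro le_Limsup) auto
  moreover have "0 < ereal K" using n by (simp add: K_def)
  ultimately show ?thesis unfolding big_line_bundle_def by (rule less_le_trans[rotated])
qed

theorem theoremC:
  fixes n c :: nat
  assumes "CARD('n) = n + 1" and "n \<ge> 2"
  shows "\<exists>G :: (nat \<Rightarrow> complex ^ 'n) set.
    multiproj_open c G \<and> G \<noteq> {} \<and>
    (\<forall>a\<in>G. general_position c a \<and>
       (big_vector_bundle n (log_cotangent c a) \<longleftrightarrow> c \<ge> 2 * n + 1))"
proof (intro exI conjI ballI)
  define C where "C = max c (2 * n + 1)"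
  define G where "G = {a :: nat \<Rightarrow> complex ^ 'n. a \<in> {..<c} \<rightarrow>\<^sub>E - {0} \<and> position_form c C a \<noteq> 0}"
  have C: "CARD('n) \<le> C" "c \<le> C" "2 * n + 1 \<le> C" using assms by (auto simp: C_def)
  show "multiproj_open c G"
    unfolding multiproj_open_def G_def
    using position_form_multiform by (intro exI[of _ "{position_form c C}"]) blast
  show "G \<noteq> {}"
  proof -
    have "pad c (restrict moment {..<c}) = (moment :: nat \<Rightarrow> complex ^ 'n)" by (auto simp: pad_def fun_eq_iff)
    then have "position_form c C (restrict moment {..<c} :: nat \<Rightarrow> complex ^ 'n) \<noteq> 0"
      by (auto simp: position_form_def finite_index_maps) (auto simp: index_maps_def det_moment_nonzero)
    then have "restrict moment {..<c} \<in> G" using moment_nonzero by (auto simp: G_def)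
    then show ?thesis by blast
  qed
  fix a assume "a \<in> G"
  then have gp: "general_position C (pad c a)"
    using position_form_general_position C(1) by (auto simp: G_def)
  show "general_position c a" by (rule general_position_initial[OF gp C(1,2)])
  interpret arrangement c C "pad c a" by unfold_locales (use gp C in auto)
  have eq: "log_cotangent c a = log_cotangent c (pad c a)" by (rule log_cotangent_cong) (simp add: pad_def)
  have exponent: "(CARD('n) - 1) + (n - 1) = 2 * n - 1" using assms by simp
  show "big_vector_bundle n (log_cotangent c a) \<longleftrightarrow> c \<ge> 2 * n + 1"
  proof (cases "c \<ge> 2 * n + 1")
    case True
    then show ?thesis
      unfolding big_vector_bundle_def exponent eq
      using big_if_large[OF _ many_sections[OF assms(1) _ True]] assms by simp
  next
    case False
    then show ?thesis
      unfolding big_vector_bundle_def exponent eq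
      using not_big_if_small[OF _ few_sections[OF assms C(3)]] assms by simp
  qed
qed

end
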